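(* Let $\mathbb{M}=(M_j)_{j\in\mathbb{N}_0}$ be a sequence of positive real numbers with $M_0=1$ and let $0<\alpha\le1$ be such that $\lim_{j\to+\infty}\big(j^{(1-\alpha)j}M_j\big)^{1/j}=\infty$. Let $\mathbb{M}^{(\alpha)}:=\overline{\mathbb{G}}^{\alpha-1}\big(\overline{\mathbb{G}}^{1-\alpha}\mathbb{M}\big)^{\mathrm{lc}}$. Then the following assertions are equivalent: (a) The sequence $\mathbb{M}^{(\alpha)}$ has property (rai). (b) The class $\mathcal{A}_{\{\mathbb{M}\}}(S_\alpha)$ is holomorphically closed. (c) The class $\mathcal{A}_{\{\mathbb{M}\}}(S_\alpha)$ is inverse-closed. If in addition $\liminf_{j\to\infty}(M_j/j!)^{1/j}>0$ and the sequence $\mathbb{M}^{(\alpha)}$ satisfies (dc), then (a), (b), (c) are also equivalent to each of: (d) The class $\mathcal{A}_{\{\mathbb{M}\}}(S_\alpha)$ is closed under composition. (e) The sequence $\mathbb{M}^{(\alpha)}$ has property (FdB).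
   Context: $\mathbb{N}_0=\{0,1,2,\dots\}$, $\mathbb{N}=\{1,2,\dots\}$, $0^0:=1$. For $a\in\mathbb{R}$, $\overline{\mathbb{G}}^a:=(j^{ja})_{j\in\mathbb{N}_0}$; products of sequences are termwise. A positive sequence is log-convex if $M_j^2\le M_{j-1}M_{j+1}$ for $j\ge1$; if $\lim_jM_j^{1/j}=\infty$, $\mathbb{M}^{\mathrm{lc}}$ is the log-convex minorant, i.e. the largest log-convex sequence termwise $\le\mathbb{M}$. For a sequence $\mathbb{M}$ with $M_0=1$ write $\check M_j:=M_j/j!$. - (rai): $\exists C>0\ \forall1\le j\le k$: $\check M_j^{1/j}\le C\check M_k^{1/k}$. - (dc): $\exists D\ge1\ \forall j\in\mathbb{N}_0$: $M_{j+1}\le D^{j+1}M_j$. - (FdB): $\exists C,h\ge1\ \forall j\in\mathbb{N}_0$: $\check M^\circ_j\le Ch^j\check M_j$, where $\check M^\circ_0:=1$ and $\check M^\circ_k:=\max\{\check M_\ell\check M_{j_1}\cdots\check M_{j_\ell}:\ell\in\mathbb{N},\ j_i\in\mathbb{N},\ \sum_{i=1}^\ell j_i=k\}$ for $k\ge1$. $\mathcal{R}$ is the Riemann surface of the logarithm and $S_\alpha:=\{z\in\mathcal{R}:|\arg z|<\alpha\pi/2\}$; derivatives are with respect to the coordinate $z$; $\mathcal{H}(\cdot)$ denotes holomorphic functions. $\mathcal{A}_{\{\mathbb{M}\}}(S)$ is the set of $f\in\mathcal{H}(S)$ for which there is $h>0$ with $\sup_{z\in S,j\in\mathbb{N}_0}\frac{|f^{(j)}(z)|}{h^jM_j}<\infty$.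 For $U\subseteq\mathbb{C}$ open, $\mathcal{H}_{\{\mathbb{M}\}}(U)$ is the set of $g\in\mathcal{H}(U)$ such that for each compact $K\subset U$ there is $h>0$ with $\sup_{z\in K,j\in\mathbb{N}_0}\frac{|g^{(j)}(z)|}{h^jM_j}<\infty$. The class $\mathcal{A}:=\mathcal{A}_{\{\mathbb{M}\}}(S_\alpha)$ is: holomorphically closed if $g\circ f\in\mathcal{A}$ for all $f\in\mathcal{A}$ and all $g\in\mathcal{H}(U)$ with $U\subseteq\mathbb{C}$ open containing the closure of the range of $f$; inverse-closed if $1/f\in\mathcal{A}$ for all $f\in\mathcal{A}$ with $\inf_{z\in S_\alpha}|f(z)|>0$; closed under composition if $g\circ f\in\mathcal{A}$ for all $f\in\mathcal{A}$ and all $g\in\mathcal{H}_{\{\mathbb{M}\}}(U)$ with $U\subseteq\mathbb{C}$ open containing the closure of the range of $f$. *)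

theory Defs
  imports "HOL-Complex_Analysis.Complex_Analysis"
begin

(* The sequence j^(j a); the case distinction is needed because 0 powr 0 = 0 in HOL,
   whereas the convention here is 0^0 = 1. *)
definition Gbar :: "real \<Rightarrow> nat \<Rightarrow> real" where
  "Gbar a j = (if j = 0 then 1 else real j powr (real j * a))"

definition log_convex :: "(nat \<Rightarrow> real) \<Rightarrow> bool" where
  "log_convex M \<longleftrightarrow> (\<forall>j. M j > 0) \<and> (\<forall>j\<ge>1. (M j)\<^sup>2 \<le> M (j - 1) * M (j + 1))"

(* The order on sequences is the termwise one. The greatest element exists as soon as
   M is positive and root j (M j) tends to infinity; otherwise the value is irrelevant. *)
definition lc_minorant :: "(nat \<Rightarrow> real) \<Rightarrow> nat \<Rightarrow> real" where
  "lc_minorant M = (GREATEST N. log_convex N \<and> N \<le> M)"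

definition seq_alpha :: "(nat \<Rightarrow> real) \<Rightarrow> real \<Rightarrow> nat \<Rightarrow> real" where
  "seq_alpha M \<alpha> j = Gbar (\<alpha> - 1) j * lc_minorant (\<lambda>i. Gbar (1 - \<alpha>) i * M i) j"

definition seq_check :: "(nat \<Rightarrow> real) \<Rightarrow> nat \<Rightarrow> real" where
  "seq_check M j = M j / fact j"

definition rai :: "(nat \<Rightarrow> real) \<Rightarrow> bool" where
  "rai M \<longleftrightarrow> (\<exists>C>0. \<forall>j k. 1 \<le> j \<and> j \<le> k \<longrightarrow>
      root j (seq_check M j) \<le> C * root k (seq_check M k))"

definition dc :: "(nat \<Rightarrow> real) \<Rightarrow> bool" where
  "dc M \<longleftrightarrow> (\<exists>D\<ge>1. \<forall>j. M (j + 1) \<le> D ^ (j + 1) * M j)"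

(* The list js is the tuple (j_1, ..., j_l). Only finitely many lists of positive
   integers have sum k, so Max ranges over a finite set, nonempty for k >= 1. *)
definition seq_check_circ :: "(nat \<Rightarrow> real) \<Rightarrow> nat \<Rightarrow> real" where
  "seq_check_circ M k = (if k = 0 then 1 else
     Max {seq_check M (length js) * prod_list (map (seq_check M) js) | js.
            length js \<ge> 1 \<and> (\<forall>i\<in>set js. i \<ge> 1) \<and> sum_list js = k})"

definition FdB :: "(nat \<Rightarrow> real) \<Rightarrow> bool" where
  "FdB M \<longleftrightarrow> (\<exists>C\<ge>1. \<exists>h\<ge>1. \<forall>j. seq_check_circ M j \<le> C * h ^ j * seq_check M j)"

(* For 0 < \<alpha> <= 1 the sector lies in the principal sheet of the Riemann surface of the
   logarithm, which is identified with a subset of the complex plane. Arg 0 = 0 in the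
   library, so 0 has to be removed. *)
definition sector :: "real \<Rightarrow> complex set" where
  "sector \<alpha> = {z. z \<noteq> 0 \<and> \<bar>Arg z\<bar> < \<alpha> * pi / 2}"

(* Functions on an open set S are represented by total functions; the values outside S are
   irrelevant, since membership in either class below only depends on the values on S. *)
definition ultraholomorphic_class :: "(nat \<Rightarrow> real) \<Rightarrow> complex set \<Rightarrow> (complex \<Rightarrow> complex) set" where
  "ultraholomorphic_class M S = {f. f holomorphic_on S \<and>
     (\<exists>h>0. bdd_above {norm ((deriv ^^ j) f z) / (h ^ j * M j) | z j. z \<in> S})}"

definition local_holomorphic_class :: "(nat \<Rightarrow> real) \<Rightarrow> complex set \<Rightarrow> (complex \<Rightarrow> complex) set" where
  "local_holomorphic_class M U = {g. g holomorphic_on U \<and>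
     (\<forall>K. compact K \<and> K \<subseteq> U \<longrightarrow>
       (\<exists>h>0. bdd_above {norm ((deriv ^^ j) g z) / (h ^ j * M j) | z j. z \<in> K}))}"

definition holomorphically_closed :: "(nat \<Rightarrow> real) \<Rightarrow> real \<Rightarrow> bool" where
  "holomorphically_closed M \<alpha> \<longleftrightarrow>
     (\<forall>f \<in> ultraholomorphic_class M (sector \<alpha>). \<forall>U g.
        open U \<and> closure (f ` sector \<alpha>) \<subseteq> U \<and> g holomorphic_on U \<longrightarrow>
        g \<circ> f \<in> ultraholomorphic_class M (sector \<alpha>))"

definition inverse_closed :: "(nat \<Rightarrow> real) \<Rightarrow> real \<Rightarrow> bool" where
  "inverse_closed M \<alpha> \<longleftrightarrow>
     (\<forall>f \<in> ultraholomorphic_class M (sector \<alpha>).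
        (INF z\<in>sector \<alpha>. norm (f z)) > 0 \<longrightarrow>
        (\<lambda>z. 1 / f z) \<in> ultraholomorphic_class M (sector \<alpha>))"

definition composition_closed :: "(nat \<Rightarrow> real) \<Rightarrow> real \<Rightarrow> bool" where
  "composition_closed M \<alpha> \<longleftrightarrow>
     (\<forall>f \<in> ultraholomorphic_class M (sector \<alpha>). \<forall>U g.
        open U \<and> closure (f ` sector \<alpha>) \<subseteq> U \<and> g \<in> local_holomorphic_class M U \<longrightarrow>
        g \<circ> f \<in> ultraholomorphic_class M (sector \<alpha>))"

end

theory Submission
  imports Defs "HOL-Real_Asymp.Real_Asymp"
begin

text \<open>
  Write \<open>L\<close> for the log-convex minorant of \<open>j powr (j * (1 - \<alpha>)) * M j\<close> and \<open>N\<close> for the sequence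
  \<open>seq_alpha M \<alpha>\<close>, that is \<open>N j = j powr (j * (\<alpha> - 1)) * L j\<close>.

  The classes of \<open>M\<close> and \<open>N\<close> on the sector coincide. At the corner of the sector a polynomial of degree
  \<open>n\<close> satisfies a Bernstein-Walsh inequality with exponent \<open>1 / (2 - \<alpha>)\<close>. Applied to Taylor polynomials it
  gives a Kolmogorov inequality, by which \<open>j powr (j * (1 - \<alpha>))\<close> times the supremum of the \<open>j\<close>-th derivative
  is log-convex up to a factor \<open>C ^ j\<close>. It therefore suffices to bound the derivatives at the indices where
  the minorant touches the sequence.

  That (rai) for \<open>N\<close> makes the class holomorphically closed follows from the composition of power
  series. Conversely, put \<open>\<beta> = 2 - \<alpha>\<close>. The canonical product \<open>F\<close> with zeros \<open>1, 2 powr \<beta>, 3 powr \<beta>, \<dots>\<close>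
  (or \<open>exp (- z)\<close> if \<open>\<alpha> = 1\<close>) is bounded on the sector and has order \<open>1 / \<beta>\<close>, so that its \<open>j\<close>-th derivative
  is there of size \<open>j powr (j * (\<alpha> - 1))\<close>; at the origin this is attained, with sign \<open>(-1) ^ j\<close>. A sum of
  dilates of \<open>F\<close> is a function \<open>f\<close> in the class of \<open>N\<close> whose derivatives at the vertex are as large as \<open>N\<close>
  permits. The power series of \<open>1 / (c - f)\<close> at the vertex dominates all powers of the coefficients of \<open>f\<close>, and
  if the class is inverse-closed this yields (rai).

  A lower bound \<open>\<epsilon> * c ^ j * fact j \<le> M j\<close> makes every holomorphic function belong to the local class,
  and passes to \<open>N\<close>. Together with (dc), which absorbs the shift from \<open>j\<close> to \<open>j - 1\<close> in each factor, it
  turns (rai) and (FdB) into one another.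
\<close>

section \<open>Logarithmically convex sequences\<close>

text \<open>The weight \<open>j powr (j * (1 - \<alpha>))\<close> originates at the corner. A
  polynomial of degree \<open>n\<close> that is bounded on the part of the sector within distance
  \<open>d\<close> of the vertex grows by at most \<open>C ^ k\<close> on the circle of radius
  \<open>d * (k / n) powr (2 - \<alpha>)\<close>, but Cauchy's estimate on so small a circle loses
  \<open>(n / k) powr ((2 - \<alpha>) * k)\<close>. With \<open>d\<close> proportional to
  \<open>n\<close>, the factorial \<open>fact k\<close> makes up for \<open>(n / k) ^ k\<close> of
  this. The obstacle in the converse is cancellation. (rai) can be read off
  \<open>1 / (c - f)\<close> if all products of Taylor coefficients contribute with one sign; the
  signs \<open>(-1) ^ j\<close> achieve this because they are multiplicative under convolution, and
  a product with positive zeros has them. The delicate point is boundedness on the sector. It ties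
  the exponent of the zeros to the angle: on the boundary rays the logarithm of the modulus is a
  rescaled Riemann sum of an integral, which vanishes for \<open>\<beta> = 2 - \<alpha>\<close>. The
  vertex lies outside the open sector, so derivatives there are limits along the positive
  axis.\<close>

lemma attains_min_of_filterlim_at_top:
  fixes u :: "nat \<Rightarrow> real"
  assumes "filterlim u at_top sequentially"
  shows "\<exists>m\<ge>k. \<forall>i\<ge>k. u m \<le> u i"
proof -
  obtain n where n: "\<And>i. i \<ge> n \<Longrightarrow> u i \<ge> u k"
    using assms by (auto simp: filterlim_at_top eventually_sequentially)
  define m where "m = arg_min_on u {k..max k n}"
  have "m \<in> {k..max k n}" "\<And>i. i \<in> {k..max k n} \<Longrightarrow> u m \<le> u i"
    unfolding m_def by (rule arg_min_if_finite(1), simp, simp)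
      (rule arg_min_least, auto)
  moreover have "u m \<le> u i" if "i \<ge> k" for i
  proof (cases "i \<le> max k n")
    case True
    then show ?thesis using that calculation(2) by auto
  next
    case False
    then have "u i \<ge> u k" using n by auto
    moreover have "u m \<le> u k" using \<open>\<And>i. i \<in> {k..max k n} \<Longrightarrow> u m \<le> u i\<close> by auto
    ultimately show ?thesis by linarith
  qed
  ultimately show ?thesis by auto
qed

text \<open>The induction walks along the lower convex hull of the graph of \<open>y\<close>. When
  \<open>j\<close> is the right end of the current edge, the next edge leads to an index of minimal
  slope, which exists because the slopes tend to infinity.\<close>

lemma supporting_line:
  fixes y :: "nat \<Rightarrow> real"
  assumes lim: "filterlim (\<lambda>j. y j / real j) at_top sequentially"
  shows "\<exists>p q c s. p \<le> j \<and> j \<le> q \<and> (\<forall>i. c + s * real i \<le> y i) \<and>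
      y p = c + s * real p \<and> y q = c + s * real q"
proof (induction j)
  have slope: "\<exists>q>k. \<forall>i>k. (y q - y k) / (real q - real k) \<le> (y i - y k) / (real i - real k)" for k
  proof -
    have "filterlim (\<lambda>j. (y j - y k) / (real j - real k)) at_top sequentially"
    proof -
      have a: "(\<lambda>j. real j / (real j - real k)) \<longlonglongrightarrow> 1" by real_asymp
      have b: "(\<lambda>j. - y k / (real j - real k)) \<longlonglongrightarrow> 0" by real_asymp
      have "filterlim (\<lambda>j. (real j / (real j - real k)) * (y j / real j) + (- y k / (real j - real k)))
          at_top sequentially"
        using filterlim_tendsto_add_at_top[OF b filterlim_tendsto_pos_mult_at_top[OF a _ lim]]
        by (simp add: add.commute)
      moreover have "\<forall>\<^sub>F j in sequentially. (real j / (real j - real k)) * (y j / real j) +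
          (- y k / (real j - real k)) = (y j - y k) / (real j - real k)"
        using eventually_gt_at_top[of 0] by eventually_elim (simp add: diff_divide_distrib)
      ultimately show ?thesis by (rule filterlim_cong[THEN iffD1, OF refl refl, rotated])
    qed
    from attains_min_of_filterlim_at_top[OF this, of "Suc k"] show ?thesis
      by (metis Suc_le_eq)
  qed
  {
    case 0
    obtain q where "q > 0" and q: "\<And>i. i > 0 \<Longrightarrow> (y q - y 0) / real q \<le> (y i - y 0) / real i"
      using slope[of 0] by auto
    have "y 0 + (y q - y 0) / real q * real i \<le> y i" for i
      using q[of i] by (cases "i = 0") (auto simp: field_simps)
    then show ?case by (intro exI[of _ 0] exI[of _ "y 0"] exI[of _ "(y q - y 0) / real q"]) auto
  next
    case (Suc j)
    then obtain p q c s where *: "p \<le> j" "j \<le> q" "\<And>i. c + s * real i \<le> y i"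
      "y p = c + s * real p" "y q = c + s * real q" by blast
    show ?case
    proof (cases "q = j")
      case False
      then show ?thesis using *
        by (intro exI[of _ p] exI[of _ q] exI[of _ c] exI[of _ s]) auto
    next
      case True
      obtain m where "m > j" and m: "\<And>i. i > j \<Longrightarrow>
          (y m - y j) / (real m - real j) \<le> (y i - y j) / (real i - real j)"
        using slope[of j] by auto
      define s' where "s' = (y m - y j) / (real m - real j)"
      have ym: "y m = y j + s' * (real m - real j)" using \<open>m > j\<close> by (simp add: s'_def)
      have "s * (real m - real j) \<le> s' * (real m - real j)"
        using *(3)[of m] *(5) True ym by (simp add: algebra_simps)
      then have ss: "s \<le> s'" using \<open>m > j\<close> by simp
      have "y j + s' * (real i - real j) \<le> y i" for i
      proof (cases "i > j")
        case True
        then show ?thesis using m[OF True] by (simp add: s'_def[symmetric] field_simps)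
      next
        case False
        then have "s' * (real i - real j) \<le> s * (real i - real j)"
          using ss by (intro mult_right_mono_neg) auto
        then show ?thesis using *(3)[of i] *(5) True by (simp add: algebra_simps)
      qed
      then show ?thesis using \<open>m > j\<close> ym
        by (intro exI[of _ j] exI[of _ m] exI[of _ "y j - s' * real j"] exI[of _ s'])
          (auto simp: algebra_simps)
    qed
  }
qed

lemma affine_le_between:
  fixes c c' s s' :: real and p j q :: nat
  assumes "c + s * real p \<le> c' + s' * real p" "c + s * real q \<le> c' + s' * real q" "p \<le> j" "j \<le> q"
  shows "c + s * real j \<le> c' + s' * real j"
proof (cases "s \<le> s'")
  case True
  then have "s * (real j - real p) \<le> s' * (real j - real p)" using assms by (intro mult_right_mono) auto
  then show ?thesis using assms by (simp add: algebra_simps)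
next
  case False
  then have "s' * (real q - real j) \<le> s * (real q - real j)" using assms by (intro mult_right_mono) auto
  then show ?thesis using assms by (simp add: algebra_simps)
qed

lemma log_convex_pos: "log_convex N \<Longrightarrow> N j > 0"
  by (simp add: log_convex_def)

lemma log_convex_ratio_mono:
  assumes "log_convex N" "i \<le> j"
  shows "N (Suc i) / N i \<le> N (Suc j) / N j"
  using assms(2)
proof (induction rule: dec_induct)
  case (step n)
  have "(N (Suc n))\<^sup>2 \<le> N n * N (Suc (Suc n))"
    using assms(1) by (auto simp: log_convex_def dest!: spec[of _ "Suc n"])
  then have "N (Suc n) / N n \<le> N (Suc (Suc n)) / N (Suc n)"
    using log_convex_pos[OF assms(1)] by (simp add: field_simps power2_eq_square)
  with step show ?case by simp
qed auto

lemma log_convex_tangent: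
  assumes N: "log_convex N"
  shows "ln (N j) + ln (N (Suc j) / N j) * (real i - real j) \<le> ln (N i)"
proof -
  define s where "s k = ln (N (Suc k) / N k)" for k
  have pos: "N k > 0" for k using log_convex_pos[OF N] .
  have s: "ln (N (Suc k)) = ln (N k) + s k" for k
    using pos[of k] pos[of "Suc k"] by (simp add: s_def ln_div)
  have mono: "s k \<le> s l" if "k \<le> l" for k l
    using log_convex_ratio_mono[OF N that] pos by (simp add: s_def)
  show ?thesis
  proof (cases "j \<le> i")
    case True
    then show ?thesis unfolding s_def[symmetric]
    proof (induction i rule: dec_induct)
      case (step n)
      then show ?case using s[of n] mono[of j n] by (simp add: algebra_simps)
    qed auto
  next
    case False
    then have "i \<le> j" by simp
    then show ?thesis unfolding s_def[symmetric]
    proof (induction rule: inc_induct)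
      case (step n)
      then show ?case using s[of n] mono[of n j] by (simp add: algebra_simps)
    qed auto
  qed
qed

text \<open>Each supporting line, evaluated at its own index, contributes one value of a sequence
  \<open>l\<close>; this sequence is the exponential of the lower convex hull of
  \<open>ln x\<close>, and it identifies the \<open>GREATEST\<close> in the definition. The last
  claim remembers two indices at which the line meets \<open>ln x\<close>, since only there bounds
  for \<open>x\<close> give bounds for the minorant.\<close>

lemma
  fixes x :: "nat \<Rightarrow> real"
  assumes pos: "\<And>j. x j > 0" and lim: "filterlim (\<lambda>j. root j (x j)) at_top sequentially"
  shows lc_minorant_log_convex: "log_convex (lc_minorant x)"
    and lc_minorant_le: "lc_minorant x j \<le> x j"
    and lc_minorant_greatest: "log_convex N \<Longrightarrow> (\<And>j. N j \<le> x j) \<Longrightarrow> N j \<le> lc_minorant x j"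
    and lc_minorant_line: "\<exists>p q c s. p \<le> j \<and> j \<le> q \<and> lc_minorant x j = exp (c + s * real j) \<and>
      x p = exp (c + s * real p) \<and> x q = exp (c + s * real q)"
proof -
  define y where "y j = ln (x j)" for j
  have xy: "x j = exp (y j)" for j using pos by (simp add: y_def)
  have "filterlim (\<lambda>j. ln (root j (x j))) at_top sequentially"
    by (rule filterlim_compose[OF ln_at_top lim])
  moreover have "\<forall>\<^sub>F j in sequentially. ln (root j (x j)) = y j / real j"
    using eventually_gt_at_top[of 0] by eventually_elim (use pos in \<open>simp add: y_def ln_root\<close>)
  ultimately have "filterlim (\<lambda>j. y j / real j) at_top sequentially"
    by (rule filterlim_cong[THEN iffD1, OF refl refl, rotated])
  from supporting_line[OF this] have "\<forall>j. \<exists>p q c s. p \<le> j \<and> j \<le> q \<and> (\<forall>i. c + s * real i \<le> y i) \<and>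
      y p = c + s * real p \<and> y q = c + s * real q" by blast
  then obtain p q c s where *: "\<And>j. p j \<le> j" "\<And>j. j \<le> q j" "\<And>j i. c j + s j * real i \<le> y i"
      "\<And>j. y (p j) = c j + s j * real (p j)" "\<And>j. y (q j) = c j + s j * real (q j)"
    by metis
  define l where "l j = exp (c j + s j * real j)" for j
  \<comment> \<open>The line for \<open>j\<close> lies below the line for \<open>i\<close> at the
    touching points \<open>p i\<close> and \<open>q i\<close>, hence also at \<open>i\<close>. So
    \<open>l\<close> is the upper envelope of all these lines.\<close>
  have above: "c j + s j * real i \<le> c i + s i * real i" for i j
    using *(3)[of j "p i"] *(3)[of j "q i"] *(4,5)[of i]
    by (intro affine_le_between[OF _ _ *(1,2)[of i]]) auto
  have lx: "l \<le> x" unfolding l_def xy using * by (auto intro!: le_funI)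
  have lc: "log_convex l"
    unfolding log_convex_def
  proof (intro conjI allI impI)
    fix j :: nat assume "1 \<le> j"
    have "(l j)\<^sup>2 = exp (c j + s j * real (j - 1)) * exp (c j + s j * real (j + 1))"
      using \<open>1 \<le> j\<close> unfolding power2_eq_square l_def exp_add[symmetric] by (simp add: algebra_simps of_nat_diff)
    also have "\<dots> \<le> l (j - 1) * l (j + 1)"
      unfolding l_def using above[of j "j - 1"] above[of j "j + 1"] by (intro mult_mono) auto
    finally show "(l j)\<^sup>2 \<le> l (j - 1) * l (j + 1)" .
  qed (simp add: l_def)
  have greatest: "N j \<le> l j" if N: "log_convex N" and "\<And>j. N j \<le> x j" for N j
  proof -
    have Nle: "ln (N j) \<le> y j" for j
      using that(2)[of j] pos[of j] log_convex_pos[OF N] by (simp add: y_def)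
    define d where "d = ln (N (Suc j) / N j)"
    have t: "(ln (N j) - d * real j) + d * real i \<le> y i" for i
      using log_convex_tangent[OF N, of j i] Nle[of i] by (simp add: d_def algebra_simps)
    have "(ln (N j) - d * real j) + d * real j \<le> c j + s j * real j"
      using t[of "p j"] t[of "q j"] *(4,5)[of j] by (intro affine_le_between[OF _ _ *(1,2)[of j]]) auto
    then have "exp (ln (N j)) \<le> l j" unfolding l_def by simp
    then show ?thesis using log_convex_pos[OF N] by simp
  qed
  have eq: "lc_minorant x = l"
    unfolding lc_minorant_def
    by (rule Greatest_equality) (use lc lx greatest in \<open>auto simp: le_fun_def\<close>)
  show "log_convex (lc_minorant x)" "lc_minorant x j \<le> x j"
    "log_convex N \<Longrightarrow> (\<And>j. N j \<le> x j) \<Longrightarrow> N j \<le> lc_minorant x j"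
    using lc lx greatest by (auto simp: eq le_fun_def)
  show "\<exists>p q c s. p \<le> j \<and> j \<le> q \<and> lc_minorant x j = exp (c + s * real j) \<and>
      x p = exp (c + s * real p) \<and> x q = exp (c + s * real q)"
    using *(1,2,4,5)[of j] xy eq l_def by metis
qed

text \<open>The tangent at \<open>j\<close> is at most \<open>0\<close> at the origin because
  \<open>N 0 \<le> 1\<close>, so \<open>ln (N j) / j\<close> increases. The form with powers also
  covers \<open>j = 0\<close>.\<close>

lemma log_convex_power_le:
  assumes N: "log_convex N" "N 0 \<le> 1" and "j \<le> k"
  shows "N j ^ k \<le> N k ^ j"
proof -
  define d where "d = ln (N (Suc j) / N j)"
  have pos: "N i > 0" for i using log_convex_pos[OF N(1)] .
  have "real k * ln (N j) \<le> real j * ln (N k)"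
  proof (cases "k = 0")
    case False
    have 0: "ln (N j) - d * real j \<le> 0"
      using log_convex_tangent[OF N(1), of j 0] N(2) ln_le_zero_iff[OF pos[of 0]] unfolding d_def by (auto simp: algebra_simps)
    have 1: "ln (N j) + d * (real k - real j) \<le> ln (N k)"
      using log_convex_tangent[OF N(1), of j k] by (simp add: d_def)
    have "(real k - real j) * (ln (N j) - d * real j) \<le> 0"
      using 0 \<open>j \<le> k\<close> by (intro mult_nonneg_nonpos) auto
    moreover have "real j * (ln (N j) + d * (real k - real j)) \<le> real j * ln (N k)"
      using 1 by (intro mult_left_mono) auto
    ultimately show ?thesis by (simp add: algebra_simps)
  qed (use \<open>j \<le> k\<close> in auto)
  then have "ln (N j ^ k) \<le> ln (N k ^ j)" using pos by (simp add: ln_realpow)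
  then show ?thesis using pos by simp
qed

text \<open>As a function of \<open>j\<close>, the left-hand side is the geometric sequence tangent to \<open>L\<close> at \<open>k\<close>.\<close>
lemma log_convex_tangent_power:
  assumes L: "log_convex L"
  shows "L k / (L (Suc k) / L k) ^ k * (L (Suc k) / L k) ^ j \<le> L j"
proof -
  have pos: "L i > 0" for i using log_convex_pos[OF L] .
  have "ln (L k / (L (Suc k) / L k) ^ k * (L (Suc k) / L k) ^ j) =
      ln (L k) + ln (L (Suc k) / L k) * (real j - real k)"
    using pos[of k] pos[of "Suc k"] by (simp add: ln_mult ln_div ln_realpow algebra_simps)
  also have "\<dots> \<le> ln (L j)" by (rule log_convex_tangent[OF L])
  finally show ?thesis using pos[of j] pos[of k] pos[of "Suc k"] by (subst (asm) ln_le_cancel_iff) auto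
qed

section \<open>The weight \<open>Gbar\<close> and its comparison with factorials\<close>

lemma Gbar_pos: "Gbar a j > 0"
  by (auto simp: Gbar_def)

lemma Gbar_0 [simp]: "Gbar a 0 = 1"
  by (simp add: Gbar_def)

lemma Gbar_cancel: "Gbar a j * Gbar (- a) j = 1"
  by (simp add: Gbar_def powr_minus)

lemma ln_Gbar: "ln (Gbar a j) = a * (real j * ln (real j))"
  by (auto simp: Gbar_def)

lemma Gbar_le_fact_powr: 
  assumes "0 \<le> a" shows "Gbar (-a) j \<le> fact j powr (-a)"
proof (cases "j = 0")
  case False
  have "ln (fact j powr (-a)) = - a * ln (fact j)" by (simp add: ln_powr)
  also have "ln (fact j) \<le> real j * ln (real j)"
  proof -
    have "ln (fact j) \<le> ln (real j ^ j)" using fact_le_power[of j, where 'a = real] False by simp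
    then show ?thesis using False by (simp add: ln_realpow)
  qed
  then have "- a * ln (fact j) \<ge> - a * (real j * ln (real j))" using assms by (intro mult_left_mono_neg) auto
  ultimately have "ln (Gbar (-a) j) \<le> ln (fact j powr (-a))" by (simp add: ln_Gbar)
  then show ?thesis using Gbar_pos[of "-a" j] by (subst (asm) ln_le_cancel_iff) auto
qed auto

lemma power_self_le_fact:
  "real n ^ n \<le> exp (real n) * fact n"
proof -
  have "real n ^ n / fact n \<le> exp (real n)"
  proof -
    have "(\<Sum>i\<in>{n}. real n ^ i /\<^sub>R fact i) \<le> (\<Sum>i. real n ^ i /\<^sub>R fact i)"
      by (rule sum_le_suminf[OF summable_exp_generic]) auto
    then show ?thesis by (simp add: exp_def field_simps)
  qed
  then show ?thesis by (simp add: field_simps)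
qed

text \<open>A log-convex lower bound of a sequence is also a lower bound of its log-convex minorant.
  In this way a lower bound for \<open>M j / fact j\<close> will reach
  \<open>seq_alpha M \<alpha>\<close>. The weight is log-convex because \<open>x * ln x\<close> is
  convex.\<close>

lemma log_convex_Gbar_fact:
  assumes "0 \<le> a" "0 < c" "0 < e"
  shows "log_convex (\<lambda>j. Gbar a j * (e * c ^ j * fact j))"
  unfolding log_convex_def
proof (intro conjI allI impI)
  fix j :: nat assume "1 \<le> j"
  have G: "(Gbar a j)\<^sup>2 \<le> Gbar a (j - 1) * Gbar a (j + 1)"
  proof -
    have conv: "convex_on {0<..} (\<lambda>x::real. x * ln x)"
      by (rule f''_ge0_imp_convex[where f' = "\<lambda>x. ln x + 1" and f'' = "\<lambda>x. 1 / x"])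
        (auto intro!: derivative_eq_intros)
    have "2 * (real j * ln (real j)) \<le> real (j - 1) * ln (real (j - 1)) + real (j + 1) * ln (real (j + 1))"
    proof (cases "j = 1")
      case False
      then have "j > 1" using \<open>1 \<le> j\<close> by simp
      have "(\<lambda>x. x * ln x) ((1 - 1/2) *\<^sub>R real (j - 1) + (1/2) *\<^sub>R real (j + 1)) \<le>
          (1 - 1/2) * (\<lambda>x. x * ln x) (real (j - 1)) + (1/2) * (\<lambda>x. x * ln x) (real (j + 1))"
        using \<open>j > 1\<close> by (intro convex_onD[OF conv]) auto
      then show ?thesis using \<open>j > 1\<close> by (simp add: of_nat_diff field_simps)
    qed auto
    then have "a * (2 * (real j * ln (real j))) \<le>
        a * (real (j - 1) * ln (real (j - 1)) + real (j + 1) * ln (real (j + 1)))"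
      using assms by (intro mult_left_mono) auto
    then have "ln ((Gbar a j)\<^sup>2) \<le> ln (Gbar a (j - 1) * Gbar a (j + 1))"
      using Gbar_pos[of a j] Gbar_pos[of a "j - 1"] Gbar_pos[of a "j + 1"]
      by (simp add: ln_mult ln_realpow ln_Gbar algebra_simps)
    then show ?thesis using Gbar_pos[of a j] Gbar_pos[of a "j - 1"] Gbar_pos[of a "j + 1"]
      by (subst (asm) ln_le_cancel_iff) auto
  qed
  have F: "(e * c ^ j * fact j)\<^sup>2 \<le> (e * c ^ (j - 1) * fact (j - 1)) * (e * c ^ (j + 1) * fact (j + 1))"
  proof -
    obtain i where j: "j = Suc i" using \<open>1 \<le> j\<close> by (cases j) auto
    define X where "X = e * e * (c ^ i * c ^ i * c * c) * (fact i * fact i)"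
    have "X \<ge> 0" using assms by (simp add: X_def)
    then have "real (Suc i) * (X * real (Suc i)) \<le> real (i + 2) * (X * real (Suc i))"
      by (intro mult_right_mono) auto
    also have "real (Suc i) * (X * real (Suc i)) = (e * c ^ j * fact j)\<^sup>2"
      by (simp add: j X_def power2_eq_square mult_ac del: of_nat_Suc)
    also have "real (i + 2) * (X * real (Suc i)) =
        (e * c ^ (j - 1) * fact (j - 1)) * (e * c ^ (j + 1) * fact (j + 1))"
      by (simp add: j X_def mult_ac del: of_nat_Suc)
    finally show ?thesis .
  qed
  have "(Gbar a j)\<^sup>2 * (e * c ^ j * fact j)\<^sup>2 \<le> (Gbar a (j - 1) * Gbar a (j + 1)) *
      ((e * c ^ (j - 1) * fact (j - 1)) * (e * c ^ (j + 1) * fact (j + 1)))"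
    by (rule mult_mono[OF G F]) (simp_all add: Gbar_pos less_imp_le)
  then show "(Gbar a j * (e * c ^ j * fact j))\<^sup>2 \<le>
      Gbar a (j - 1) * (e * c ^ (j - 1) * fact (j - 1)) * (Gbar a (j + 1) * (e * c ^ (j + 1) * fact (j + 1)))"
    by (simp add: power_mult_distrib mult_ac)
qed (use assms in \<open>simp add: Gbar_pos\<close>)

section \<open>Sectors\<close>

text \<open>Maximum modulus principle for \<open>G v * exp (- K * W v)\<close>: the comparison function
  \<open>W v = 2 * v / \<rho> - (v / \<rho>)\<^sup>2\<close> has real part at least \<open>0\<close> on the diameter and at least \<open>1\<close> on the arc.\<close>
lemma half_disk_bound:
  fixes G :: "complex \<Rightarrow> complex"
  assumes hol: "G holomorphic_on {v. Re v > 0}" and cont: "continuous_on {v. Re v \<ge> 0} G"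
    and \<rho>: "\<rho> > 0" and "K \<ge> 0"
    and diam: "\<And>y. \<bar>y\<bar> \<le> \<rho> \<Longrightarrow> norm (G (\<i> * of_real y)) \<le> C"
    and arc: "\<And>v. norm v = \<rho> \<Longrightarrow> Re v \<ge> 0 \<Longrightarrow> norm (G v) \<le> C * exp K"
    and v: "Re v \<ge> 0" "norm v \<le> \<rho>"
  shows "norm (G v) \<le> C * exp (K * (2 * norm v / \<rho> + (norm v / \<rho>)\<^sup>2))"
proof -
  define S where "S = {v. Re v \<ge> 0} \<inter> cball (0::complex) \<rho>"
  have "norm (G (\<i> * of_real 0)) \<le> C" by (rule diam) (use \<rho> in simp)
  then have "C \<ge> 0" by (rule order_trans[OF norm_ge_zero])
  define W where "W v = 2 * (v / of_real \<rho>) - (v / of_real \<rho>)\<^sup>2" for v :: complex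
  define g where "g v = G v * exp (- of_real K * W v)" for v
  have clS: "closed S" unfolding S_def by (intro closed_Int closed_halfspace_Re_ge) auto
  have intS: "interior S = {v. Re v > 0} \<inter> ball 0 \<rho>"
    unfolding S_def using interior_halfspace_ge[of "1::complex" 0]
    by (simp add: inner_complex_def)
  have normg: "norm (g v) = norm (G v) * exp (- K * Re (W v))" for v
    by (simp add: g_def norm_mult norm_exp_eq_Re)
  have "norm (g v) \<le> C"
  proof (rule maximum_modulus_frontier[of g S C v])
    show "g holomorphic_on interior S"
      unfolding g_def W_def intS using \<rho>
      by (intro holomorphic_intros holomorphic_on_subset[OF hol]) auto
    show "continuous_on (closure S) g"
      unfolding g_def W_def closure_closed[OF clS] using \<rho>
      by (intro continuous_intros continuous_on_subset[OF cont]) (auto simp: S_def)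
    show "bounded S" unfolding S_def by auto
    show "v \<in> S" using v by (simp add: S_def)
    fix z assume "z \<in> frontier S"
    then have z: "Re z \<ge> 0" "norm z \<le> \<rho>" "Re z = 0 \<or> norm z = \<rho>"
      unfolding frontier_def closure_closed[OF clS] intS by (auto simp: S_def)
    define c where "c = Re z / \<rho>"
    define s where "s = Im z / \<rho>"
    have ReW: "Re (W z) = 2 * c - c\<^sup>2 + s\<^sup>2"
      by (simp add: W_def c_def s_def power2_eq_square diff_divide_distrib)
    show "norm (g z) \<le> C"
    proof (cases "Re z = 0")
      case True
      then have "norm (G z) \<le> C" using diam[of "Im z"] z(2) abs_Im_le_cmod[of z]
        by (metis True add_0 complex_eq of_real_0 order_trans)
      moreover have "Re (W z) \<ge> 0" using True by (simp add: ReW c_def)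
      then have "exp (- K * Re (W z)) \<le> 1" using \<open>K \<ge> 0\<close> by (simp add: mult_nonneg_nonneg)
      ultimately have "norm (G z) * exp (- K * Re (W z)) \<le> C * 1"
        using \<open>C \<ge> 0\<close> by (intro mult_mono) auto
      then show ?thesis unfolding normg by simp
    next
      case False
      then have nz: "norm z = \<rho>" using z(3) by blast
      have cs: "c\<^sup>2 + s\<^sup>2 = 1"
        using nz \<rho> cmod_power2[of z, symmetric]
        by (simp add: c_def s_def power_divide add_divide_distrib[symmetric])
      have c01: "0 \<le> c" "c \<le> 1" using z \<rho> complex_Re_le_cmod[of z] by (auto simp: c_def nz)
      \<comment> \<open>On the arc \<open>c\<^sup>2 + s\<^sup>2 = 1\<close>, so that the real part
        is \<open>1 + 2 * c * (1 - c)\<close>.\<close>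
      have "Re (W z) \<ge> 1"
      proof -
        have "c * c \<le> c" using c01 mult_left_le by auto
        then show ?thesis using ReW cs by (simp add: power2_eq_square)
      qed
      then have "exp (- K * Re (W z)) \<le> exp (- K)" using \<open>K \<ge> 0\<close> mult_left_mono[of 1 "Re (W z)" K] by simp
      then have "norm (G z) * exp (- K * Re (W z)) \<le> (C * exp K) * exp (- K)"
        using arc[OF nz z(1)] \<open>C \<ge> 0\<close> by (intro mult_mono) auto
      then show ?thesis unfolding normg by (simp add: exp_minus mult.assoc)
    qed
  qed
  then have "norm (G v) \<le> C * exp (K * Re (W v))"
    unfolding normg by (simp add: exp_minus field_simps)
  also have "Re (W v) \<le> 2 * norm v / \<rho> + (norm v / \<rho>)\<^sup>2"
  proof -
    have "Re (W v) \<le> norm (W v)" by (rule complex_Re_le_cmod)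
    also have "\<dots> \<le> norm (2 * (v / of_real \<rho>)) + norm ((v / of_real \<rho>)\<^sup>2)"
      unfolding W_def by (rule norm_triangle_ineq4)
    also have "\<dots> = 2 * norm v / \<rho> + (norm v / \<rho>)\<^sup>2" using \<rho> by (simp add: norm_mult norm_divide norm_power)
    finally show ?thesis .
  qed
  then have "C * exp (K * Re (W v)) \<le> C * exp (K * (2 * norm v / \<rho> + (norm v / \<rho>)\<^sup>2))"
    using \<open>C \<ge> 0\<close> \<open>K \<ge> 0\<close> by (intro mult_left_mono) (auto intro: mult_left_mono)
  finally show ?thesis .
qed

lemma Re_mult_cis: "Re (of_real r * cis t * cis s) = r * cos (t + s)"
  by (simp add: cos_add algebra_simps)

text \<open>Half planes replace arguments, which behave badly under addition: openness, convexity
  and stability under sums can now be read off. The sum of the two cosines is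
  \<open>2 * cos t * cos \<phi>\<close>, which forces \<open>\<bar>t\<bar> < pi / 2\<close>; after
  that, monotonicity of the cosine suffices.\<close>

lemma sector_halfplanes:
  assumes "0 < \<alpha>" "\<alpha> \<le> 1"
  defines "\<phi> \<equiv> (1 - \<alpha>) * pi / 2"
  shows "sector \<alpha> = {z. Re (z * cis \<phi>) > 0 \<and> Re (z * cis (- \<phi>)) > 0}"
proof -
  have \<phi>: "0 \<le> \<phi>" "\<phi> < pi / 2" using assms by (auto simp: \<phi>_def)
  have \<alpha>\<phi>: "\<alpha> * pi / 2 = pi / 2 - \<phi>" by (simp add: \<phi>_def field_simps)
  have main: "\<bar>t\<bar> < pi / 2 - \<phi> \<longleftrightarrow> cos (t + \<phi>) > 0 \<and> cos (t - \<phi>) > 0" if t: "-pi < t" "t \<le> pi" for t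
  proof
    assume "\<bar>t\<bar> < pi / 2 - \<phi>"
    then show "cos (t + \<phi>) > 0 \<and> cos (t - \<phi>) > 0" using \<phi> by (intro conjI cos_gt_zero_pi) auto
  next
    assume *: "cos (t + \<phi>) > 0 \<and> cos (t - \<phi>) > 0"
    have "cos (t + \<phi>) + cos (t - \<phi>) = 2 * cos t * cos \<phi>" by (simp add: cos_add cos_diff)
    moreover have "cos \<phi> > 0" using \<phi> by (intro cos_gt_zero_pi) auto
    ultimately have "cos t > 0" using * by (smt (verit) mult_nonneg_nonpos2 mult_nonneg_nonpos)
    have t2: "\<bar>t\<bar> < pi / 2"
    proof (rule ccontr)
      assume "\<not> \<bar>t\<bar> < pi / 2"
      then have "cos \<bar>t\<bar> \<le> cos (pi / 2)" using t by (intro cos_monotone_0_pi_le) auto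
      then show False using \<open>cos t > 0\<close> by simp
    qed
    show "\<bar>t\<bar> < pi / 2 - \<phi>"
    proof (rule ccontr)
      assume "\<not> \<bar>t\<bar> < pi / 2 - \<phi>"
      then have "cos (\<bar>t\<bar> + \<phi>) \<le> cos (pi / 2)" using t2 \<phi> by (intro cos_monotone_0_pi_le) auto
      then have "cos (\<bar>t\<bar> + \<phi>) \<le> 0" by simp
      moreover have "cos (\<bar>t\<bar> + \<phi>) = cos (t + \<phi>) \<or> cos (\<bar>t\<bar> + \<phi>) = cos (t - \<phi>)"
        using cos_minus[of "t - \<phi>"] by (cases "t \<ge> 0") (auto simp: abs_if)
      ultimately show False using * by auto
    qed
  qed
  show ?thesis
  proof (intro equalityI subsetI; clarsimp simp only: mem_Collect_eq)
    fix z assume "z \<in> sector \<alpha>"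
    then have z: "z \<noteq> 0" "\<bar>Arg z\<bar> < pi / 2 - \<phi>" by (auto simp: sector_def \<alpha>\<phi>)
    have "z = of_real (norm z) * cis (Arg z)" using rcis_cmod_Arg[of z] by (simp add: rcis_def)
    then show "0 < Re (z * cis \<phi>) \<and> 0 < Re (z * cis (- \<phi>))"
      using main[of "Arg z"] z Arg_bounded[of z] Re_mult_cis[of "norm z" "Arg z" \<phi>]
        Re_mult_cis[of "norm z" "Arg z" "-\<phi>"] by (metis add_uminus_conv_diff mult_pos_pos zero_less_norm_iff)
  next
    fix z assume *: "0 < Re (z * cis \<phi>)" "0 < Re (z * cis (- \<phi>))"
    then have "z \<noteq> 0" by auto
    have zz: "z = of_real (norm z) * cis (Arg z)" using rcis_cmod_Arg[of z] by (simp add: rcis_def)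
    have "\<bar>Arg z\<bar> < pi / 2 - \<phi>"
      using main[of "Arg z"] * Arg_bounded[of z] Re_mult_cis[of "norm z" "Arg z" \<phi>]
        Re_mult_cis[of "norm z" "Arg z" "-\<phi>"] \<open>z \<noteq> 0\<close>
      by (metis add_uminus_conv_diff zz zero_less_mult_pos zero_less_norm_iff)
    then show "z \<in> sector \<alpha>" using \<open>z \<noteq> 0\<close> by (simp add: sector_def \<alpha>\<phi>)
  qed
qed

lemma cis_add_pi: "cis (t + pi) = - cis t" "cis (t - pi) = - cis t"
  by (auto simp: complex_eq_iff)

text \<open>Closed, so that it contains the vertex and the boundary rays, onto which the imaginary
  axis will be mapped by a power function.\<close>

definition closed_sector :: "real \<Rightarrow> complex set" where
  "closed_sector \<alpha> = {z. Re (z * cis ((1 - \<alpha>) * pi / 2)) \<ge> 0 \<and> Re (z * cis (- ((1 - \<alpha>) * pi / 2))) \<ge> 0}"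

lemma Re_mult_inner: "Re (z * c) = cnj c \<bullet> z"
  by (simp add: inner_complex_def algebra_simps)

context
  fixes \<alpha> :: real
  assumes \<alpha>: "0 < \<alpha>" "\<alpha> \<le> 1"
begin

lemma open_sector: "open (sector \<alpha>)"
  unfolding sector_halfplanes[OF \<alpha>] Re_mult_inner Collect_conj_eq
  by (intro open_Int open_halfspace_gt)

lemma convex_sector: "convex (sector \<alpha>)"
  unfolding sector_halfplanes[OF \<alpha>] Re_mult_inner Collect_conj_eq
  by (intro convex_Int convex_halfspace_gt)

lemma sector_add: "z \<in> sector \<alpha> \<Longrightarrow> w \<in> closed_sector \<alpha> \<Longrightarrow> z + w \<in> sector \<alpha>"
  unfolding sector_halfplanes[OF \<alpha>] closed_sector_def by (auto simp: algebra_simps)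

lemma of_real_in_sector: "x > 0 \<Longrightarrow> of_real x \<in> sector \<alpha>"
  using \<alpha> by (simp add: sector_def)

lemma sector_scale: "z \<in> sector \<alpha> \<Longrightarrow> x > 0 \<Longrightarrow> of_real x * z \<in> sector \<alpha>"
  unfolding sector_halfplanes[OF \<alpha>] by (auto simp: algebra_simps) (auto simp: zero_less_mult_iff simp flip: right_diff_distrib distrib_left)

lemma rcis_in_closed_sector:
  assumes "r \<ge> 0" "\<bar>t\<bar> \<le> \<alpha> * pi / 2"
  shows "of_real r * cis t \<in> closed_sector \<alpha>"
proof -
  define \<phi> where "\<phi> = (1 - \<alpha>) * pi / 2"
  have "\<bar>t\<bar> \<le> pi / 2 - \<phi>" "\<phi> \<ge> 0" using assms \<alpha> by (auto simp: \<phi>_def field_simps)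
  then have "cos (t + \<phi>) \<ge> 0" "cos (t + - \<phi>) \<ge> 0" by (auto intro!: cos_ge_zero)
  then show ?thesis using assms(1) unfolding closed_sector_def mem_Collect_eq Re_mult_cis \<phi>_def by auto
qed

text \<open>The angle \<open>t\<close> is measured from the negative axis. The half-openings
  \<open>\<alpha> * pi / 2\<close> and \<open>(2 - \<alpha>) * pi / 2\<close> add up to
  \<open>pi\<close>, so the sector and the opposite sector cover the plane.\<close>

lemma sector_or_opposite:
  obtains "w \<in> closed_sector \<alpha>"
  | t where "\<bar>t\<bar> \<le> (2 - \<alpha>) * pi / 2" "w = - (of_real (norm w) * cis t)"
proof -
  define t where "t = Arg (- w)"
  have t: "-pi < t" "t \<le> pi" using Arg_bounded[of "-w"] by (auto simp: t_def)
  have w: "w = - (of_real (norm w) * cis t)"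
    using rcis_cmod_Arg[of "-w"] by (simp add: rcis_def t_def minus_equation_iff[of w])
  show ?thesis
  proof (cases "\<bar>t\<bar> \<le> (2 - \<alpha>) * pi / 2")
    case False
    show ?thesis
    proof (cases "t \<ge> 0")
      case True
      have "w = of_real (norm w) * cis (t - pi)" using w by (simp add: cis_add_pi)
      moreover have "of_real (norm w) * cis (t - pi) \<in> closed_sector \<alpha>"
        using False True t by (intro rcis_in_closed_sector) (auto simp: field_simps)
      ultimately show ?thesis using that by auto
    next
      case neg: False
      have "w = of_real (norm w) * cis (t + pi)" using w by (simp add: cis_add_pi)
      moreover have "of_real (norm w) * cis (t + pi) \<in> closed_sector \<alpha>"
        using False neg t by (intro rcis_in_closed_sector) (auto simp: field_simps)
      ultimately show ?thesis using that by auto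
    qed
  qed (use that w in auto)
qed

end

section \<open>Power functions on the right half plane\<close>

lemma powr_rcis:
  assumes "s > 0" "\<bar>t\<bar> < pi"
  shows "(of_real s * cis t) powr of_real b = of_real (s powr b) * cis (b * t)"
proof -
  have "Ln (of_real s * cis t) = Complex (ln s) t"
    using assms by (intro Ln_unique) (auto simp: exp_eq_polar)
  then show ?thesis using assms
    by (auto simp: powr_def exp_eq_polar scaleR_conv_of_real)
qed

lemma continuous_on_powr_half_plane:
  assumes "b > 0"
  shows "continuous_on {v. Re v \<ge> 0} (\<lambda>v::complex. v powr of_real b)"
proof -
  have "continuous (at v within {v. Re v \<ge> 0}) (\<lambda>v::complex. v powr of_real b)" if "Re v \<ge> 0" for v
  proof (cases "v = 0")
    case False
    then have "v \<notin> \<real>\<^sub>\<le>\<^sub>0" using that by (auto simp: complex_nonpos_Reals_iff complex_eq_iff)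
    then have "isCont (\<lambda>v::complex. v powr of_real b) v" by (intro continuous_intros) auto
    then show ?thesis by (rule continuous_at_imp_continuous_within)
  next
    case True
    have "((\<lambda>v::complex. norm v) \<longlongrightarrow> 0) (at 0 within {v. Re v \<ge> 0})"
      by (rule tendsto_norm_zero) (rule tendsto_ident_at)
    then have "((\<lambda>v::complex. norm v powr b) \<longlongrightarrow> 0) (at 0 within {v. Re v \<ge> 0})"
      using assms by (intro tendsto_zero_powrI[OF _ tendsto_const]) auto
    then have "((\<lambda>v::complex. v powr of_real b) \<longlongrightarrow> 0) (at 0 within {v. Re v \<ge> 0})"
      by (subst tendsto_norm_zero_iff[symmetric]) (simp add: norm_powr_real_powr')
    then show ?thesis using True assms by (simp add: continuous_within)
  qed
  then show ?thesis by (simp add: continuous_on_eq_continuous_within)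
qed

lemma holomorphic_on_powr_half_plane:
  "(\<lambda>v::complex. v powr of_real b) holomorphic_on {v. Re v > 0}"
  by (intro holomorphic_intros) (auto simp: complex_nonpos_Reals_iff)

lemma imaginary_powr:
  assumes "y \<noteq> 0"
  shows "(\<i> * of_real y) powr of_real b = of_real (\<bar>y\<bar> powr b) * cis (b * (sgn y * (pi / 2)))"
proof -
  have "\<i> * of_real y = of_real \<bar>y\<bar> * cis (sgn y * (pi / 2))"
    using assms by (auto simp: complex_eq_iff sgn_if)
  then show ?thesis using assms powr_rcis[of "\<bar>y\<bar>" "sgn y * (pi / 2)" b] by (simp add: sgn_if)
qed

context
  fixes \<alpha> :: real
  assumes \<alpha>: "0 < \<alpha>" "\<alpha> \<le> 1"
begin

text \<open>The imaginary axis goes to the boundary rays: a rotation by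
  \<open>(2 - \<alpha>) * pi / 2\<close> followed by the sign change, a rotation by
  \<open>pi\<close> in the other direction, leaves the angle \<open>\<alpha> * pi / 2\<close> up to
  sign.\<close>

lemma imaginary_powr_opposite_sector:
  assumes "d \<ge> 0"
  shows "- (of_real d * (\<i> * of_real y) powr of_real (2 - \<alpha>)) \<in> closed_sector \<alpha>"
proof (cases "y = 0")
  case False
  have c: "- cis ((2 - \<alpha>) * (sgn y * (pi / 2))) = cis (- \<alpha> * (sgn y * (pi / 2)))"
  proof (cases "y > 0")
    case True
    then have "(2 - \<alpha>) * (sgn y * (pi / 2)) = - \<alpha> * (sgn y * (pi / 2)) + pi"
      by (simp add: field_simps)
    then show ?thesis by (simp only: cis_add_pi minus_minus)
  next
    case neg: False
    then have "(2 - \<alpha>) * (sgn y * (pi / 2)) = - \<alpha> * (sgn y * (pi / 2)) - pi"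
      using False by (simp add: sgn_if field_simps)
    then show ?thesis by (simp only: cis_add_pi minus_minus)
  qed
  have "- (of_real d * (\<i> * of_real y) powr of_real (2 - \<alpha>)) =
      of_real (d * \<bar>y\<bar> powr (2 - \<alpha>)) * - cis ((2 - \<alpha>) * (sgn y * (pi / 2)))"
    unfolding imaginary_powr[OF False] of_real_mult mult.assoc mult_minus_right ..
  also have "\<dots> = of_real (d * \<bar>y\<bar> powr (2 - \<alpha>)) * cis (- \<alpha> * (sgn y * (pi / 2)))"
    unfolding c ..
  also have "\<dots> \<in> closed_sector \<alpha>"
    by (rule rcis_in_closed_sector[OF \<alpha>]) (use \<alpha> assms in \<open>auto simp: abs_mult sgn_if\<close>)
  finally show ?thesis .
qed (simp add: closed_sector_def)

text \<open>Outside the sector, points are parametrized by the right half plane. The norm of the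
  parameter is recorded because the half-plane estimates are expressed in it; it is the source of
  the exponent \<open>1 / (2 - \<alpha>)\<close>.\<close>

lemma sector_or_powr_image:
  assumes "d > 0"
  obtains "w \<in> closed_sector \<alpha>"
  | v where "Re v \<ge> 0" "norm v = (norm w / d) powr (1 / (2 - \<alpha>))"
      "w = - (of_real d * v powr of_real (2 - \<alpha>))"
proof (cases rule: sector_or_opposite[OF \<alpha>, of w])
  case (2 t)
  show ?thesis
  proof (cases "w = 0")
    case True
    then have "w \<in> closed_sector \<alpha>" by (simp add: closed_sector_def)
    then show ?thesis using that by blast
  next
    case False
    define b where "b = 2 - \<alpha>"
    have b: "1 \<le> b" "b < 2" using \<alpha> by (auto simp: b_def)
    define s where "s = (norm w / d) powr (1 / b)"
    have s: "s > 0" "s powr b = norm w / d" using False assms b by (auto simp: s_def powr_powr)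
    have t: "\<bar>t / b\<bar> \<le> pi / 2" using 2(1) b by (simp add: b_def[symmetric] field_simps)
    have "cos (t / b) \<ge> 0" using t by (intro cos_ge_zero) (simp_all only: abs_le_iff, linarith+)
    then have "Re (of_real s * cis (t / b)) \<ge> 0" using s by simp
    moreover have n: "norm (of_real s * cis (t / b)) = (norm w / d) powr (1 / (2 - \<alpha>))"
      using s by (simp add: norm_mult s_def b_def)
    moreover have "(of_real s * cis (t / b)) powr of_real b = of_real (norm w / d) * cis t"
      using powr_rcis[of s "t / b" b] s b le_less_trans[OF t, of pi] pi_gt_zero
      by (simp del: of_real_divide)
    then have "- (of_real d * (of_real s * cis (t / b)) powr of_real (2 - \<alpha>)) = w"
      using 2(2) assms by (simp add: b_def)
    ultimately show ?thesis using n by (intro that(2)[of "of_real s * cis (t / b)"]) simp_all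
  qed
qed (use that in blast)

end

section \<open>Kolmogorov inequalities on a sector\<close>

text \<open>The maximum principle for \<open>p w / (w - a) ^ m\<close> on the exterior of the disk.
  The reflected polynomial moves it to the disk of radius \<open>1 / \<rho>\<close>, where infinity
  has become the centre.\<close>

lemma poly_growth_outside_disk:
  fixes p :: "complex poly"
  assumes deg: "degree p \<le> n" and "\<rho> > 0"
    and bound: "\<And>w. norm (w - a) \<le> \<rho> \<Longrightarrow> norm (poly p w) \<le> A"
    and w: "norm (w - a) \<le> R" and "\<rho> \<le> R"
  shows "norm (poly p w) \<le> A * (R / \<rho>) ^ n"
proof -
  have "norm (poly p a) \<le> A" using bound[of a] \<open>\<rho> > 0\<close> by simp
  then have "A \<ge> 0" by (rule order_trans[OF norm_ge_zero])
  define b where "b = pcompose p [:a, 1:]"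
  have pb: "poly b u = poly p (a + u)" for u by (simp add: b_def poly_pcompose)
  define m where "m = degree b"
  have "m \<le> n" unfolding m_def b_def using deg by (simp add: degree_pcompose)
  have R1: "R / \<rho> \<ge> 1" using assms by simp
  show ?thesis
  proof (cases "norm (w - a) \<le> \<rho>")
    case True
    have "A * 1 \<le> A * (R / \<rho>) ^ n" using \<open>A \<ge> 0\<close> R1 by (intro mult_left_mono one_le_power) auto
    then show ?thesis using bound[OF True] by simp
  next
    case False
    define u where "u = w - a"
    have u: "u \<noteq> 0" "norm u > \<rho>" "norm u \<le> R" using False w \<open>\<rho> > 0\<close> by (auto simp: u_def)
    have "norm (poly (reflect_poly b) (inverse u)) \<le> A / \<rho> ^ m"
    proof (rule maximum_modulus_frontier[of "poly (reflect_poly b)" "cball 0 (1 / \<rho>)" _ "inverse u"])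
      show "inverse u \<in> cball 0 (1 / \<rho>)"
        using u \<open>\<rho> > 0\<close> le_imp_inverse_le[of \<rho> "norm u"]
        by (simp add: norm_inverse inverse_eq_divide norm_divide)
      fix z :: complex assume "z \<in> frontier (cball 0 (1 / \<rho>))"
      then have z: "norm z = 1 / \<rho>" using \<open>\<rho> > 0\<close> by (simp add: frontier_cball)
      then have "z \<noteq> 0" using \<open>\<rho> > 0\<close> by auto
      have "norm (poly p (a + inverse z)) \<le> A"
        using z \<open>\<rho> > 0\<close> by (intro bound) (simp add: norm_inverse)
      then have "(1 / \<rho>) ^ m * norm (poly p (a + inverse z)) \<le> (1 / \<rho>) ^ m * A"
        using \<open>\<rho> > 0\<close> by (intro mult_left_mono) auto
      then show "norm (poly (reflect_poly b) z) \<le> A / \<rho> ^ m"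
        unfolding poly_reflect_poly_nz[OF \<open>z \<noteq> 0\<close>] norm_mult norm_power z pb m_def[symmetric]
        by (simp add: power_one_over)
    qed (auto intro!: holomorphic_intros continuous_intros)
    moreover have "poly (reflect_poly b) (inverse u) = inverse u ^ m * poly p w"
      using poly_reflect_poly_nz[of "inverse u" b] u by (simp add: m_def pb u_def)
    ultimately have "inverse (norm u) ^ m * norm (poly p w) \<le> A / \<rho> ^ m"
      by (simp only: norm_mult norm_power norm_inverse)
    then have "norm u ^ m * (inverse (norm u) ^ m * norm (poly p w)) \<le> norm u ^ m * (A / \<rho> ^ m)"
      by (rule mult_left_mono) simp
    then have "norm (poly p w) \<le> A * (norm u / \<rho>) ^ m"
      using u by (simp add: power_divide field_simps)
    also have "\<dots> \<le> A * (R / \<rho>) ^ m"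
      using u \<open>A \<ge> 0\<close> \<open>\<rho> > 0\<close> by (intro mult_left_mono power_mono divide_right_mono) auto
    also have "\<dots> \<le> A * (R / \<rho>) ^ n"
      using R1 \<open>m \<le> n\<close> \<open>A \<ge> 0\<close> by (intro mult_left_mono power_increasing) auto
    finally show ?thesis .
  qed
qed

lemma higher_deriv_poly:
  fixes p :: "complex poly"
  shows "(deriv ^^ k) (poly p) = poly ((pderiv ^^ k) p)"
  by (induction k) (auto intro!: ext DERIV_imp_deriv poly_DERIV)

lemma higher_deriv_poly_0:
  fixes p :: "complex poly"
  shows "(deriv ^^ k) (poly p) 0 = fact k * coeff p k"
  by (simp add: higher_deriv_poly poly_0_coeff_0 coeff_higher_pderiv pochhammer_fact[symmetric])

lemma norm_coeff_le:
  fixes p :: "complex poly"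
  assumes "r > 0" "\<And>w. norm w = r \<Longrightarrow> norm (poly p w) \<le> B"
  shows "norm (coeff p k) \<le> B / r ^ k"
proof -
  have "norm ((deriv ^^ k) (poly p) 0) \<le> fact k * B / r ^ k"
    using assms by (intro Cauchy_inequality) (auto intro!: holomorphic_intros continuous_intros)
  then have "fact k * norm (coeff p k) \<le> fact k * (B / r ^ k)" by (simp add: higher_deriv_poly_0 norm_mult)
  then show ?thesis by (simp only: mult_le_cancel_left_pos[OF fact_gt_zero])
qed

text \<open>Here \<open>p\<close>, \<open>p + k\<close> and \<open>p + n\<close> are the lower,
  middle and upper index of an interpolation. The weights \<open>j powr j\<close> at these indices
  absorb the Kolmogorov factor \<open>(n / k) powr k\<close> up to \<open>2 powr (p + k)\<close>.
  The factor 2 is the entropy estimate \<open>(p + k) powr (p + k) \<le> 2 powr (p + k) * p powr p *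
  k powr k\<close>, obtained from \<open>ln t \<le> t - 1\<close> for two values of \<open>t\<close>
  whose errors cancel.\<close>

lemma entropy_bound:
  fixes p k n :: real
  assumes "0 \<le> p" "0 < k" "k \<le> n"
  shows "k * ln (n / k) + (p + k) * ln (p + k) \<le>
    (1 - k / n) * (p * ln p) + k / n * ((p + n) * ln (p + n)) + (p + k) * ln 2"
proof -
  have eq: "k / n * ((p + n) * ln (p + n)) = k / n * (p * ln (p + n)) + k * ln (p + n)"
    using assms by (simp add: field_simps)
  have "k * ln n \<le> k * ln (p + n)" using assms by (intro mult_left_mono) auto
  moreover have "k / n * (p * ln p) \<le> k / n * (p * ln (p + n))"
    using assms by (cases "p = 0") (auto intro!: mult_left_mono divide_right_mono)
  moreover have "p * ln (p + k) + k * ln (p + k) \<le> p * ln p + k * ln k + (p + k) * ln 2"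
  proof (cases "p = 0")
    case False
    then have "p > 0" using assms by simp
    have "p * ln ((p + k) / (2 * p)) \<le> p * ((p + k) / (2 * p) - 1)"
      using \<open>p > 0\<close> assms by (intro mult_left_mono ln_le_minus_one) auto
    moreover have "k * ln ((p + k) / (2 * k)) \<le> k * ((p + k) / (2 * k) - 1)"
      using \<open>p > 0\<close> assms by (intro mult_left_mono ln_le_minus_one) auto
    moreover have "p * ((p + k) / (2 * p) - 1) + k * ((p + k) / (2 * k) - 1) = 0"
      using \<open>p > 0\<close> assms by (simp add: field_simps)
    ultimately show ?thesis using \<open>p > 0\<close> assms by (simp add: ln_div ln_mult algebra_simps)
  qed (use assms in auto)
  moreover have "k * ln (n / k) = k * ln n - k * ln k" using assms by (simp add: ln_div algebra_simps)
  moreover have "(1 - k / n) * (p * ln p) = p * ln p - k / n * (p * ln p)" by (simp add: left_diff_distrib)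
  moreover have "(p + k) * ln (p + k) = p * ln (p + k) + k * ln (p + k)" by (simp add: distrib_right)
  ultimately show ?thesis unfolding eq by linarith
qed

lemma exp_mult_le_8_power:
  assumes "n \<ge> 1" shows "exp (real n) * real n \<le> 8 ^ n"
proof -
  have "exp (real n) = exp 1 ^ n" by (simp add: exp_of_nat_mult[symmetric])
  also have "\<dots> \<le> 4 ^ n" using e_less_272 by (intro power_mono) auto
  finally have "exp (real n) * real n \<le> 4 ^ n * 2 ^ n"
    by (intro mult_mono) (auto simp: less_imp_le[OF of_nat_less_two_power])
  then show ?thesis by (simp flip: power_mult_distrib)
qed

text \<open>The quotient \<open>3 / cos \<phi>\<close> compares two disks about
  \<open>d / 2\<close>: one of radius \<open>d / 2 * cos \<phi>\<close> inside the sector, and one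
  of radius \<open>3 * d / 2\<close> that covers the disk of radius \<open>d\<close> about the
  vertex. The outer factor comes from \<open>2 * t + t\<^sup>2 \<le> 3 * t\<close> for
  \<open>0 \<le> t \<le> 1\<close>.\<close>

definition corner_growth :: "real \<Rightarrow> real" where
  "corner_growth \<alpha> = 3 * ln (3 / cos ((1 - \<alpha>) * pi / 2))"

definition kolmogorov_const :: "real \<Rightarrow> real" where
  "kolmogorov_const \<alpha> = 8 * exp (corner_growth \<alpha>)"

context
  fixes \<alpha> :: real
  assumes \<alpha>: "0 < \<alpha>" "\<alpha> \<le> 1"
begin

lemma corner_growth_nonneg: "corner_growth \<alpha> \<ge> 0"
proof -
  have "0 < cos ((1 - \<alpha>) * pi / 2)" using \<alpha> by (intro cos_gt_zero_pi) (auto simp: field_simps)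
  then show ?thesis by (auto simp: corner_growth_def intro: order_trans[OF cos_le_one])
qed

text \<open>A Bernstein-Walsh inequality. The map \<open>v \<mapsto> - d * v powr (2 - \<alpha>)\<close> takes the right half plane onto
  the complement of the sector, and the half-disk bound applies in the variable \<open>v\<close>.\<close>
lemma poly_growth_at_corner:
  fixes p :: "complex poly"
  assumes deg: "degree p \<le> n" and d: "d > 0"
    and bound: "\<And>w. w \<in> closed_sector \<alpha> \<Longrightarrow> norm w \<le> d \<Longrightarrow> norm (poly p w) \<le> A"
    and w: "norm w \<le> d"
  shows "norm (poly p w) \<le> A * exp (corner_growth \<alpha> * real n * (norm w / d) powr (1 / (2 - \<alpha>)))"
proof -
  define \<phi> where "\<phi> = (1 - \<alpha>) * pi / 2"
  define \<sigma> where "\<sigma> = cos \<phi>"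
  have "0 \<le> \<phi>" "\<phi> < pi / 2" using \<alpha> by (auto simp: \<phi>_def)
  then have \<sigma>: "0 < \<sigma>" "\<sigma> \<le> 1" unfolding \<sigma>_def by (auto intro: cos_gt_zero_pi)
  define \<kappa> where "\<kappa> = ln (3 / \<sigma>)"
  have \<kappa>: "corner_growth \<alpha> = 3 * \<kappa>" by (simp add: corner_growth_def \<kappa>_def \<sigma>_def \<phi>_def)
  have "\<kappa> \<ge> 0" using \<sigma> by (simp add: \<kappa>_def)
  have "norm (poly p 0) \<le> A" using d by (intro bound) (auto simp: closed_sector_def)
  then have "A \<ge> 0" by (rule order_trans[OF norm_ge_zero])
  have disk: "norm (poly p u) \<le> A" if u: "norm (u - of_real (d / 2)) \<le> d / 2 * \<sigma>" for u
  proof (rule bound)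
    have *: "Re (u * cis s) \<ge> 0" if "cos s = \<sigma>" for s
    proof -
      have "Re (u * cis s) = d / 2 * \<sigma> + Re ((u - of_real (d / 2)) * cis s)"
        using that by (simp add: algebra_simps)
      moreover have "\<bar>Re ((u - of_real (d / 2)) * cis s)\<bar> \<le> d / 2 * \<sigma>"
        using abs_Re_le_cmod[of "(u - of_real (d / 2)) * cis s"] u by (simp add: norm_mult)
      ultimately show ?thesis by linarith
    qed
    show "u \<in> closed_sector \<alpha>"
      using *[of \<phi>] *[of "- \<phi>"] unfolding closed_sector_def \<sigma>_def \<phi>_def by simp
    have "norm u \<le> norm (u - of_real (d / 2)) + norm (of_real (d / 2) :: complex)"
      using norm_triangle_ineq[of "u - of_real (d / 2)" "of_real (d / 2)"] by (simp only: diff_add_cancel)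
    also have "norm (of_real (d / 2) :: complex) = d / 2" using d by (simp only: norm_of_real abs_of_pos half_gt_zero)
    also have "norm (u - of_real (d / 2)) \<le> d / 2 * 1"
      by (rule order_trans[OF u]) (use \<sigma> d in \<open>intro mult_left_mono; simp\<close>)
    finally show "norm u \<le> d" by simp
  qed
  \<comment> \<open>This bound, exponential in the full degree, is used on the arc of the half disk;
    near the corner \<open>half_disk_bound\<close> improves it.\<close>
  have crude: "norm (poly p u) \<le> A * exp (\<kappa> * real n)" if "norm u \<le> d" for u
  proof -
    have "norm (u - of_real (d / 2)) \<le> norm u + norm (of_real (d / 2) :: complex)"
      by (rule norm_triangle_ineq4)
    also have "norm (of_real (d / 2) :: complex) = d / 2" using d by (simp only: norm_of_real abs_of_pos half_gt_zero)
    finally have "norm (u - of_real (d / 2)) \<le> 3 * d / 2" using that by simp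
    moreover have "d / 2 * \<sigma> \<le> 3 * d / 2" using \<sigma> d by (simp add: field_simps)
    ultimately have "norm (poly p u) \<le> A * ((3 * d / 2) / (d / 2 * \<sigma>)) ^ n"
      using disk d \<sigma> by (intro poly_growth_outside_disk[OF deg]) auto
    also have "(3 * d / 2) / (d / 2 * \<sigma>) = exp \<kappa>" using d \<sigma> by (simp add: \<kappa>_def)
    finally show ?thesis by (simp add: exp_of_nat_mult[symmetric] mult.commute)
  qed
  show ?thesis
  proof (cases rule: sector_or_powr_image[OF \<alpha> d, of w])
    case 1
    have "A * 1 \<le> A * exp (corner_growth \<alpha> * real n * (norm w / d) powr (1 / (2 - \<alpha>)))"
      using \<open>A \<ge> 0\<close> \<open>\<kappa> \<ge> 0\<close> by (intro mult_left_mono) (auto simp: \<kappa>)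
    then show ?thesis using bound[OF 1 w] by simp
  next
    case (2 v)
    define G where "G v = poly p (- (of_real d * v powr of_real (2 - \<alpha>)))" for v
    have b: "2 - \<alpha> > 0" using \<alpha> by simp
    have nv: "norm v \<le> 1" using 2(2) w d \<alpha> by (simp add: powr_le1)
    have "norm (G v) \<le> A * exp (\<kappa> * real n * (2 * norm v / 1 + (norm v / 1)\<^sup>2))"
    proof (rule half_disk_bound[of G 1 "\<kappa> * real n" A v])
      show "G holomorphic_on {v. Re v > 0}" unfolding G_def
        by (intro holomorphic_intros holomorphic_on_powr_half_plane)
      show "continuous_on {v. Re v \<ge> 0} G" unfolding G_def
        by (intro continuous_intros continuous_on_powr_half_plane b)
      have nG: "norm (- (of_real d * v powr of_real (2 - \<alpha>))) \<le> d" if "norm v \<le> 1" for v :: complex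
        using that d b by (simp add: norm_mult norm_powr_real_powr' powr_le1 del: of_real_diff)
      show "norm (G (\<i> * of_real y)) \<le> A" if "\<bar>y\<bar> \<le> 1" for y
        unfolding G_def using that d \<alpha>
        by (intro bound nG imaginary_powr_opposite_sector) (auto simp: norm_mult)
      show "norm (G v) \<le> A * exp (\<kappa> * real n)" if "norm v = 1" for v
        unfolding G_def using that by (intro crude nG) auto
    qed (use 2 nv \<open>\<kappa> \<ge> 0\<close> in auto)
    also have "\<dots> \<le> A * exp (\<kappa> * real n * (3 * norm v))"
    proof -
      have "2 * norm v + (norm v)\<^sup>2 \<le> 3 * norm v"
        using nv by (simp add: power2_eq_square mult_left_le)
      then have "\<kappa> * real n * (2 * norm v + (norm v)\<^sup>2) \<le> \<kappa> * real n * (3 * norm v)"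
        using \<open>\<kappa> \<ge> 0\<close> by (intro mult_left_mono) auto
      then show ?thesis using \<open>A \<ge> 0\<close> by (intro mult_left_mono) auto
    qed
    also have "\<dots> = A * exp (corner_growth \<alpha> * real n * (norm w / d) powr (1 / (2 - \<alpha>)))"
      by (simp add: 2(2) \<kappa> mult_ac)
    finally show ?thesis unfolding G_def 2(3)[symmetric] .
  qed
qed

lemma kolmogorov_const_ge_1: "kolmogorov_const \<alpha> \<ge> 1"
  using one_le_exp_iff[of "corner_growth \<alpha>"] corner_growth_nonneg
  unfolding kolmogorov_const_def by linarith

text \<open>Translation by \<open>z\<close> maps the closed sector into the sector, so at every
  point the Taylor polynomial of \<open>g\<close> is controlled on a full corner. The
  Bernstein-Walsh inequality carries this over to a circle about the corner, and Cauchy's estimate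
  there gives the coefficient of index \<open>k\<close>.\<close>

lemma kolmogorov_sector:
  assumes hol: "g holomorphic_on sector \<alpha>" and A: "A > 0" and B: "B > 0"
    and gA: "\<And>w. w \<in> sector \<alpha> \<Longrightarrow> norm (g w) \<le> A"
    and gB: "\<And>w. w \<in> sector \<alpha> \<Longrightarrow> norm ((deriv ^^ n) g w) \<le> B"
    and k: "1 \<le> k" "k < n" and z: "z \<in> sector \<alpha>"
  shows "norm ((deriv ^^ k) g z) \<le> 2 * kolmogorov_const \<alpha> ^ k *
    (real n / real k) powr ((1 - \<alpha>) * real k) * A * (B / A) powr (real k / real n)"
proof -
  define \<kappa> where "\<kappa> = corner_growth \<alpha>"
  define b where "b = 2 - \<alpha>"
  have b: "1 \<le> b" "b < 2" using \<alpha> by (auto simp: b_def)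
  define p where "p = (\<Sum>i<n. monom ((deriv ^^ i) g z / fact i) i)"
  have polyp: "poly p w = (\<Sum>i\<le>n - 1. (deriv ^^ i) g z * w ^ i / fact i)" for w
  proof -
    have "{..<n} = {..n - 1}" using k by auto
    then show ?thesis by (simp add: p_def poly_sum poly_monom)
  qed
  have deg: "degree p \<le> n" unfolding p_def
    by (intro degree_sum_le) (auto intro: order_trans[OF degree_monom_le])
  have coeff: "coeff p k = (deriv ^^ k) g z / fact k"
    using k unfolding p_def coeff_sum by (simp add: coeff_monom if_distrib cong: if_cong)
  \<comment> \<open>The radius up to which the Taylor remainder stays below \<open>A\<close>: this
    amounts to \<open>(n / 8) ^ n \<le> fact (n - 1)\<close>, which holds because
    \<open>exp n * n \<le> 8 ^ n\<close>.\<close>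
  define d where "d = (A / B) powr (1 / real n) * (real n / 8)"
  have "d > 0" using A B k by (simp add: d_def)
  have "((A / B) powr (1 / real n)) ^ n = A / B"
    using A B k by (simp add: powr_realpow[symmetric] powr_powr)
  then have dn: "d ^ n = A / B * (real n / 8) ^ n" unfolding d_def power_mult_distrib by simp
  have rem: "B * d ^ n / fact (n - 1) \<le> A"
  proof -
    have "fact n = real n * fact (n - 1)" using k by (simp add: fact_reduce)
    then have "real n ^ n \<le> exp (real n) * real n * fact (n - 1)"
      using power_self_le_fact[of n] by (simp add: mult_ac)
    also have "\<dots> \<le> 8 ^ n * fact (n - 1)"
      using exp_mult_le_8_power[of n] k by (intro mult_right_mono) auto
    finally have "(real n / 8) ^ n \<le> fact (n - 1)" by (simp add: power_divide field_simps)
    then have "A * (real n / 8) ^ n \<le> A * fact (n - 1)" using A by simp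
    then show ?thesis using B by (simp add: dn field_simps)
  qed
  have p2A: "norm (poly p w) \<le> 2 * A" if w: "w \<in> closed_sector \<alpha>" "norm w \<le> d" for w
  proof -
    have zw: "z + w \<in> sector \<alpha>" by (rule sector_add[OF \<alpha> z w(1)])
    have "norm ((deriv ^^ 0) g (z + w) - (\<Sum>i\<le>n - 1. (deriv ^^ i) g z * (z + w - z) ^ i / fact i)) \<le>
        B * norm (z + w - z) ^ Suc (n - 1) / fact (n - 1)"
    proof (rule complex_Taylor[OF convex_sector[OF \<alpha>] _ _ z zw, where f = "\<lambda>i. (deriv ^^ i) g"])
      show "((deriv ^^ i) g has_field_derivative (deriv ^^ Suc i) g x) (at x within sector \<alpha>)"
        if "x \<in> sector \<alpha>" for i x
        using holomorphic_derivI[OF holomorphic_higher_deriv[OF hol open_sector[OF \<alpha>]] open_sector[OF \<alpha>] that]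
        by simp
      show "norm ((deriv ^^ Suc (n - 1)) g x) \<le> B" if "x \<in> sector \<alpha>" for x
        using gB[OF that] k by (simp del: funpow.simps)
    qed
    then have "norm (g (z + w) - poly p w) \<le> B * norm w ^ n / fact (n - 1)"
      using k by (simp add: polyp)
    also have "\<dots> \<le> B * d ^ n / fact (n - 1)"
      using w B by (intro divide_right_mono mult_left_mono power_mono) auto
    finally have "norm (g (z + w) - poly p w) \<le> A" using rem by simp
    then have "norm (poly p w) \<le> norm (g (z + w)) + A"
      using norm_triangle_sub[of "poly p w" "g (z + w)"] by (simp add: norm_minus_commute)
    then show ?thesis using gA[OF zw] by simp
  qed
  \<comment> \<open>At this radius the growth exponent, proportional to
    \<open>n * (r / d) powr (1 / b)\<close>, is proportional to \<open>k\<close> instead of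
    \<open>n\<close>.\<close>
  define r where "r = d * (real k / real n) powr b"
  have kn: "0 < real k / real n" "real k / real n \<le> 1" using k by auto
  have r: "r > 0" "r \<le> d" using \<open>d > 0\<close> kn b k by (simp_all add: r_def powr_le1 mult_left_le)
  have "norm (coeff p k) \<le> (2 * A * exp (\<kappa> * real k)) / r ^ k"
  proof (rule norm_coeff_le[OF r(1)])
    fix w :: complex assume w: "norm w = r"
    have "(norm w / d) powr (1 / b) = real k / real n"
      using w \<open>d > 0\<close> kn b by (simp add: r_def powr_powr)
    then have e: "\<kappa> * real n * (norm w / d) powr (1 / (2 - \<alpha>)) = \<kappa> * real k"
      using k by (simp add: b_def)
    show "norm (poly p w) \<le> 2 * A * exp (\<kappa> * real k)"
      using poly_growth_at_corner[OF deg \<open>d > 0\<close> p2A, of w] w r unfolding \<kappa>_def[symmetric] e by simp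
  qed
  then have "norm ((deriv ^^ k) g z) \<le> 2 * A * exp (\<kappa> * real k) * (fact k / r ^ k)"
    by (simp add: coeff norm_divide field_simps)
  also have "\<dots> \<le> 2 * A * exp (\<kappa> * real k) * (real k ^ k / r ^ k)"
    using A r fact_le_power[of k, where 'a = real] k
    by (intro mult_left_mono divide_right_mono) auto
  also have "real k ^ k / r ^ k = 8 ^ k * ((real n / real k) powr ((1 - \<alpha>) * real k) * (B / A) powr (real k / real n))"
  proof -
    have "ln (real k ^ k / r ^ k) =
        ln (8 ^ k * ((real n / real k) powr ((1 - \<alpha>) * real k) * (B / A) powr (real k / real n)))"
      using A B k r(1) \<open>d > 0\<close> unfolding r_def d_def
      by (simp add: ln_mult ln_div ln_powr ln_realpow b_def field_simps)
    then show ?thesis using A B k r(1) by (subst (asm) ln_inj_iff) auto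
  qed
  finally show ?thesis by (simp add: kolmogorov_const_def \<kappa>_def power_mult_distrib exp_of_nat_mult[symmetric] mult_ac)
qed

end

section \<open>Passage from \<open>M\<close> to \<open>seq_alpha M \<alpha>\<close>\<close>

lemma ultraholomorphic_class_iff:
  assumes M: "\<And>j. M j > 0"
  shows "f \<in> ultraholomorphic_class M S \<longleftrightarrow> f holomorphic_on S \<and>
    (\<exists>h>0. \<exists>K>0. \<forall>z\<in>S. \<forall>j. norm ((deriv ^^ j) f z) \<le> K * h ^ j * M j)"
proof -
  have *: "bdd_above {norm ((deriv ^^ j) f z) / (h ^ j * M j) | z j. z \<in> S} \<longleftrightarrow>
      (\<exists>K>0. \<forall>z\<in>S. \<forall>j. norm ((deriv ^^ j) f z) \<le> K * h ^ j * M j)" if "h > 0" for h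
  proof
    assume "bdd_above {norm ((deriv ^^ j) f z) / (h ^ j * M j) | z j. z \<in> S}"
    then obtain K where K: "\<And>z j. z \<in> S \<Longrightarrow> norm ((deriv ^^ j) f z) / (h ^ j * M j) \<le> K"
      by (auto simp: bdd_above_def)
    have "norm ((deriv ^^ j) f z) \<le> max K 1 * h ^ j * M j" if "z \<in> S" for z j
    proof -
      have "norm ((deriv ^^ j) f z) / (h ^ j * M j) \<le> max K 1" using K[OF that, of j] by simp
      then show ?thesis using \<open>h > 0\<close> M[of j] by (simp add: field_simps)
    qed
    then show "\<exists>K>0. \<forall>z\<in>S. \<forall>j. norm ((deriv ^^ j) f z) \<le> K * h ^ j * M j"
      by (intro exI[of _ "max K 1"]) auto
  next
    assume "\<exists>K>0. \<forall>z\<in>S. \<forall>j. norm ((deriv ^^ j) f z) \<le> K * h ^ j * M j"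
    then obtain K where K: "\<And>z j. z \<in> S \<Longrightarrow> norm ((deriv ^^ j) f z) \<le> K * h ^ j * M j" by blast
    show "bdd_above {norm ((deriv ^^ j) f z) / (h ^ j * M j) | z j. z \<in> S}"
    proof (rule bdd_aboveI[of _ K], safe)
      fix z j assume "z \<in> S"
      then show "norm ((deriv ^^ j) f z) / (h ^ j * M j) \<le> K"
        using K[of z j] \<open>h > 0\<close> M[of j] by (simp add: field_simps)
    qed
  qed
  show ?thesis unfolding ultraholomorphic_class_def mem_Collect_eq
    by (intro conj_cong refl ex_cong1 *)
qed

lemma ultraholomorphic_class_mono:
  assumes "\<And>j. 0 < N j" "\<And>j. N j \<le> M j"
  shows "ultraholomorphic_class N S \<subseteq> ultraholomorphic_class M S"
proof
  fix f assume "f \<in> ultraholomorphic_class N S"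
  then obtain h K where *: "f holomorphic_on S" "h > 0" "K > 0"
    "\<And>z j. z \<in> S \<Longrightarrow> norm ((deriv ^^ j) f z) \<le> K * h ^ j * N j"
    by (auto simp: ultraholomorphic_class_iff assms(1))
  have "norm ((deriv ^^ j) f z) \<le> K * h ^ j * M j" if "z \<in> S" for z j
    by (rule order_trans[OF *(4)[OF that]]) (use * assms(2) in \<open>intro mult_left_mono; simp\<close>)
  moreover have "M j > 0" for j using assms[of j] by linarith
  ultimately show "f \<in> ultraholomorphic_class M S" using * by (auto simp: ultraholomorphic_class_iff)
qed

text \<open>Between two indices \<open>p \<le> j \<le> q\<close> at which the minorant touches the sequence it is geometric, so the
  Kolmogorov inequality interpolates the bounds at \<open>p\<close> and \<open>q\<close>.\<close>
lemma ultraholomorphic_class_seq_alpha: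
  assumes M: "\<And>j. M j > 0" and \<alpha>: "0 < \<alpha>" "\<alpha> \<le> 1"
    and lim: "filterlim (\<lambda>j. root j (Gbar (1 - \<alpha>) j * M j)) at_top sequentially"
  shows "ultraholomorphic_class M (sector \<alpha>) = ultraholomorphic_class (seq_alpha M \<alpha>) (sector \<alpha>)"
proof
  define x where "x j = Gbar (1 - \<alpha>) j * M j" for j
  define N where "N = seq_alpha M \<alpha>"
  have x: "x j > 0" for j using M Gbar_pos by (simp add: x_def)
  have xlim: "filterlim (\<lambda>j. root j (x j)) at_top sequentially" using lim by (simp add: x_def)
  have N: "N j = Gbar (\<alpha> - 1) j * lc_minorant x j" for j by (simp add: N_def seq_alpha_def x_def[abs_def])
  have Npos: "N j > 0" for j
    unfolding N using Gbar_pos log_convex_pos[OF lc_minorant_log_convex[OF x xlim]] by simp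
  have Mx: "M j = Gbar (\<alpha> - 1) j * x j" for j
    using Gbar_cancel[of "\<alpha> - 1" j] by (simp add: x_def)
  have NM: "N j \<le> M j" for j
    unfolding N Mx using lc_minorant_le[OF x xlim] less_imp_le[OF Gbar_pos] by (intro mult_left_mono)
  show "ultraholomorphic_class (seq_alpha M \<alpha>) (sector \<alpha>) \<subseteq> ultraholomorphic_class M (sector \<alpha>)"
    using Npos NM unfolding N_def by (intro ultraholomorphic_class_mono) auto
  define C where "C = kolmogorov_const \<alpha>"
  have "C \<ge> 1" unfolding C_def by (rule kolmogorov_const_ge_1[OF \<alpha>])
  show "ultraholomorphic_class M (sector \<alpha>) \<subseteq> ultraholomorphic_class (seq_alpha M \<alpha>) (sector \<alpha>)"
  proof
    fix f assume "f \<in> ultraholomorphic_class M (sector \<alpha>)"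
    then obtain h K where f: "f holomorphic_on sector \<alpha>" "h > 0" "K > 0"
      "\<And>z j. z \<in> sector \<alpha> \<Longrightarrow> norm ((deriv ^^ j) f z) \<le> K * h ^ j * M j"
      by (auto simp: ultraholomorphic_class_iff M)
    have *: "norm ((deriv ^^ j) f z) \<le> 2 * K * (2 * C * h) ^ j * N j" if z: "z \<in> sector \<alpha>" for z j
    proof -
      obtain p q c s where pq: "p \<le> j" "j \<le> q" and lcj: "lc_minorant x j = exp (c + s * real j)"
        and xp: "x p = exp (c + s * real p)" and xq: "x q = exp (c + s * real q)"
        using lc_minorant_line[OF x xlim] by blast
      have lnM: "ln (M i) = ln (x i) - (1 - \<alpha>) * (real i * ln (real i))" for i
        unfolding Mx using x[of i] Gbar_pos[of "\<alpha> - 1" i] by (simp add: ln_mult ln_Gbar algebra_simps)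
      have lnN: "ln (N j) = c + s * real j - (1 - \<alpha>) * (real j * ln (real j))"
        unfolding N lcj using Gbar_pos[of "\<alpha> - 1" j] by (simp add: ln_mult ln_Gbar algebra_simps)
      show ?thesis
      proof (cases "p < j \<and> j < q")
        case False
        then have "j = p \<or> j = q" using pq by linarith
        then have "x j = exp (c + s * real j)" using xp xq by (elim disjE) (simp_all only:)
        then have "M j = N j" by (simp only: Mx N lcj)
        have "(1 * h) ^ j \<le> (2 * C * h) ^ j"
          using f(2) \<open>C \<ge> 1\<close> by (intro power_mono mult_right_mono) auto
        then have "K * h ^ j * M j \<le> 2 * K * (2 * C * h) ^ j * N j"
          unfolding \<open>M j = N j\<close> using f(2,3) \<open>C \<ge> 1\<close> Npos[of j] by (intro mult_mono) auto
        then show ?thesis using f(4)[OF z, of j] by linarith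
      next
        case True
        define n where "n = q - p"
        define k where "k = j - p"
        have k: "1 \<le> k" "k < n" using True by (auto simp: n_def k_def)
        have j: "j = p + k" and q: "q = p + n" using pq by (auto simp: k_def n_def)
        define A where "A = K * h ^ p * M p"
        define B where "B = K * h ^ q * M q"
        have AB: "A > 0" "B > 0" using f(2,3) M by (auto simp: A_def B_def)
        have eq: "(deriv ^^ i) ((deriv ^^ p) f) = (deriv ^^ (p + i)) f" for i
          using funpow_add[of i p deriv] by (metis add.commute comp_apply)
        have "norm ((deriv ^^ k) ((deriv ^^ p) f) z) \<le>
            2 * C ^ k * (real n / real k) powr ((1 - \<alpha>) * real k) * A * (B / A) powr (real k / real n)"
          unfolding C_def
        proof (rule kolmogorov_sector[OF \<alpha> _ AB _ _ k z])
          show "(deriv ^^ p) f holomorphic_on sector \<alpha>"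
            by (rule holomorphic_higher_deriv[OF f(1) open_sector[OF \<alpha>]])
          show "norm ((deriv ^^ p) f w) \<le> A" if "w \<in> sector \<alpha>" for w
            using f(4)[OF that] by (simp add: A_def)
          show "norm ((deriv ^^ n) ((deriv ^^ p) f) w) \<le> B" if "w \<in> sector \<alpha>" for w
            using f(4)[OF that] by (simp add: B_def eq q)
        qed
        then have "norm ((deriv ^^ j) f z) \<le>
            2 * C ^ k * (real n / real k) powr ((1 - \<alpha>) * real k) * A * (B / A) powr (real k / real n)"
          by (simp add: eq j)
        also have "\<dots> \<le> 2 * K * (2 * C * h) ^ j * N j"
        proof -
          define t where "t = real k / real n"
          have "ln (2 * C ^ k * (real n / real k) powr ((1 - \<alpha>) * real k) * A * (B / A) powr t) =
              ln 2 + real k * ln C + (1 - \<alpha>) * (real k * ln (real n / real k)) + (1 - t) * ln A + t * ln B"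
            using AB k \<open>C \<ge> 1\<close> by (simp add: ln_mult ln_powr ln_realpow ln_div algebra_simps)
          \<comment> \<open>Since \<open>j = (1 - t) * p + t * q\<close>, the affine parts of
            \<open>ln A\<close> and \<open>ln B\<close> interpolate exactly to the logarithm of the
            minorant at \<open>j\<close>. Only the weights do not, and \<open>entropy_bound\<close>
            compares them.\<close>
          moreover have "(1 - t) * ln A + t * ln B = ln K + real j * ln h + (c + s * real j) -
              (1 - \<alpha>) * ((1 - t) * (real p * ln (real p)) + t * (real q * ln (real q)))"
          proof -
            have lA: "ln A = ln K + real p * ln h + (c + s * real p) - (1 - \<alpha>) * (real p * ln (real p))"
              using f(2,3) M[of p] by (simp add: A_def ln_mult ln_realpow lnM xp)
            have lB: "ln B = ln K + real q * ln h + (c + s * real q) - (1 - \<alpha>) * (real q * ln (real q))"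
              using f(2,3) M[of q] by (simp add: B_def ln_mult ln_realpow lnM xq)
            have jt: "real j = (1 - t) * real p + t * real q"
              using k by (simp add: t_def j q field_simps)
            show ?thesis unfolding jt lA lB by (simp add: algebra_simps)
          qed
          ultimately have lhs: "ln (2 * C ^ k * (real n / real k) powr ((1 - \<alpha>) * real k) * A * (B / A) powr t) =
              ln 2 + real k * ln C + ln K + real j * ln h + (c + s * real j) +
              (1 - \<alpha>) * (real k * ln (real n / real k) - (1 - t) * (real p * ln (real p)) - t * (real q * ln (real q)))"
            by (simp add: algebra_simps)
          have rhs: "ln (2 * K * (2 * C * h) ^ j * N j) = ln 2 + ln K + real j * ln 2 + real j * ln C +
              real j * ln h + (c + s * real j) - (1 - \<alpha>) * (real j * ln (real j))"
            using f(2,3) \<open>C \<ge> 1\<close> Npos[of j] by (simp add: ln_mult ln_realpow lnN algebra_simps)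
          have "(1 - \<alpha>) * (real k * ln (real n / real k) + real j * ln (real j) - (1 - t) * (real p * ln (real p)) -
              t * (real q * ln (real q))) \<le> (1 - \<alpha>) * (real j * ln 2)"
            using entropy_bound[of "real p" "real k" "real n"] k \<alpha>
            by (intro mult_left_mono) (auto simp: t_def j q)
          also have "\<dots> \<le> 1 * (real j * ln 2)" using \<alpha> by (intro mult_right_mono) auto
          finally have ent: "(1 - \<alpha>) * (real k * ln (real n / real k) - (1 - t) * (real p * ln (real p)) -
              t * (real q * ln (real q))) + (1 - \<alpha>) * (real j * ln (real j)) \<le> real j * ln 2"
            by (simp add: algebra_simps)
          have "real k * ln C \<le> real j * ln C" using \<open>C \<ge> 1\<close> by (intro mult_right_mono) (auto simp: j)
          then have "ln (2 * C ^ k * (real n / real k) powr ((1 - \<alpha>) * real k) * A * (B / A) powr t) \<le>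
              ln (2 * K * (2 * C * h) ^ j * N j)"
            unfolding lhs rhs using ent by linarith
          then show ?thesis unfolding t_def using AB k f(2,3) \<open>C \<ge> 1\<close> Npos[of j]
            by (subst (asm) ln_le_cancel_iff) auto
        qed
        finally show ?thesis .
      qed
    qed
    show "f \<in> ultraholomorphic_class (seq_alpha M \<alpha>) (sector \<alpha>)"
      unfolding N_def[symmetric] ultraholomorphic_class_iff[OF Npos]
    proof (intro conjI f(1) exI ballI allI)
      show "0 < 2 * C * h" "0 < 2 * K" using f(2,3) \<open>C \<ge> 1\<close> by simp_all
    qed (rule *)
  qed
qed

section \<open>A kernel for the sector\<close>

text \<open>The logarithm of the modulus of one factor of the canonical product, on a boundary ray
  at distance \<open>r\<close> from the vertex; \<open>y\<close> stands for
  \<open>r powr (- 1 / \<beta>)\<close> times the index of the zero.\<close>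

definition critical_log :: "real \<Rightarrow> real \<Rightarrow> real" where
  "critical_log \<beta> y = ln (norm (1 + of_real (y powr (- \<beta>)) * cis (\<beta> * pi / 2)))"

text \<open>The integral of \<open>critical_log\<close> over the positive half line vanishes, by Cauchy's theorem for
  \<open>Log (1 + s\<^sup>-\<^sup>\<beta>)\<close> in the right half plane. With \<open>s = exp \<zeta>\<close> the domain becomes a
  strip.\<close>
lemma critical_log_primitive:
  assumes \<beta>: "1 < \<beta>" "\<beta> < 2"
  obtains V :: "real \<Rightarrow> real" where "V 0 = 0" "continuous_on {0..} V"
    "\<And>y. y > 0 \<Longrightarrow> (V has_real_derivative critical_log \<beta> y) (at y)" "(V \<longlongrightarrow> 0) at_top"
proof -
  define S where "S = {\<zeta>::complex. \<bar>Im \<zeta>\<bar> < pi / \<beta>}"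
  define g where "g \<zeta> = exp \<zeta> * Ln (1 + exp (- of_real \<beta> * \<zeta>))" for \<zeta>
  have S_eq: "S = {\<zeta>. Im \<zeta> < pi / \<beta>} \<inter> {\<zeta>. Im \<zeta> > - (pi / \<beta>)}" by (auto simp: S_def)
  have opS: "open S" unfolding S_eq by (intro open_Int open_halfspace_Im_lt open_halfspace_Im_gt)
  have cvS: "convex S" unfolding S_eq by (intro convex_Int convex_halfspace_Im_lt convex_halfspace_Im_gt)
  \<comment> \<open>In the strip \<open>\<beta> * Im \<zeta>\<close> stays strictly between
    \<open>- pi\<close> and \<open>pi\<close>, so the exponential is never a negative real
    number.\<close>
  have slit: "1 + exp (- of_real \<beta> * \<zeta>) \<notin> \<real>\<^sub>\<le>\<^sub>0" if "\<zeta> \<in> S" for \<zeta>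
  proof
    assume *: "1 + exp (- of_real \<beta> * \<zeta>) \<in> \<real>\<^sub>\<le>\<^sub>0"
    have im: "\<bar>\<beta> * Im \<zeta>\<bar> < pi" using that \<beta> by (simp add: S_def abs_mult field_simps)
    have "exp (- \<beta> * Re \<zeta>) * sin (\<beta> * Im \<zeta>) = 0"
      using * by (auto simp: complex_nonpos_Reals_iff Im_exp)
    then have "sin (\<beta> * Im \<zeta>) = 0" by simp
    from sin_eq_0_pi[OF _ _ this] have "\<beta> * Im \<zeta> = 0" using im by linarith
    then have "cos (\<beta> * Im \<zeta>) = 1" by (metis cos_zero)
    then have "Re (exp (- of_real \<beta> * \<zeta>)) = exp (- \<beta> * Re \<zeta>)" by (simp add: Re_exp)
    then have "Re (1 + exp (- of_real \<beta> * \<zeta>)) > 0" by (simp add: add_pos_pos)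
    then show False using * by (auto simp: complex_nonpos_Reals_iff)
  qed
  have holg: "g holomorphic_on S" unfolding g_def
    by (intro holomorphic_intros) (use slit in auto)
  obtain H where H: "\<And>\<zeta>. \<zeta> \<in> S \<Longrightarrow> (H has_field_derivative g \<zeta>) (at \<zeta> within S)"
    using holomorphic_convex_primitive'[OF cvS opS holg] by blast
  then have H: "(H has_field_derivative g \<zeta>) (at \<zeta>)" if "\<zeta> \<in> S" for \<zeta>
    using at_within_open[OF that opS] that by metis
  have piS: "Complex a b \<in> S" if "\<bar>b\<bar> \<le> pi / 2" for a b
  proof -
    have "pi / 2 < pi / \<beta>" using \<beta> by (intro divide_strict_left_mono) auto
    with that have "\<bar>b\<bar> < pi / \<beta>" by linarith
    then show ?thesis by (simp add: S_def)
  qed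
  \<comment> \<open>Up to the factor \<open>1 / 2\<close> this is the imaginary part of the integral
    of \<open>Ln (1 + s powr (- \<beta>))\<close> from \<open>- \<i> * y\<close> to
    \<open>\<i> * y\<close>. Since \<open>ds = \<i> dy\<close> there, the derivative picks out the
    real part of the logarithm; both ends contribute equally, hence the division by 2.\<close>
  define V where "V y = (if y = 0 then 0 else
    Im (H (Complex (ln y) (pi / 2)) - H (Complex (ln y) (- (pi / 2)))) / 2)" for y
  have exp_eq: "exp (- of_real \<beta> * Complex (ln y) b) = of_real (y powr (- \<beta>)) * cis (- \<beta> * b)" if "y > 0" for y b
    using that by (simp add: exp_eq_polar powr_def Complex_eq scaleR_conv_of_real)
  have exp_eq': "exp (Complex (ln y) b) = of_real y * cis b" if "y > 0" for y b
    using that by (simp add: exp_eq_polar scaleR_conv_of_real)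
  have gval: "g (Complex (ln y) b) = of_real y * cis b * Ln (1 + of_real (y powr (- \<beta>)) * cis (- \<beta> * b))"
    if "y > 0" for y b
    unfolding g_def exp_eq[OF that] exp_eq'[OF that] ..
  have slit': "1 + of_real (y powr (- \<beta>)) * cis (- \<beta> * b) \<notin> \<real>\<^sub>\<le>\<^sub>0"
    if "y > 0" "\<bar>b\<bar> \<le> pi / 2" for y b
    using slit[OF piS[OF that(2), of "ln y"]] unfolding exp_eq[OF that(1)] .
  have der: "(V has_real_derivative critical_log \<beta> y) (at y)" if y: "y > 0" for y
  proof -
    define u :: complex where "u = of_real (y powr (- \<beta>)) * cis (\<beta> * pi / 2)"
    have part: "((\<lambda>y. Im (H (Complex (ln y) b))) has_real_derivative
        Im (g (Complex (ln y) b) * of_real (1 / y))) (at y)" if "\<bar>b\<bar> \<le> pi / 2" for b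
    proof -
      have "((\<lambda>y. Complex (ln y) b) has_vector_derivative of_real (1 / y)) (at y)"
        using DERIV_ln_divide[OF y] by (simp add: has_vector_derivative_complex_iff)
      from field_vector_diff_chain_at[OF this H[OF piS[OF that]]]
      have "((\<lambda>y. H (Complex (ln y) b)) has_vector_derivative of_real (1 / y) * g (Complex (ln y) b)) (at y)"
        by (simp add: o_def)
      from bounded_linear.has_vector_derivative[OF bounded_linear_Im this]
      show ?thesis by (simp add: has_real_derivative_iff_has_vector_derivative mult.commute)
    qed
    have val: "Im (g (Complex (ln y) b) * of_real (1 / y)) = sgn b * critical_log \<beta> y" if "b = pi / 2 \<or> b = - (pi / 2)" for b
    proof -
      have "g (Complex (ln y) b) * of_real (1 / y) = cis b * Ln (1 + of_real (y powr (- \<beta>)) * cis (- \<beta> * b))"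
        using y by (simp add: gval)
      moreover have "cis b = sgn b * \<i>" using that by (elim disjE; hypsubst) (simp_all add: complex_eq_iff)
      ultimately have "Im (g (Complex (ln y) b) * of_real (1 / y)) =
          sgn b * Re (Ln (1 + of_real (y powr (- \<beta>)) * cis (- \<beta> * b)))" by simp
      also have "1 + of_real (y powr (- \<beta>)) * cis (- \<beta> * b) \<noteq> 0"
        using that slit'[OF y, of b] by (elim disjE; hypsubst) auto
      then have "Re (Ln (1 + of_real (y powr (- \<beta>)) * cis (- \<beta> * b))) =
          ln (norm (1 + of_real (y powr (- \<beta>)) * cis (- \<beta> * b)))" by simp
      also have "norm (1 + of_real (y powr (- \<beta>)) * cis (- \<beta> * b)) = norm (1 + u)"
        using that
      proof
        assume b: "b = pi / 2"
        have "1 + of_real (y powr (- \<beta>)) * cis (- \<beta> * b) = cnj (1 + u)"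
          by (simp add: u_def b cis_cnj)
        then show ?thesis by (simp only: complex_mod_cnj)
      qed (simp add: u_def)
      finally show ?thesis by (simp add: critical_log_def u_def)
    qed
    have "((\<lambda>y. Im (H (Complex (ln y) (pi / 2))) / 2 - Im (H (Complex (ln y) (- (pi / 2)))) / 2) has_real_derivative
        critical_log \<beta> y) (at y)"
    proof (rule DERIV_cong[OF DERIV_diff[OF DERIV_cdivide[OF part] DERIV_cdivide[OF part]]])
      show "Im (g (Complex (ln y) (pi / 2)) * of_real (1 / y)) / 2 -
          Im (g (Complex (ln y) (- (pi / 2))) * of_real (1 / y)) / 2 = critical_log \<beta> y"
        unfolding val[of "pi / 2", OF disjI1[OF refl]] val[of "- (pi / 2)", OF disjI2[OF refl]] by simp
    qed auto
    moreover have "\<forall>\<^sub>F t in nhds y. V t = Im (H (Complex (ln t) (pi / 2))) / 2 - Im (H (Complex (ln t) (- (pi / 2)))) / 2"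
    proof (rule eventually_mono)
      show "\<forall>\<^sub>F t in nhds y. t \<in> {0<..}" by (rule eventually_nhds_in_open) (use y in auto)
    qed (simp add: V_def diff_divide_distrib)
    ultimately show ?thesis by (subst DERIV_cong_ev[OF refl _ refl])
  qed
  \<comment> \<open>By Cauchy's theorem \<open>V y\<close> is also an integral over the half circle
    of radius \<open>y\<close>, of length \<open>pi * y\<close>, which is a vertical segment in the
    variable \<open>\<zeta>\<close>.\<close>
  have Vbound: "\<bar>V y\<bar> \<le> pi * (y * B)"
    if y: "y > 0" and B: "\<And>b. \<bar>b\<bar> \<le> pi / 2 \<Longrightarrow> norm (Ln (1 + of_real (y powr (- \<beta>)) * cis (- \<beta> * b))) \<le> B" for y B
  proof -
    have seg: "closed_segment (Complex (ln y) (- (pi / 2))) (Complex (ln y) (pi / 2)) \<subseteq> {Complex (ln y) b | b. \<bar>b\<bar> \<le> pi / 2}"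
      (is "?s \<subseteq> _")
    proof
      fix x assume "x \<in> ?s"
      then obtain u where u: "0 \<le> u" "u \<le> 1" "x = (1 - u) *\<^sub>R Complex (ln y) (- (pi / 2)) + u *\<^sub>R Complex (ln y) (pi / 2)"
        by (auto simp: in_segment)
      have "x = Complex (ln y) ((2 * u - 1) * (pi / 2))" using u(3) by (simp add: complex_eq_iff algebra_simps)
      moreover have "\<bar>(2 * u - 1) * (pi / 2)\<bar> \<le> 1 * (pi / 2)"
        unfolding abs_mult using u by (intro mult_mono) auto
      ultimately show "x \<in> {Complex (ln y) b | b. \<bar>b\<bar> \<le> pi / 2}"
        by (intro CollectI exI[of _ "(2 * u - 1) * (pi / 2)"]) simp
    qed
    have "norm (H (Complex (ln y) (pi / 2)) - H (Complex (ln y) (- (pi / 2)))) \<le>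
        (y * B) * norm (Complex (ln y) (pi / 2) - Complex (ln y) (- (pi / 2)))"
    proof (rule field_differentiable_bound[OF convex_closed_segment])
      fix x assume "x \<in> ?s"
      then obtain b where b: "x = Complex (ln y) b" "\<bar>b\<bar> \<le> pi / 2" using seg by blast
      show "(H has_field_derivative g x) (at x within ?s)"
        unfolding b(1) using H[OF piS[OF b(2)]] by (rule has_field_derivative_at_within)
      have "norm (g x) = y * norm (Ln (1 + of_real (y powr (- \<beta>)) * cis (- \<beta> * b)))"
        using y unfolding b(1) by (simp add: gval norm_mult)
      also have "\<dots> \<le> y * B" using B[OF b(2)] y by (intro mult_left_mono) auto
      finally show "norm (g x) \<le> y * B" .
    qed auto
    also have "norm (Complex (ln y) (pi / 2) - Complex (ln y) (- (pi / 2))) = pi"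
      by (simp add: cmod_def complex_diff)
    finally have "norm (H (Complex (ln y) (pi / 2)) - H (Complex (ln y) (- (pi / 2)))) \<le> pi * (y * B)"
      by (simp add: mult.commute)
    moreover have "\<bar>V y\<bar> \<le> norm (H (Complex (ln y) (pi / 2)) - H (Complex (ln y) (- (pi / 2)))) / 2"
      using abs_Im_le_cmod[of "H (Complex (ln y) (pi / 2)) - H (Complex (ln y) (- (pi / 2)))"] y
      by (simp add: V_def)
    moreover have "0 \<le> norm (H (Complex (ln y) (pi / 2)) - H (Complex (ln y) (- (pi / 2))))" by simp
    ultimately show ?thesis by linarith
  qed
  \<comment> \<open>Far out the logarithm is of size \<open>y powr (- \<beta>)\<close>, and
    \<open>\<beta> > 1\<close> outweighs the length of the half circle.\<close>
  have top: "(V \<longlongrightarrow> 0) at_top"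
  proof (rule Lim_null_comparison)
    have lim0: "((\<lambda>y::real. y powr (- \<beta>)) \<longlongrightarrow> 0) at_top" using \<beta> by real_asymp
    then have "\<forall>\<^sub>F y in at_top. y powr (- \<beta>) < 1 / 2" by (rule order_tendstoD) simp
    then show "\<forall>\<^sub>F y in at_top. norm (V y) \<le> pi * (y * (2 * y powr (- \<beta>)))"
      using eventually_gt_at_top[of 0]
    proof eventually_elim
      case (elim y)
      have "\<bar>V y\<bar> \<le> pi * (y * (2 * y powr (- \<beta>)))"
      proof (rule Vbound[OF elim(2)])
        fix b
        have "norm (of_real (y powr (- \<beta>)) * cis (- \<beta> * b)) = y powr (- \<beta>)" by (simp add: norm_mult)
        then show "norm (Ln (1 + of_real (y powr (- \<beta>)) * cis (- \<beta> * b))) \<le> 2 * y powr (- \<beta>)"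
          using norm_Ln_le[of "of_real (y powr (- \<beta>)) * cis (- \<beta> * b)"] elim(1) by simp
      qed
      then show ?case by simp
    qed
    show "((\<lambda>y. pi * (y * (2 * y powr (- \<beta>)))) \<longlongrightarrow> 0) at_top" using \<beta> by real_asymp
  qed
  \<comment> \<open>Near the origin the logarithm grows only like \<open>- ln y\<close>, so the
    length of the half circle wins.\<close>
  have zero: "(V \<longlongrightarrow> 0) (at_right 0)"
  proof (rule Lim_null_comparison)
    have "\<forall>\<^sub>F y in at_right 0. (0::real) < y \<and> y < 1 / 4"
      by (rule eventually_at_rightI[of 0 "1/4"]) auto
    then show "\<forall>\<^sub>F y in at_right 0. norm (V y) \<le> pi * (y * (ln 2 + \<beta> * (- ln y) + pi))"
    proof eventually_elim
      case (elim y)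
      have y: "y > 0" "y < 1 / 4" using elim by auto
      have up: "y powr (- \<beta>) \<ge> 4"
      proof -
        have "(1 / y) powr 1 \<le> (1 / y) powr \<beta>" using y \<beta> by (intro powr_mono) auto
        moreover have "(1 / y) powr \<beta> = y powr (- \<beta>)" using y by (simp add: powr_minus powr_divide inverse_eq_divide)
        moreover have "1 / y \<ge> 4" using y by (simp add: field_simps)
        ultimately show ?thesis using y by simp
      qed
      have "\<bar>V y\<bar> \<le> pi * (y * (ln 2 + \<beta> * (- ln y) + pi))"
      proof (rule Vbound[OF y(1)])
        fix b
        define w where "w = 1 + of_real (y powr (- \<beta>)) * cis (- \<beta> * b)"
        have nn: "norm (of_real (y powr (- \<beta>)) * cis (- \<beta> * b)) = y powr (- \<beta>)" by (simp add: norm_mult)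
        have w1: "norm w \<ge> 1" using norm_diff_ineq[of "of_real (y powr (- \<beta>)) * cis (- \<beta> * b)" 1] up
          unfolding nn by (simp add: w_def add.commute)
        have w2: "norm w \<le> 2 * y powr (- \<beta>)" using norm_triangle_ineq[of 1 "of_real (y powr (- \<beta>)) * cis (- \<beta> * b)"] up
          unfolding nn by (simp add: w_def)
        have "norm (Ln w) \<le> \<bar>Re (Ln w)\<bar> + \<bar>Im (Ln w)\<bar>" by (rule cmod_le)
        also have "\<bar>Im (Ln w)\<bar> \<le> pi" using Im_Ln_le_pi[of w] mpi_less_Im_Ln[of w] w1 by fastforce
        also have "\<bar>Re (Ln w)\<bar> = ln (norm w)" using w1 by (subst Re_Ln) auto
        also have "\<dots> \<le> ln (2 * y powr (- \<beta>))" using w1 w2 by (subst ln_le_cancel_iff) auto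
        also have "\<dots> = ln 2 + \<beta> * (- ln y)" using y by (simp add: ln_mult ln_powr)
        finally show "norm (Ln w) \<le> ln 2 + \<beta> * (- ln y) + pi" by simp
      qed
      then show ?case by simp
    qed
    show "((\<lambda>y. pi * (y * (ln 2 + \<beta> * (- ln y) + pi))) \<longlongrightarrow> 0) (at_right 0)" using \<beta> by real_asymp
  qed
  have "continuous_on {0..} V"
    unfolding continuous_on_eq_continuous_within
  proof
    fix y :: real assume "y \<in> {0..}"
    show "continuous (at y within {0..}) V"
    proof (cases "y = 0")
      case True
      have "at (0::real) within {0..} = at_right 0"
        by (metis atLeast_eq_UNIV_iff at_within_Ici_at_right)
      then show ?thesis using zero True by (simp add: continuous_within V_def)
    next
      case False
      then have "y > 0" using \<open>y \<in> {0..}\<close> by auto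
      then have "isCont V y" using der DERIV_isCont by blast
      then show ?thesis by (rule continuous_at_imp_continuous_within)
    qed
  qed
  then show ?thesis using der top by (intro that[of V]) (auto simp: V_def)
qed

lemma mvt_lower_bound:
  fixes V :: "real \<Rightarrow> real"
  assumes "0 \<le> a" "a < b" and cont: "continuous_on {0..} V"
    and der: "\<And>y. y > 0 \<Longrightarrow> (V has_real_derivative V' y) (at y)"
    and lower: "\<And>y. a < y \<Longrightarrow> y < b \<Longrightarrow> m \<le> V' y"
  shows "(b - a) * m \<le> V b - V a"
proof -
  have "\<exists>z. a < z \<and> z < b \<and> V b - V a = V' z * (b - a)"
  proof (rule mvt[OF \<open>a < b\<close>, where f = V and f' = "\<lambda>y h. V' y * h"])
    show "continuous_on {a..b} V" by (rule continuous_on_subset[OF cont]) (use \<open>0 \<le> a\<close> in auto)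
    show "(V has_derivative (\<lambda>h. V' x * h)) (at x)" if "a < x" for x
      using der[of x] that \<open>0 \<le> a\<close> by (simp add: has_field_derivative_def)
  qed blast
  then obtain z where z: "a < z" "z < b" "V b - V a = V' z * (b - a)" by blast
  then show ?thesis using lower[OF z(1,2)] assms(2) by (simp add: mult.commute mult_left_mono)
qed

text \<open>Completing the square exhibits the turning point
  \<open>y powr (- \<beta>) = - cos (\<beta> * pi / 2)\<close> and the minimum, which drive the
  comparison of sum and integral.\<close>

lemma critical_log_eq:
  assumes "y > 0"
  shows "critical_log \<beta> y =
    ln ((y powr (- \<beta>) - (- cos (\<beta> * pi / 2)))\<^sup>2 + (sin (\<beta> * pi / 2))\<^sup>2) / 2"
proof -
  define u where "u = y powr (- \<beta>)"
  have "(norm (1 + of_real u * cis (\<beta> * pi / 2)))\<^sup>2 = (1 + u * cos (\<beta> * pi / 2))\<^sup>2 + (u * sin (\<beta> * pi / 2))\<^sup>2"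
    by (simp add: cmod_power2)
  also have "\<dots> = (u - (- cos (\<beta> * pi / 2)))\<^sup>2 + (sin (\<beta> * pi / 2))\<^sup>2"
    using sin_cos_squared_add[of "\<beta> * pi / 2"] by algebra
  finally have "norm (1 + of_real u * cis (\<beta> * pi / 2)) =
      sqrt ((u - (- cos (\<beta> * pi / 2)))\<^sup>2 + (sin (\<beta> * pi / 2))\<^sup>2)"
    by (metis norm_ge_zero real_sqrt_unique)
  then show ?thesis by (simp add: critical_log_def u_def ln_sqrt)
qed

text \<open>Since \<open>critical_log\<close> decreases up to its minimum \<open>ln (sin (\<beta> * pi / 2))\<close> and increases afterwards,
  a Riemann sum exceeds the integral by at most one minimal term.\<close>
lemma critical_log_sum:
  fixes V :: "real \<Rightarrow> real"
  assumes \<beta>: "1 < \<beta>" "\<beta> < 2" and V: "V 0 = 0" "continuous_on {0..} V"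
    "\<And>y. y > 0 \<Longrightarrow> (V has_real_derivative critical_log \<beta> y) (at y)" and "\<rho> > 0"
  shows "\<rho> * (\<Sum>k<n. critical_log \<beta> (\<rho> * real (Suc k))) \<le> V (\<rho> * real (Suc n)) - \<rho> * ln (sin (\<beta> * pi / 2))"
proof -
  define c where "c = - cos (\<beta> * pi / 2)"
  define s where "s = sin (\<beta> * pi / 2)"
  have "s > 0" unfolding s_def using \<beta> by (intro sin_gt_zero) auto
  have cl: "critical_log \<beta> y = ln ((y powr (- \<beta>) - c)\<^sup>2 + s\<^sup>2) / 2" if "y > 0" for y
    using critical_log_eq[OF that] by (simp add: c_def s_def)
  have mono: "critical_log \<beta> y \<le> critical_log \<beta> x"
    if "x > 0" "y > 0" "\<bar>y powr (- \<beta>) - c\<bar> \<le> \<bar>x powr (- \<beta>) - c\<bar>" for x y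
    unfolding cl[OF that(1)] cl[OF that(2)] using abs_le_square_iff that(3) \<open>s > 0\<close>
    by (intro divide_right_mono, subst ln_le_cancel_iff) (auto intro: add_nonneg_pos)
  have dec: "y powr (- \<beta>) \<le> x powr (- \<beta>)" if "0 < x" "x \<le> y" for x y
    using that \<beta> by (intro powr_mono2') auto
  have low: "ln s \<le> critical_log \<beta> y" if "y > 0" for y
  proof -
    have "ln (s\<^sup>2) \<le> ln ((y powr (- \<beta>) - c)\<^sup>2 + s\<^sup>2)"
      using \<open>s > 0\<close> by (subst ln_le_cancel_iff) (auto intro: add_nonneg_pos)
    then show ?thesis using \<open>s > 0\<close> by (simp add: cl[OF that] ln_realpow)
  qed
  note inc = mvt_lower_bound[OF _ _ V(2,3)]
  have step: "\<rho> * real (Suc m) - \<rho> * real m = \<rho>" for m by (simp add: algebra_simps)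
  \<comment> \<open>As long as \<open>critical_log\<close> decreases, each node is compared with the
    cell to its left.\<close>
  have left: "\<rho> * (\<Sum>k<n. critical_log \<beta> (\<rho> * real (Suc k))) \<le> V (\<rho> * real n)"
    if "n > 0 \<longrightarrow> c \<le> (\<rho> * real n) powr (- \<beta>)" for n
    using that
  proof (induction n)
    case 0
    then show ?case using V(1) by simp
  next
    case (Suc n)
    have c: "c \<le> (\<rho> * real (Suc n)) powr (- \<beta>)" using Suc.prems by simp
    have "n > 0 \<longrightarrow> c \<le> (\<rho> * real n) powr (- \<beta>)"
      using order_trans[OF c dec[of "\<rho> * real n" "\<rho> * real (Suc n)"]] \<open>\<rho> > 0\<close> by simp
    with Suc.IH have "\<rho> * (\<Sum>k<n. critical_log \<beta> (\<rho> * real (Suc k))) \<le> V (\<rho> * real n)" by blast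
    moreover have "(\<rho> * real (Suc n) - \<rho> * real n) * critical_log \<beta> (\<rho> * real (Suc n)) \<le>
        V (\<rho> * real (Suc n)) - V (\<rho> * real n)"
    proof (rule inc)
      fix y assume y: "\<rho> * real n < y" "y < \<rho> * real (Suc n)"
      have "0 < y" using y(1) \<open>\<rho> > 0\<close> by (metis le_less_trans mult_nonneg_nonneg less_imp_le of_nat_0_le_iff)
      then show "critical_log \<beta> (\<rho> * real (Suc n)) \<le> critical_log \<beta> y"
        using c dec[of y "\<rho> * real (Suc n)"] y \<open>\<rho> > 0\<close> by (intro mono) auto
    qed (use \<open>\<rho> > 0\<close> in auto)
    ultimately show ?case unfolding step sum.lessThan_Suc distrib_left by linarith
  qed
  \<comment> \<open>The integral runs one cell beyond the sum. Once \<open>critical_log\<close>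
    increases, each node is compared with the cell to its right; before that, \<open>left\<close>
    applies and the spare cell is estimated by the minimum.\<close>
  show ?thesis unfolding s_def[symmetric]
  proof (induction n)
    case 0
    have "(\<rho> - 0) * ln s \<le> V \<rho> - V 0" using \<open>\<rho> > 0\<close> low by (intro inc) auto
    then show ?case using V(1) by simp
  next
    case (Suc n)
    have tail: "(\<rho> * real (Suc (Suc n)) - \<rho> * real (Suc n)) * ln s \<le>
        V (\<rho> * real (Suc (Suc n))) - V (\<rho> * real (Suc n))"
    proof (rule inc)
      show "ln s \<le> critical_log \<beta> y" if "\<rho> * real (Suc n) < y" for y
        using \<open>\<rho> > 0\<close> that by (intro low) (smt (verit) mult_nonneg_nonneg of_nat_0_le_iff)
    qed (use \<open>\<rho> > 0\<close> in auto)
    show ?case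
    proof (cases "c \<le> (\<rho> * real (Suc n)) powr (- \<beta>)")
      case True
      then show ?thesis using left[of "Suc n"] tail unfolding step by simp
    next
      case False
      have "(\<rho> * real (Suc (Suc n)) - \<rho> * real (Suc n)) * critical_log \<beta> (\<rho> * real (Suc n)) \<le>
          V (\<rho> * real (Suc (Suc n))) - V (\<rho> * real (Suc n))"
      proof (rule inc)
        fix y assume y: "\<rho> * real (Suc n) < y" "y < \<rho> * real (Suc (Suc n))"
        have p: "0 < \<rho> * real (Suc n)" using \<open>\<rho> > 0\<close> by simp
        then show "critical_log \<beta> (\<rho> * real (Suc n)) \<le> critical_log \<beta> y"
          using False dec[OF p, of y] y by (intro mono) auto
      qed (use \<open>\<rho> > 0\<close> in auto)
      then show ?thesis using Suc.IH unfolding step sum.lessThan_Suc distrib_left by linarith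
    qed
  qed
qed

text \<open>Up to the constant, the right-hand side is the derivative of the bounded function
  \<open>- ((1 + sqrt y) powr (2 - 2 * \<beta>))\<close>.\<close>
lemma ln_le_derivative_bound:
  fixes \<beta> y :: real
  assumes \<beta>: "1 < \<beta>" and y: "y > 0"
  shows "ln (1 + y powr (- \<beta>)) \<le> 2 * \<beta> * 2 powr (2 * \<beta> - 1) * ((1 + sqrt y) powr (1 - 2 * \<beta>) / sqrt y)"
proof -
  define s where "s = sqrt y"
  have s: "s > 0" using y by (simp add: s_def)
  have ys: "y powr (- \<beta>) = s powr (- 2 * \<beta>)"
    using y by (simp add: s_def powr_half_sqrt[symmetric] powr_powr)
  have "ln (1 + s powr (- 2 * \<beta>)) \<le> 2 * \<beta> * 2 powr (2 * \<beta> - 1) * ((1 + s) powr (1 - 2 * \<beta>) / s)"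
  proof (cases "s \<ge> 1")
    case True
    have "ln (1 + s powr (- 2 * \<beta>)) \<le> s powr (- 2 * \<beta>)" by (rule ln_add_one_self_le_self) simp
    also have "\<dots> = 1 * (s powr (1 - 2 * \<beta>) / s)"
      using s by (simp add: powr_diff powr_minus field_simps)
    also have "\<dots> = 2 powr (2 * \<beta> - 1) * ((2 * s) powr (1 - 2 * \<beta>) / s)"
      using s by (simp add: powr_mult powr_diff field_simps)
    also have "\<dots> \<le> 2 powr (2 * \<beta> - 1) * ((1 + s) powr (1 - 2 * \<beta>) / s)"
      using s True \<beta> by (intro mult_left_mono divide_right_mono powr_mono2') auto
    also have "\<dots> \<le> 2 * \<beta> * (2 powr (2 * \<beta> - 1) * ((1 + s) powr (1 - 2 * \<beta>) / s))"
      (is "?a \<le> _")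
    proof -
      have "?a \<ge> 0" using s by simp
      then have "1 * ?a \<le> 2 * \<beta> * ?a" using \<beta> by (intro mult_right_mono) auto
      then show ?thesis by simp
    qed
    finally show ?thesis by (simp add: mult_ac)
  next
    case False
    have "ln (1 + s powr (- 2 * \<beta>)) \<le> ln (2 * s powr (- 2 * \<beta>))"
    proof (subst ln_le_cancel_iff)
      have "1 powr (- 2 * \<beta>) \<le> s powr (- 2 * \<beta>)" using False s \<beta> by (intro powr_mono2') auto
      then show "1 + s powr (- 2 * \<beta>) \<le> 2 * s powr (- 2 * \<beta>)" by simp
    qed (use s in \<open>auto intro: add_pos_pos\<close>)
    also have "\<dots> = ln 2 + 2 * \<beta> * ln (1 / s)" using s by (simp add: ln_mult ln_powr ln_div)
    also have "\<dots> \<le> 1 + 2 * \<beta> * (1 / s - 1)"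
      using s \<beta> ln_le_minus_one[of "1 / s"] ln2_le_25_over_36 by (intro add_mono mult_left_mono) auto
    also have "\<dots> \<le> 2 * \<beta> * (1 / s)" using \<beta> by (simp add: algebra_simps)
    also have "\<dots> = 2 * \<beta> * 2 powr (2 * \<beta> - 1) * (2 powr (1 - 2 * \<beta>) / s)"
      by (simp add: powr_diff field_simps)
    also have "\<dots> \<le> 2 * \<beta> * 2 powr (2 * \<beta> - 1) * ((1 + s) powr (1 - 2 * \<beta>) / s)"
      using s False \<beta> by (intro mult_left_mono divide_right_mono powr_mono2') auto
    finally show ?thesis .
  qed
  then show ?thesis by (simp add: ys s_def)
qed

text \<open>Times \<open>\<rho>\<close>, the sum is bounded by a Riemann sum of step
  \<open>\<rho>\<close> for a decreasing integrable majorant with primitive \<open>C * W\<close>.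
  That \<open>W\<close> stays bounded is due to \<open>\<beta> > 1\<close>.\<close>

lemma growth_sum:
  fixes \<beta> \<rho> :: real
  assumes \<beta>: "1 < \<beta>" and \<rho>: "\<rho> > 0"
  shows "(\<Sum>k<n. ln (1 + (\<rho> * real (Suc k)) powr (- \<beta>))) \<le> (2 * \<beta> * 2 powr (2 * \<beta> - 1) / (\<beta> - 1)) / \<rho>"
proof -
  define C where "C = 2 * \<beta> * 2 powr (2 * \<beta> - 1)"
  have "C > 0" using \<beta> by (simp add: C_def)
  define f where "f y = (1 + sqrt y) powr (1 - 2 * \<beta>) / sqrt y" for y :: real
  define W where "W y = - ((1 + sqrt y) powr (2 - 2 * \<beta>)) / (\<beta> - 1)" for y :: real
  have contW: "continuous_on {0..} W" unfolding W_def using \<beta>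
    by (intro continuous_intros) (auto simp: add_nonneg_eq_0_iff)
  have derW: "(W has_real_derivative f y) (at y)" if "y > 0" for y
  proof -
    have "((\<lambda>y. - ((1 + sqrt y) powr (2 - 2 * \<beta>)) / (\<beta> - 1)) has_real_derivative
        - ((2 - 2 * \<beta>) * (1 + sqrt y) powr (2 - 2 * \<beta> - 1) * (inverse (sqrt y) / 2)) / (\<beta> - 1)) (at y)"
      using that \<beta> by (auto intro!: derivative_eq_intros simp: add_pos_pos)
    also have "- ((2 - 2 * \<beta>) * (1 + sqrt y) powr (2 - 2 * \<beta> - 1) * (inverse (sqrt y) / 2)) / (\<beta> - 1) = f y"
    proof -
      have e: "2 - 2 * \<beta> - 1 = 1 - 2 * \<beta>" by simp
      show ?thesis unfolding f_def e using \<beta> that by (simp add: field_simps)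
    qed
    finally show ?thesis unfolding W_def .
  qed
  have decf: "f y \<le> f x" if "0 < x" "x \<le> y" for x y
    unfolding f_def using that \<beta> by (intro frac_le powr_mono2') (auto intro: add_pos_nonneg)
  have "\<rho> * (\<Sum>k<n. ln (1 + (\<rho> * real (Suc k)) powr (- \<beta>))) \<le> C * (W (\<rho> * real n) - W 0)"
  proof (induction n)
    case (Suc n)
    have step: "\<rho> * real (Suc n) - \<rho> * real n = \<rho>" by (simp add: algebra_simps)
    have "(\<rho> * real (Suc n) - \<rho> * real n) * f (\<rho> * real (Suc n)) \<le> W (\<rho> * real (Suc n)) - W (\<rho> * real n)"
    proof (rule mvt_lower_bound[OF _ _ contW derW])
      fix y assume y: "\<rho> * real n < y" "y < \<rho> * real (Suc n)"
      have "0 < y" using y(1) \<rho> by (metis le_less_trans mult_nonneg_nonneg less_imp_le of_nat_0_le_iff)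
      then show "f (\<rho> * real (Suc n)) \<le> f y" using y by (intro decf) auto
    qed (use \<rho> in auto)
    then have "C * (\<rho> * f (\<rho> * real (Suc n))) \<le> C * (W (\<rho> * real (Suc n)) - W (\<rho> * real n))"
      unfolding step using \<open>C > 0\<close> by (intro mult_left_mono) auto
    moreover have "\<rho> * ln (1 + (\<rho> * real (Suc n)) powr (- \<beta>)) \<le> \<rho> * (C * f (\<rho> * real (Suc n)))"
      unfolding C_def f_def using \<rho> by (intro mult_left_mono ln_le_derivative_bound[OF \<beta>]) auto
    ultimately show ?case using Suc.IH by (simp add: algebra_simps del: of_nat_Suc)
  qed simp
  also have "\<dots> \<le> C * (1 / (\<beta> - 1))"
  proof (rule mult_left_mono)
    have "W (\<rho> * real n) - W 0 = (1 - (1 + sqrt (\<rho> * real n)) powr (2 - 2 * \<beta>)) / (\<beta> - 1)"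
      by (simp add: W_def diff_divide_distrib)
    also have "\<dots> \<le> 1 / (\<beta> - 1)" using \<beta> by (intro divide_right_mono) auto
    finally show "W (\<rho> * real n) - W 0 \<le> 1 / (\<beta> - 1)" .
  qed (use \<open>C > 0\<close> in simp)
  finally have "(\<Sum>k<n. ln (1 + (\<rho> * real (Suc k)) powr (- \<beta>))) \<le> C * (1 / (\<beta> - 1)) / \<rho>"
    using \<rho> by (simp only: pos_le_divide_eq mult.commute)
  then show ?thesis by (simp add: C_def)
qed

section \<open>The canonical product with zeros \<open>k powr \<beta>\<close>\<close>

definition kernel_partial :: "real \<Rightarrow> nat \<Rightarrow> complex \<Rightarrow> complex" where
  "kernel_partial \<beta> n z = (\<Prod>k<n. 1 - z * of_real (real (Suc k) powr (- \<beta>)))"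

text \<open>For \<open>\<rho> = norm z powr (- 1 / \<beta>)\<close> the factors are at most
  \<open>1 + (\<rho> * k) powr (- \<beta>)\<close>, so the order \<open>1 / \<beta>\<close> comes
  out of \<open>growth_sum\<close> by scaling, uniformly in \<open>n\<close>.\<close>

lemma kernel_partial_growth:
  assumes \<beta>: "1 < \<beta>"
  obtains B where "B > 0" "\<And>n z. norm (kernel_partial \<beta> n z) \<le> exp (B * norm z powr (1 / \<beta>))"
proof
  define B where "B = 2 * \<beta> * 2 powr (2 * \<beta> - 1) / (\<beta> - 1)"
  show "B > 0" using \<beta> by (simp add: B_def)
  fix n z
  show "norm (kernel_partial \<beta> n z) \<le> exp (B * norm z powr (1 / \<beta>))"
  proof (cases "z = 0")
    case True
    then show ?thesis by (simp add: kernel_partial_def)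
  next
    case False
    define \<rho> where "\<rho> = norm z powr (- 1 / \<beta>)"
    have \<rho>: "\<rho> > 0" using False by (simp add: \<rho>_def)
    have u: "(\<rho> * real (Suc k)) powr (- \<beta>) = norm z * real (Suc k) powr (- \<beta>)" for k
      using False \<beta> unfolding \<rho>_def by (subst powr_mult) (auto simp: powr_powr)
    have "norm (kernel_partial \<beta> n z) \<le> (\<Prod>k<n. 1 + norm z * real (Suc k) powr (- \<beta>))"
      unfolding kernel_partial_def prod_norm[symmetric]
    proof (rule prod_mono, safe)
      fix k
      show "norm (1 - z * of_real (real (Suc k) powr (- \<beta>))) \<le> 1 + norm z * real (Suc k) powr (- \<beta>)"
        using norm_triangle_ineq4[of 1 "z * of_real (real (Suc k) powr (- \<beta>))"] by (simp add: norm_mult)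
    qed auto
    also have "\<dots> = exp (\<Sum>k<n. ln (1 + (\<rho> * real (Suc k)) powr (- \<beta>)))"
      unfolding exp_sum[OF finite_lessThan] u by (intro prod.cong refl) (simp add: add_pos_nonneg)
    also have "\<dots> \<le> exp (B / \<rho>)" unfolding B_def using growth_sum[OF \<beta> \<rho>] by simp
    also have "B / \<rho> = B * norm z powr (1 / \<beta>)" by (simp add: \<rho>_def powr_minus divide_inverse)
    finally show ?thesis .
  qed
qed

lemma kernel_partial_limit:
  assumes \<beta>: "1 < \<beta>"
  obtains F where "F holomorphic_on UNIV" "\<And>z m. (\<lambda>n. (deriv ^^ m) (kernel_partial \<beta> n) z) \<longlonglongrightarrow> (deriv ^^ m) F z"
proof -
  have hol: "kernel_partial \<beta> n holomorphic_on A" for n A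
    unfolding kernel_partial_def[abs_def] by (intro holomorphic_intros)
  have conv: "uniformly_convergent_on (cball 0 R) (kernel_partial \<beta>)" for R
  proof -
    have "summable (\<lambda>k. real (Suc k) powr (- \<beta>))"
      using \<beta> summable_real_powr_iff[of "- \<beta>"] summable_Suc_iff[of "\<lambda>k. real k powr (- \<beta>)"] by simp
    then have s: "summable (\<lambda>k. R * real (Suc k) powr (- \<beta>))" by (rule summable_mult)
    have "uniformly_convergent_on (cball (0::complex) R)
        (\<lambda>N x. \<Sum>k<N. norm (- (x * of_real (real (Suc k) powr (- \<beta>)))))"
      by (rule Weierstrass_m_test'[OF _ s]) (auto intro!: mult_right_mono simp: norm_mult)
    then have "uniformly_convergent_on (cball (0::complex) R)
        (\<lambda>N x. \<Prod>k<N. 1 + - (x * of_real (real (Suc k) powr (- \<beta>))))"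
      by (intro uniformly_convergent_on_prod continuous_intros) auto
    then show ?thesis by (simp add: kernel_partial_def[abs_def])
  qed
  define F where "F z = lim (\<lambda>n. kernel_partial \<beta> n z)" for z
  have lim: "uniform_limit (cball 0 R) (kernel_partial \<beta>) F sequentially" for R
    using uniformly_convergent_uniform_limit_iff[THEN iffD1, OF conv[of R]] by (simp add: F_def[abs_def])
  have "(\<lambda>n. (deriv ^^ m) (kernel_partial \<beta> n) z) \<longlonglongrightarrow> (deriv ^^ m) F z" for z m
  proof (rule higher_deriv_complex_uniform_limit[where A = "ball 0 (norm z + 1)"])
    show "uniform_limit (ball 0 (norm z + 1)) (kernel_partial \<beta>) F sequentially"
      by (rule uniform_limit_on_subset[OF lim[of "norm z + 1"]]) auto
  qed (auto intro: hol always_eventually)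
  moreover have "F holomorphic_on UNIV"
  proof (rule holomorphic_uniform_sequence[OF open_UNIV hol])
    fix x :: complex
    have "cball x 1 \<subseteq> cball 0 (norm x + 1)"
    proof
      fix y assume "y \<in> cball x 1"
      then show "y \<in> cball 0 (norm x + 1)"
        using norm_triangle_sub[of y x] by (simp add: dist_norm norm_minus_commute)
    qed
    then have "uniform_limit (cball x 1) (kernel_partial \<beta>) F sequentially"
      by (rule uniform_limit_on_subset[OF lim])
    then show "\<exists>d>0. cball x d \<subseteq> UNIV \<and> uniform_limit (cball x d) (kernel_partial \<beta>) F sequentially"
      by (intro exI[of _ 1]) auto
  qed
  ultimately show ?thesis using that by blast
qed

text \<open>Up to sign, the coefficient is an elementary symmetric polynomial in the reciprocals of
  the zeros. Its terms are nonnegative, and the product of the first \<open>j\<close> of them alone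
  is the lower bound.\<close>

lemma kernel_partial_coeff:
  "\<exists>e. coeff (\<Prod>k<n. [:1, - complex_of_real (real (Suc k) powr (- \<beta>)):]) j = (-1) ^ j * of_real e \<and>
    0 \<le> e \<and> (j \<le> n \<longrightarrow> (\<Prod>k<j. real (Suc k) powr (- \<beta>)) \<le> e)"
proof (induction n arbitrary: j)
  case 0
  show ?case by (intro exI[of _ "if j = 0 then 1 else 0"]) (auto simp: coeff_eq_0)
next
  case (Suc n)
  define p where "p = (\<Prod>k<n. [:1, - complex_of_real (real (Suc k) powr (- \<beta>)):])"
  define a where "a = real (Suc n) powr (- \<beta>)"
  have "a \<ge> 0" by (simp add: a_def)
  have ps: "(\<Prod>k<Suc n. [:1, - complex_of_real (real (Suc k) powr (- \<beta>)):]) = p * [:1, - complex_of_real a:]"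
    by (simp add: p_def a_def del: of_nat_Suc)
  show ?case
  proof (cases j)
    case 0
    obtain e where e: "coeff p 0 = (-1) ^ 0 * of_real e" "0 \<le> e" "(\<Prod>k<0. real (Suc k) powr (- \<beta>)) \<le> e"
      using Suc.IH[of 0] unfolding p_def by auto
    show ?thesis unfolding ps 0 using e by (intro exI[of _ e]) (simp add: coeff_mult)
  next
    case (Suc i)
    obtain e1 where e1: "coeff p (Suc i) = (-1) ^ Suc i * of_real e1" "0 \<le> e1"
        "Suc i \<le> n \<longrightarrow> (\<Prod>k<Suc i. real (Suc k) powr (- \<beta>)) \<le> e1"
      using Suc.IH[of "Suc i"] unfolding p_def by auto
    obtain e2 where e2: "coeff p i = (-1) ^ i * of_real e2" "0 \<le> e2"
        "i \<le> n \<longrightarrow> (\<Prod>k<i. real (Suc k) powr (- \<beta>)) \<le> e2"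
      using Suc.IH[of i] unfolding p_def by auto
    have "coeff (p * [:1, - complex_of_real a:]) (Suc i) = coeff p (Suc i) - of_real a * coeff p i"
      by (simp add: mult_pCons_right)
    also have "\<dots> = (-1) ^ Suc i * of_real (e1 + a * e2)" unfolding e1 e2 by (simp add: algebra_simps)
    finally have "coeff (p * [:1, - complex_of_real a:]) j = (-1) ^ j * of_real (e1 + a * e2)" using Suc by simp
    moreover have "(\<Prod>k<j. real (Suc k) powr (- \<beta>)) \<le> e1 + a * e2" if "j \<le> Suc n"
    proof (cases "j \<le> n")
      case True
      then show ?thesis using e1 e2 Suc \<open>a \<ge> 0\<close> by (simp add: add_increasing2 del: of_nat_Suc prod.lessThan_Suc)
    next
      case False
      then have "i = n" using that Suc by simp
      then have "(\<Prod>k<j. real (Suc k) powr (- \<beta>)) = (\<Prod>k<i. real (Suc k) powr (- \<beta>)) * a"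
        unfolding Suc by (simp add: a_def del: of_nat_Suc)
      also have "\<dots> \<le> e2 * a" using e2 \<open>i = n\<close> \<open>a \<ge> 0\<close> by (intro mult_right_mono) auto
      finally show ?thesis using e1 by (simp add: mult.commute)
    qed
    ultimately show ?thesis unfolding ps using e1 e2 \<open>a \<ge> 0\<close> by (intro exI[of _ "e1 + a * e2"]) auto
  qed
qed

lemma prod_powr_fact: "(\<Prod>k<j. real (Suc k) powr a) = fact j powr a"
  by (induction j) (simp_all add: powr_mult mult.commute del: of_nat_Suc)

lemma kernel_partial_deriv:
  assumes "j \<le> n"
  obtains e where "(deriv ^^ j) (kernel_partial \<beta> n) 0 = (-1) ^ j * of_real e" "fact j powr (1 - \<beta>) \<le> e"
proof -
  define p where "p = (\<Prod>k<n. [:1, - complex_of_real (real (Suc k) powr (- \<beta>)):])"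
  have "kernel_partial \<beta> n = poly p"
    by (simp add: fun_eq_iff kernel_partial_def p_def poly_prod)
  then have "(deriv ^^ j) (kernel_partial \<beta> n) 0 = fact j * coeff p j" by (simp only: higher_deriv_poly_0)
  moreover obtain e where e: "coeff p j = (-1) ^ j * of_real e" "fact j powr (- \<beta>) \<le> e"
    using kernel_partial_coeff[where n = n and j = j and \<beta> = \<beta>] assms unfolding p_def prod_powr_fact by blast
  ultimately have "(deriv ^^ j) (kernel_partial \<beta> n) 0 = (-1) ^ j * of_real (fact j * e)" by (simp add: mult_ac)
  moreover have "fact j powr (1 - \<beta>) \<le> fact j * e"
  proof -
    have "fact j powr (1 - \<beta>) = fact j * (fact j powr (- \<beta>) :: real)" by (simp add: powr_diff powr_minus divide_inverse)
    also have "\<dots> \<le> fact j * e" using e by (intro mult_left_mono) auto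
    finally show ?thesis .
  qed
  ultimately show ?thesis using that by blast
qed

text \<open>The logarithm of the partial product is a sum over nodes of step \<open>\<rho>\<close>.
  In the limit the integral contributes \<open>0\<close>, and the remaining error term
  \<open>- \<rho> * ln (sin (\<beta> * pi / 2))\<close>, divided by \<open>\<rho>\<close>, is
  independent of the point on the ray.\<close>

lemma kernel_partial_critical_ray:
  assumes \<beta>: "1 < \<beta>" "\<beta> < 2"
    and lim: "(\<lambda>n. kernel_partial \<beta> n z) \<longlonglongrightarrow> w"
    and z: "z = of_real r * cis (s * ((2 - \<beta>) * pi / 2))" "r > 0" "s = 1 \<or> s = -1"
  shows "norm w \<le> 1 / sin (\<beta> * pi / 2)"
proof -
  obtain V where V: "V 0 = 0" "continuous_on {0..} V"
    "\<And>y. y > 0 \<Longrightarrow> (V has_real_derivative critical_log \<beta> y) (at y)" "(V \<longlongrightarrow> 0) at_top"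
    using critical_log_primitive[OF \<beta>] by blast
  define \<rho> where "\<rho> = r powr (- 1 / \<beta>)"
  have \<rho>: "\<rho> > 0" using z by (simp add: \<rho>_def)
  have sin: "sin (\<beta> * pi / 2) > 0" using \<beta> by (intro sin_gt_zero) auto
  have factor: "norm (1 - z * of_real (real (Suc k) powr (- \<beta>))) = exp (critical_log \<beta> (\<rho> * real (Suc k)))" for k
  proof -
    define u where "u = (\<rho> * real (Suc k)) powr (- \<beta>)"
    have u: "u = r * real (Suc k) powr (- \<beta>)"
      unfolding u_def \<rho>_def using z \<beta> by (subst powr_mult) (auto simp: powr_powr)
    have "z * of_real (real (Suc k) powr (- \<beta>)) = of_real u * cis (s * ((2 - \<beta>) * pi / 2))"
      by (simp add: z u del: of_nat_Suc)
    moreover have "norm (1 - of_real u * cis (s * ((2 - \<beta>) * pi / 2))) = norm (1 + of_real u * cis (\<beta> * pi / 2))"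
      using z(3)
    proof
      assume "s = 1"
      then have "cis (s * ((2 - \<beta>) * pi / 2)) = - cnj (cis (\<beta> * pi / 2))"
        using cis_add_pi(1)[of "- (\<beta> * pi / 2)"] by (simp add: cis_cnj field_simps)
      then have "1 - of_real u * cis (s * ((2 - \<beta>) * pi / 2)) = cnj (1 + of_real u * cis (\<beta> * pi / 2))"
        by simp
      then show ?thesis by (simp only: complex_mod_cnj)
    next
      assume "s = -1"
      then have "cis (s * ((2 - \<beta>) * pi / 2)) = - cis (\<beta> * pi / 2)"
        using cis_add_pi(2)[of "\<beta> * pi / 2"] by (simp add: field_simps)
      then show ?thesis by simp
    qed
    moreover have "1 + of_real u * cis (\<beta> * pi / 2) \<noteq> 0"
    proof
      assume *: "1 + of_real u * cis (\<beta> * pi / 2) = 0"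
      have "u > 0" using u z by simp
      from * have "u * sin (\<beta> * pi / 2) = 0" by (simp add: complex_eq_iff)
      then show False using \<open>u > 0\<close> sin by simp
    qed
    ultimately show ?thesis by (simp add: critical_log_def u_def)
  qed
  have "norm (kernel_partial \<beta> n z) \<le> exp (V (\<rho> * real (Suc n)) / \<rho> - ln (sin (\<beta> * pi / 2)))" for n
  proof -
    have "norm (kernel_partial \<beta> n z) = exp (\<Sum>k<n. critical_log \<beta> (\<rho> * real (Suc k)))"
      unfolding kernel_partial_def prod_norm[symmetric] factor exp_sum[OF finite_lessThan] ..
    moreover have "(\<Sum>k<n. critical_log \<beta> (\<rho> * real (Suc k))) \<le> V (\<rho> * real (Suc n)) / \<rho> - ln (sin (\<beta> * pi / 2))"
      using critical_log_sum[OF \<beta> V(1-3) \<rho>, of n] \<rho> by (simp add: field_simps)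
    ultimately show ?thesis by simp
  qed
  moreover have "(\<lambda>n. exp (V (\<rho> * real (Suc n)) / \<rho> - ln (sin (\<beta> * pi / 2)))) \<longlonglongrightarrow> exp (0 / \<rho> - ln (sin (\<beta> * pi / 2)))"
  proof -
    have "filterlim (\<lambda>n. \<rho> * real (Suc n)) at_top sequentially"
      using \<rho> filterlim_Suc filterlim_real_sequentially
      by (intro filterlim_tendsto_pos_mult_at_top[OF tendsto_const] filterlim_compose[OF filterlim_real_sequentially]) auto
    then have "(\<lambda>n. V (\<rho> * real (Suc n))) \<longlonglongrightarrow> 0" by (rule filterlim_compose[OF V(4)])
    then show ?thesis using \<rho> by (intro tendsto_intros) auto
  qed
  ultimately have "norm w \<le> exp (0 / \<rho> - ln (sin (\<beta> * pi / 2)))"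
    using LIMSEQ_le[OF tendsto_norm[OF lim]] by blast
  then show ?thesis using sin by (simp add: exp_minus inverse_eq_divide)
qed

text \<open>A Phragmen-Lindeloef principle, obtained from half-disks of radius \<open>\<rho>\<close> tending to infinity.\<close>
lemma half_plane_bound:
  assumes hol: "G holomorphic_on {v. Re v > 0}" and cont: "continuous_on {v. Re v \<ge> 0} G"
    and imag: "\<And>y. norm (G (\<i> * of_real y)) \<le> C"
    and growth: "\<And>v. Re v \<ge> 0 \<Longrightarrow> norm (G v) \<le> C * exp (K (norm v))" "\<And>\<rho>. \<rho> > 0 \<Longrightarrow> K \<rho> \<ge> 0"
    and lim: "((\<lambda>\<rho>. K \<rho> / \<rho>) \<longlongrightarrow> B) at_top" and v: "Re v \<ge> 0"
  shows "norm (G v) \<le> C * exp (2 * B * norm v)"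
proof -
  have C: "C \<ge> 0" using order_trans[OF norm_ge_zero imag] .
  have "((\<lambda>\<rho>. C * exp (K \<rho> / \<rho> * (2 * norm v + (norm v)\<^sup>2 * (1 / \<rho>)))) \<longlongrightarrow>
      C * exp (B * (2 * norm v + (norm v)\<^sup>2 * 0))) at_top"
    by (intro tendsto_intros lim) real_asymp
  moreover have "\<forall>\<^sub>F \<rho> in at_top. norm (G v) \<le> C * exp (K \<rho> / \<rho> * (2 * norm v + (norm v)\<^sup>2 * (1 / \<rho>)))"
    using eventually_gt_at_top[of 0] eventually_ge_at_top[of "norm v"]
  proof eventually_elim
    case (elim \<rho>)
    have "norm (G v) \<le> C * exp (K \<rho> * (2 * norm v / \<rho> + (norm v / \<rho>)\<^sup>2))"
      by (rule half_disk_bound[OF hol cont elim(1) growth(2)[OF elim(1)] imag _ v elim(2)])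
        (use growth(1) in auto)
    also have "K \<rho> * (2 * norm v / \<rho> + (norm v / \<rho>)\<^sup>2) = K \<rho> / \<rho> * (2 * norm v + (norm v)\<^sup>2 * (1 / \<rho>))"
      using elim(1) by (simp add: field_simps power2_eq_square)
    finally show ?case .
  qed
  ultimately have "norm (G v) \<le> C * exp (B * (2 * norm v + (norm v)\<^sup>2 * 0))"
    by (intro tendsto_lowerbound) auto
  then show ?thesis by (simp add: mult_ac)
qed

lemma powr_superadditive:
  fixes x y b :: real
  assumes "0 \<le> x" "0 \<le> y" "1 \<le> b"
  shows "x powr b + y powr b \<le> (x + y) powr b"
proof -
  have p: "t powr b = t * t powr (b - 1)" if "t \<ge> 0" for t :: real
    using that powr_add[of t 1 "b - 1"] by (cases "t = 0") auto
  have "x powr b + y powr b \<le> x * (x + y) powr (b - 1) + y * (x + y) powr (b - 1)"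
    unfolding p[OF assms(1)] p[OF assms(2)] using assms
    by (intro add_mono mult_left_mono powr_mono2) auto
  also have "\<dots> = (x + y) powr b" using p[of "x + y"] assms by (simp add: distrib_right)
  finally show ?thesis .
qed

text \<open>Entire, so that derivatives at the vertex, a boundary point of the sector, make sense.
  The last condition says that the preceding bounds are sharp at the vertex up to a geometric
  factor, with a sign that excludes cancellation in sums of dilates and in convolutions.\<close>

definition sector_kernel :: "real \<Rightarrow> (complex \<Rightarrow> complex) \<Rightarrow> bool" where
  "sector_kernel \<alpha> F \<longleftrightarrow> F holomorphic_on UNIV \<and>
    (\<exists>C>0. \<exists>h>0. \<forall>z\<in>sector \<alpha>. \<forall>j. norm ((deriv ^^ j) F z) \<le> C * h ^ j * Gbar (\<alpha> - 1) j) \<and>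
    (\<forall>j. \<exists>e\<ge>Gbar (\<alpha> - 1) j. (deriv ^^ j) F 0 = (-1) ^ j * of_real e)"

lemma sector_kernel_exp: "sector_kernel 1 (\<lambda>z. exp (- z))"
proof -
  have d: "(deriv ^^ j) (\<lambda>z. exp (- z)) = (\<lambda>z. (-1) ^ j * exp (- z :: complex))" for j
  proof (induction j)
    case (Suc j)
    have "deriv (\<lambda>z. (-1) ^ j * exp (- z :: complex)) z = (-1) ^ Suc j * exp (- z)" for z
      by (rule DERIV_imp_deriv) (auto intro!: derivative_eq_intros)
    then show ?case using Suc by auto
  qed simp
  have G: "Gbar 0 j = 1" for j by (simp add: Gbar_def)
  show ?thesis unfolding sector_kernel_def
  proof (intro conjI)
    have "norm ((-1) ^ j * exp (- z)) \<le> 1 * 1 ^ j * Gbar (1 - 1) j" if "z \<in> sector 1" for z :: complex and j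
      using that sector_halfplanes[of 1] by (simp add: norm_mult norm_power G norm_exp_eq_Re)
    then show "\<exists>C>0. \<exists>h>0. \<forall>z\<in>sector 1. \<forall>j. norm ((deriv ^^ j) (\<lambda>z. exp (- z)) z) \<le> C * h ^ j * Gbar (1 - 1) j"
      unfolding d by (intro exI[of _ "1::real"] conjI ballI allI zero_less_one)
    show "\<forall>j. \<exists>e\<ge>Gbar (1 - 1) j. (deriv ^^ j) (\<lambda>z. exp (- z)) 0 = (- 1) ^ j * complex_of_real e"
      unfolding d by (intro allI exI[of _ 1]) (simp add: G)
  qed (intro holomorphic_intros)
qed

text \<open>The canonical product is bounded on the two boundary rays, hence on the sector by Phragmen-Lindeloef.
  A second application outside translates of the sector bounds \<open>F (z + w)\<close> by
  \<open>C * exp (2 * B * norm w powr (1 / \<beta>))\<close> uniformly in \<open>z\<close>, and Cauchy's inequality on the circle of radius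
  \<open>j powr \<beta>\<close> gives the derivative bounds.\<close>
lemma sector_kernel_exists:
  assumes \<alpha>: "0 < \<alpha>" "\<alpha> \<le> 1"
  obtains F where "sector_kernel \<alpha> F"
proof (cases "\<alpha> = 1")
  \<comment> \<open>Here \<open>\<beta>\<close> would be \<open>1\<close>, and the product over the
    zeros \<open>1, 2, 3, \<dots>\<close> diverges.\<close>
  case True
  then show ?thesis using that sector_kernel_exp by blast
next
  case False
  define \<beta> where "\<beta> = 2 - \<alpha>"
  have \<beta>: "1 < \<beta>" "\<beta> < 2" using \<alpha> False by (auto simp: \<beta>_def)
  obtain B where "B > 0" and B: "\<And>n z. norm (kernel_partial \<beta> n z) \<le> exp (B * norm z powr (1 / \<beta>))"
    using kernel_partial_growth[OF \<beta>(1)] by blast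
  obtain F where hol: "F holomorphic_on UNIV"
      and lim: "\<And>z m. (\<lambda>n. (deriv ^^ m) (kernel_partial \<beta> n) z) \<longlonglongrightarrow> (deriv ^^ m) F z"
    using kernel_partial_limit[OF \<beta>(1)] by blast
  have lim0: "(\<lambda>n. kernel_partial \<beta> n z) \<longlonglongrightarrow> F z" for z using lim[of 0] by simp
  have growth: "norm (F z) \<le> exp (B * norm z powr (1 / \<beta>))" for z
    by (rule LIMSEQ_le_const2[OF tendsto_norm[OF lim0]]) (use B in auto)
  have cont: "continuous_on S F" for S
    using holomorphic_on_imp_continuous_on[OF hol] continuous_on_subset by blast
  define C where "C = 1 / sin (\<beta> * pi / 2)"
  have sin: "sin (\<beta> * pi / 2) > 0" using \<beta> by (intro sin_gt_zero) auto
  have C: "C \<ge> 1" unfolding C_def using sin by (simp add: le_divide_eq_1)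
  have F0: "norm (F 0) \<le> C" using growth[of 0] C by simp
  have bounded: "norm (F z) \<le> C" if z: "z \<in> sector \<alpha>" for z
  proof -
    \<comment> \<open>This power map takes the right half plane onto the sector itself. In the
      variable \<open>v\<close> the function has order at most
      \<open>\<alpha> / \<beta> < 1\<close>, so no exponential factor survives in the limit.\<close>
    define v where "v = of_real (norm z powr (1 / \<alpha>)) * cis (Arg z / \<alpha>)"
    have z0: "z \<noteq> 0" "\<bar>Arg z\<bar> < \<alpha> * pi / 2" using z by (auto simp: sector_def)
    then have a: "\<bar>Arg z / \<alpha>\<bar> < pi / 2" using \<alpha> by (simp add: field_simps)
    have "v powr of_real \<alpha> = of_real ((norm z powr (1 / \<alpha>)) powr \<alpha>) * cis (\<alpha> * (Arg z / \<alpha>))"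
      unfolding v_def using z0 by (intro powr_rcis less_trans[OF a]) auto
    also have "\<dots> = z" using z0 \<alpha> rcis_cmod_Arg[of z] by (simp add: powr_powr rcis_def)
    finally have vz: "v powr of_real \<alpha> = z" .
    have "cos (Arg z / \<alpha>) > 0" using a unfolding abs_less_iff by (intro cos_gt_zero_pi) linarith+
    then have v: "Re v \<ge> 0" by (simp add: v_def)
    have "norm (F (v powr of_real \<alpha>)) \<le> C * exp (2 * 0 * norm v)"
    proof (rule half_plane_bound[where K = "\<lambda>\<rho>. B * \<rho> powr (\<alpha> / \<beta>)", OF _ _ _ _ _ _ v])
      show "(\<lambda>v. F (v powr of_real \<alpha>)) holomorphic_on {v. Re v > 0}"
        using holomorphic_on_compose[OF holomorphic_on_powr_half_plane holomorphic_on_subset[OF hol]]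
        by (simp add: o_def)
      show "continuous_on {v. Re v \<ge> 0} (\<lambda>v. F (v powr of_real \<alpha>))"
        using continuous_on_compose[OF continuous_on_powr_half_plane[OF \<alpha>(1)] cont] by (simp add: o_def)
      fix y :: real
      show "norm (F ((\<i> * of_real y) powr of_real \<alpha>)) \<le> C"
      proof (cases "y = 0")
        case False
        show ?thesis unfolding C_def
        proof (rule kernel_partial_critical_ray[OF \<beta> lim0])
          show "(\<i> * of_real y) powr of_real \<alpha> = of_real (\<bar>y\<bar> powr \<alpha>) * cis (sgn y * ((2 - \<beta>) * pi / 2))"
          proof -
            have "\<alpha> * (sgn y * (pi / 2)) = sgn y * ((2 - \<beta>) * pi / 2)" by (simp add: \<beta>_def)
            then show ?thesis unfolding imaginary_powr[OF False] by (simp only:)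
          qed
        qed (use False in \<open>auto simp: sgn_if\<close>)
      qed (use F0 in simp)
    next
      fix v :: complex
      have "norm (F (v powr of_real \<alpha>)) \<le> exp (B * norm v powr (\<alpha> / \<beta>))"
        using growth[of "v powr of_real \<alpha>"] by (simp add: norm_powr_real_powr' powr_powr)
      also have "\<dots> \<le> C * exp (B * norm v powr (\<alpha> / \<beta>))" using C by simp
      finally show "norm (F (v powr of_real \<alpha>)) \<le> C * exp (B * norm v powr (\<alpha> / \<beta>))" .
    next
      have "\<alpha> / \<beta> < 1" using \<beta> \<alpha> by simp
      then have "((\<lambda>\<rho>. B * (\<rho> powr (\<alpha> / \<beta> - 1))) \<longlongrightarrow> B * 0) at_top"
        by (intro tendsto_mult tendsto_const) real_asymp
      moreover have "\<forall>\<^sub>F \<rho> in at_top. B * (\<rho> powr (\<alpha> / \<beta> - 1)) = B * \<rho> powr (\<alpha> / \<beta>) / \<rho>"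
        using eventually_gt_at_top[of 0] by eventually_elim (simp add: powr_diff)
      ultimately have "((\<lambda>\<rho>. B * \<rho> powr (\<alpha> / \<beta>) / \<rho>) \<longlongrightarrow> B * 0) at_top"
        by (rule Lim_transform_eventually)
      then show "((\<lambda>\<rho>. B * \<rho> powr (\<alpha> / \<beta>) / \<rho>) \<longlongrightarrow> 0) at_top" by simp
    qed (use \<open>B > 0\<close> in simp)
    then show ?thesis by (simp add: vz)
  qed
  have expansion: "norm (F (z + w)) \<le> C * exp (2 * B * norm w powr (1 / \<beta>))" if z: "z \<in> sector \<alpha>" for z w
  proof (cases rule: sector_or_powr_image[OF \<alpha> zero_less_one, of w])
    case 1
    have "norm (F (z + w)) \<le> C * 1" using bounded[OF sector_add[OF \<alpha> z 1]] by simp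
    also have "\<dots> \<le> C * exp (2 * B * norm w powr (1 / \<beta>))" using C \<open>B > 0\<close> by (intro mult_left_mono) auto
    finally show ?thesis .
  next
    case (2 v)
    \<comment> \<open>Now the growth in \<open>v\<close> is of order 1. Superadditivity of
      \<open>\<lambda>x. x powr \<beta>\<close> separates \<open>z\<close> from \<open>v\<close> in
      the exponent, and division by \<open>\<rho>\<close> removes the part with \<open>z\<close>:
      this makes the bound uniform in \<open>z\<close>.\<close>
    have "norm (F (z + - (of_real 1 * v powr of_real \<beta>))) \<le> C * exp (2 * B * norm v)"
    proof (rule half_plane_bound[where K = "\<lambda>\<rho>. B * (norm z powr (1 / \<beta>) + \<rho>)", OF _ _ _ _ _ _ 2(1)])
      show "(\<lambda>v. F (z + - (of_real 1 * v powr of_real \<beta>))) holomorphic_on {v. Re v > 0}"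
        using holomorphic_on_compose[OF _ holomorphic_on_subset[OF hol], of "\<lambda>v. z + - (of_real 1 * v powr of_real \<beta>)"]
          holomorphic_on_powr_half_plane[of \<beta>]
        by (simp add: o_def holomorphic_on_diff)
      show "continuous_on {v. Re v \<ge> 0} (\<lambda>v. F (z + - (of_real 1 * v powr of_real \<beta>)))"
        using continuous_on_compose[OF _ cont, of "{v. Re v \<ge> 0}" "\<lambda>v. z + - (of_real 1 * v powr of_real \<beta>)"]
          continuous_on_powr_half_plane[of \<beta>] \<beta>
        by (simp add: o_def continuous_on_diff continuous_on_const)
      show "norm (F (z + - (of_real 1 * (\<i> * of_real y) powr of_real \<beta>))) \<le> C" for y
        unfolding \<beta>_def by (intro bounded sector_add[OF \<alpha> z] imaginary_powr_opposite_sector[OF \<alpha>]) simp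
    next
      fix v :: complex
      define a where "a = norm z powr (1 / \<beta>)"
      have "norm (z + - (of_real 1 * v powr of_real \<beta>)) \<le> norm z + norm v powr \<beta>"
        using norm_triangle_ineq4[of z "v powr of_real \<beta>"] by (simp add: norm_powr_real_powr')
      also have "norm z = a powr \<beta>" using \<beta> by (simp add: a_def powr_powr)
      also have "a powr \<beta> + norm v powr \<beta> \<le> (a + norm v) powr \<beta>"
        using \<beta> by (intro powr_superadditive) (auto simp: a_def)
      finally have "norm (z + - (of_real 1 * v powr of_real \<beta>)) powr (1 / \<beta>) \<le> ((a + norm v) powr \<beta>) powr (1 / \<beta>)"
        using \<beta> by (intro powr_mono2) auto
      also have "\<dots> = a + norm v" using \<beta> by (simp add: powr_powr a_def)
      finally have "B * norm (z + - (of_real 1 * v powr of_real \<beta>)) powr (1 / \<beta>) \<le> B * (a + norm v)"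
        using \<open>B > 0\<close> by simp
      then have "norm (F (z + - (of_real 1 * v powr of_real \<beta>))) \<le> exp (B * (a + norm v))"
        by (intro order_trans[OF growth]) simp
      also have "\<dots> \<le> C * exp (B * (a + norm v))" using C by simp
      finally show "norm (F (z + - (of_real 1 * v powr of_real \<beta>))) \<le> C * exp (B * (norm z powr (1 / \<beta>) + norm v))"
        by (simp add: a_def)
    next
      show "((\<lambda>\<rho>. B * (norm z powr (1 / \<beta>) + \<rho>) / \<rho>) \<longlongrightarrow> B) at_top" by real_asymp
    qed (use \<open>B > 0\<close> in simp)
    then show ?thesis unfolding \<beta>_def 2(3)[symmetric] 2(2) by simp
  qed
  have derivs: "norm ((deriv ^^ j) F z) \<le> C * exp (2 * B) ^ j * Gbar (\<alpha> - 1) j" if z: "z \<in> sector \<alpha>" for z j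
  proof (cases "j = 0")
    case True
    then show ?thesis using bounded[OF z] by simp
  next
    case False
    \<comment> \<open>With this radius the growth factor is a \<open>j\<close>-th power, while
      \<open>real j ^ j / r ^ j\<close> is exactly the weight.\<close>
    define r where "r = real j powr \<beta>"
    have r: "r > 0" using False by (simp add: r_def)
    have "norm ((deriv ^^ j) F z) \<le> fact j * (C * exp (2 * B * real j)) / r ^ j"
    proof (rule Cauchy_inequality[OF holomorphic_on_subset[OF hol] cont r])
      fix x assume x: "norm (z - x) = r"
      have "norm (x - z) powr (1 / \<beta>) = real j" using x \<beta> by (simp add: norm_minus_commute r_def powr_powr)
      then show "norm (F x) \<le> C * exp (2 * B * real j)" using expansion[OF z, of "x - z"] by simp
    qed simp
    also have "\<dots> \<le> real j ^ j * (C * exp (2 * B * real j)) / r ^ j"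
      using fact_le_power[of j, where 'a = real] C r by (intro divide_right_mono mult_right_mono) auto
    also have "\<dots> = C * exp (2 * B) ^ j * (real j ^ j / r ^ j)"
      by (simp add: exp_of_nat_mult[symmetric] mult_ac)
    also have "real j ^ j / r ^ j = Gbar (\<alpha> - 1) j"
      using False by (simp add: r_def \<beta>_def Gbar_def powr_realpow[symmetric] powr_powr powr_diff[symmetric] algebra_simps)
    finally show ?thesis .
  qed
  have coeffs: "\<exists>e\<ge>Gbar (\<alpha> - 1) j. (deriv ^^ j) F 0 = (-1) ^ j * of_real e" for j
  proof -
    \<comment> \<open>With the sign removed, the derivatives of the partial products are real and
      bounded below once \<open>n \<ge> j\<close>, and both properties survive the limit.\<close>
    define w where "w = (-1) ^ j * (deriv ^^ j) F 0"
    have wlim: "(\<lambda>n. (-1) ^ j * (deriv ^^ j) (kernel_partial \<beta> n) 0) \<longlonglongrightarrow> w"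
      unfolding w_def by (intro tendsto_intros lim)
    have ev: "\<forall>\<^sub>F n in sequentially. Im ((-1) ^ j * (deriv ^^ j) (kernel_partial \<beta> n) 0) = 0 \<and>
        fact j powr (1 - \<beta>) \<le> Re ((-1) ^ j * (deriv ^^ j) (kernel_partial \<beta> n) 0)"
      using eventually_ge_at_top[of j]
    proof eventually_elim
      case (elim n)
      obtain e where e: "(deriv ^^ j) (kernel_partial \<beta> n) 0 = (-1) ^ j * of_real e" "fact j powr (1 - \<beta>) \<le> e"
        using kernel_partial_deriv[OF elim] by blast
      have "(-1) ^ j * (deriv ^^ j) (kernel_partial \<beta> n) 0 = of_real e"
        unfolding e by (simp add: mult.assoc[symmetric] power_mult_distrib[symmetric])
      then show ?case using e by simp
    qed
    have "(\<lambda>n. Im ((-1) ^ j * (deriv ^^ j) (kernel_partial \<beta> n) 0)) \<longlonglongrightarrow> Im w"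
      by (intro tendsto_Im wlim)
    moreover have "(\<lambda>n. Im ((-1) ^ j * (deriv ^^ j) (kernel_partial \<beta> n) 0)) \<longlonglongrightarrow> 0"
      by (rule tendsto_eventually) (use ev in eventually_elim, simp)
    ultimately have Im0: "Im w = 0" using LIMSEQ_unique by blast
    have "fact j powr (1 - \<beta>) \<le> Re w"
      by (rule tendsto_lowerbound[OF tendsto_Re[OF wlim]]) (use ev in \<open>auto elim: eventually_mono\<close>)
    moreover have "Gbar (\<alpha> - 1) j \<le> fact j powr (1 - \<beta>)"
      using Gbar_le_fact_powr[of "1 - \<alpha>" j] \<alpha> by (simp add: \<beta>_def)
    moreover have "(deriv ^^ j) F 0 = (-1) ^ j * of_real (Re w)"
    proof -
      have "of_real (Re w) = w" using Im0 by (simp add: complex_eq_iff)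
      then show ?thesis by (simp add: w_def mult.assoc[symmetric] power_mult_distrib[symmetric])
    qed
    ultimately show ?thesis by (intro exI[of _ "Re w"]) auto
  qed
  have "sector_kernel \<alpha> F" unfolding sector_kernel_def
  proof (intro conjI hol allI coeffs)
    show "\<exists>C>0. \<exists>h>0. \<forall>z\<in>sector \<alpha>. \<forall>j. norm ((deriv ^^ j) F z) \<le> C * h ^ j * Gbar (\<alpha> - 1) j"
      using derivs C by (intro exI[of _ C] conjI exI[of _ "exp (2 * B)"]) auto
  qed
  then show ?thesis by (rule that)
qed

section \<open>Characteristic functions\<close>

lemma higher_deriv_sum_UNIV:
  fixes t :: "nat \<Rightarrow> complex \<Rightarrow> complex"
  assumes "\<And>k. t k holomorphic_on UNIV"
  shows "(deriv ^^ j) (\<lambda>z. \<Sum>k<n. t k z) z = (\<Sum>k<n. (deriv ^^ j) (t k) z)"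
proof (induction n)
  case (Suc n)
  have "(\<lambda>z. \<Sum>k<n. t k z) holomorphic_on UNIV" by (intro holomorphic_intros assms)
  from higher_deriv_add[OF this assms open_UNIV UNIV_I] show ?case using Suc by simp
qed simp

text \<open>The function is the sum of \<open>c k * F (m k * z)\<close>. Up to the factor
  \<open>(1 / 2) ^ k\<close>, which ensures convergence, \<open>c k * m k ^ j\<close> is the
  geometric sequence tangent to \<open>L\<close> at \<open>k\<close>: no dilate exceeds the class
  bound, and the one with \<open>k = j\<close> attains it at order \<open>j\<close>. At the vertex
  all terms have the same sign, so this single term bounds the sum from below.\<close>

lemma characteristic_function:
  assumes \<alpha>: "0 < \<alpha>" "\<alpha> \<le> 1" and L: "log_convex L" and N: "\<And>j. N j = Gbar (\<alpha> - 1) j * L j"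
  obtains f a where "f \<in> ultraholomorphic_class N (sector \<alpha>)" "\<And>j. (1 / 2) ^ j * N j \<le> a j"
    "\<And>j. ((\<lambda>x. (deriv ^^ j) f (of_real x)) \<longlongrightarrow> (-1) ^ j * of_real (a j)) (at_right 0)"
proof -
  obtain F where F: "sector_kernel \<alpha> F" using sector_kernel_exists[OF \<alpha>] by blast
  then obtain C h where hol: "F holomorphic_on UNIV" and C: "C > 0" "h > 0"
    "\<And>z j. z \<in> sector \<alpha> \<Longrightarrow> norm ((deriv ^^ j) F z) \<le> C * h ^ j * Gbar (\<alpha> - 1) j"
    unfolding sector_kernel_def by blast
  obtain e where e: "\<And>j. Gbar (\<alpha> - 1) j \<le> e j" "\<And>j. (deriv ^^ j) F 0 = (-1) ^ j * of_real (e j)"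
    using F unfolding sector_kernel_def by metis
  have Lpos: "L j > 0" for j using log_convex_pos[OF L] .
  have Npos: "N j > 0" for j using Lpos Gbar_pos by (simp add: N)
  have epos: "e j > 0" for j using e(1)[of j] Gbar_pos[of "\<alpha> - 1" j] by linarith
  define m where "m k = L (Suc k) / L k" for k
  have m: "m k > 0" for k using Lpos by (simp add: m_def)
  define c where "c k = (1 / 2) ^ k * (L k / m k ^ k)" for k
  have c: "c k > 0" for k using Lpos m by (simp add: c_def)
  have cm: "c k * m k ^ j \<le> (1 / 2) ^ k * L j" for k j
    using log_convex_tangent_power[OF L, of k j] unfolding c_def m_def[symmetric] mult.assoc
    by (intro mult_left_mono) auto
  define t where "t k z = of_real (c k) * F (of_real (m k) * z)" for k z
  have dilate: "(\<lambda>z. F (of_real (m k) * z)) holomorphic_on UNIV" for k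
    using holomorphic_on_compose_gen[OF _ hol, of "\<lambda>z. of_real (m k) * z" UNIV]
    by (simp add: o_def holomorphic_intros)
  have holt: "t k holomorphic_on A" for k A
    unfolding t_def[abs_def]
    by (intro holomorphic_intros holomorphic_on_subset[OF dilate]) simp
  have dt: "(deriv ^^ j) (t k) z = of_real (c k * m k ^ j) * (deriv ^^ j) F (of_real (m k) * z)" for j k z
    unfolding t_def[abs_def] using higher_deriv_cmult[OF dilate UNIV_I open_UNIV]
    by (simp add: higher_deriv_compose_linear[OF hol open_UNIV open_UNIV])
  have bt: "norm ((deriv ^^ j) (t k) z) \<le> (1 / 2) ^ k * (C * h ^ j * N j)" if "z \<in> sector \<alpha>" for j k z
  proof -
    have "norm ((deriv ^^ j) (t k) z) = (c k * m k ^ j) * norm ((deriv ^^ j) F (of_real (m k) * z))"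
      unfolding dt norm_mult norm_of_real using c[of k] m[of k] by simp
    also have "\<dots> \<le> ((1 / 2) ^ k * L j) * (C * h ^ j * Gbar (\<alpha> - 1) j)"
      using cm[of k j] C(3)[OF sector_scale[OF \<alpha> that m], of j k] Lpos[of j]
      by - (rule mult_mono, auto)
    finally show ?thesis by (simp add: N mult_ac)
  qed
  have sumh: "summable (\<lambda>k. (1 / 2) ^ k * B :: real)" for B
    by (intro summable_mult2 summable_geometric) simp
  define f where "f z = (\<Sum>k. t k z)" for z
  have unif: "uniform_limit (sector \<alpha>) (\<lambda>n z. \<Sum>k<n. t k z) f sequentially"
    unfolding f_def[abs_def]
    by (rule Weierstrass_m_test[OF _ sumh]) (use bt[of _ 0] in simp)
  have sums: "(\<lambda>k. (deriv ^^ j) (t k) z) sums (deriv ^^ j) f z" if "z \<in> sector \<alpha>" for j z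
  proof -
    have "(\<lambda>n. (deriv ^^ j) (\<lambda>z. \<Sum>k<n. t k z) z) \<longlonglongrightarrow> (deriv ^^ j) f z"
      by (rule higher_deriv_complex_uniform_limit[OF unif _ _ open_sector[OF \<alpha>] that])
        (auto intro!: always_eventually holomorphic_intros holt)
    then show ?thesis unfolding sums_def by (simp add: higher_deriv_sum_UNIV[OF holt])
  qed
  have holf: "f holomorphic_on sector \<alpha>"
  proof (rule holomorphic_uniform_sequence[OF open_sector[OF \<alpha>]])
    fix x assume "x \<in> sector \<alpha>"
    then obtain d where d: "d > 0" "cball x d \<subseteq> sector \<alpha>"
      using open_sector[OF \<alpha>] open_contains_cball by blast
    then show "\<exists>d>0. cball x d \<subseteq> sector \<alpha> \<and> uniform_limit (cball x d) (\<lambda>n z. \<Sum>k<n. t k z) f sequentially"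
      using uniform_limit_on_subset[OF unif d(2)] by blast
  qed (intro holomorphic_intros holt)
  have bf: "norm ((deriv ^^ j) f z) \<le> (2 * C) * h ^ j * N j" if z: "z \<in> sector \<alpha>" for j z
  proof -
    have "norm (\<Sum>k. (deriv ^^ j) (t k) z) \<le> (\<Sum>k. (1 / 2) ^ k * (C * h ^ j * N j))"
      by (rule norm_suminf_le[OF bt[OF z] sumh])
    also have "\<dots> = (\<Sum>k. (1 / 2) ^ k) * (C * h ^ j * N j)"
      by (rule suminf_mult2[symmetric]) simp
    also have "(\<Sum>k. (1 / 2 :: real) ^ k) = 2" by (subst suminf_geometric) auto
    finally show ?thesis using sums_unique[OF sums[OF z]] by simp
  qed
  define b where "b j k = c k * m k ^ j * e j" for j k
  define a where "a j = (\<Sum>k. b j k)" for j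
  \<comment> \<open>Tannery's theorem, that is dominated convergence for series: on the positive
    axis the terms are bounded by \<open>bt\<close>, uniformly in \<open>x\<close>.\<close>
  have tan: "summable (b j) \<and> ((\<lambda>x. (deriv ^^ j) f (of_real x)) \<longlongrightarrow> (-1) ^ j * of_real (a j)) (at_right 0)" for j
  proof -
    have pos: "\<forall>\<^sub>F x in at_right (0::real). x > 0" by (rule eventually_at_right_less)
    have "\<forall>\<^sub>F x in at_right 0. summable (\<lambda>k. norm ((deriv ^^ j) (t k) (of_real x)))"
      "summable (\<lambda>k. norm ((-1) ^ j * of_real (b j k) :: complex))"
      "((\<lambda>x. \<Sum>k. (deriv ^^ j) (t k) (of_real x)) \<longlongrightarrow> (\<Sum>k. (-1) ^ j * of_real (b j k))) (at_right 0)"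
    proof (atomize(full), rule tannerys_theorem)
      fix k
      have "isCont ((deriv ^^ j) F) 0"
        using holomorphic_on_imp_continuous_on[OF holomorphic_higher_deriv[OF hol open_UNIV]]
        by (simp add: continuous_on_eq_continuous_at)
      moreover have "((\<lambda>x. of_real (m k) * of_real x) \<longlongrightarrow> (of_real (m k) * of_real 0 :: complex)) (at_right 0)"
        by (intro tendsto_intros)
      ultimately have "((\<lambda>x. (deriv ^^ j) F (of_real (m k) * of_real x)) \<longlongrightarrow> (deriv ^^ j) F 0) (at_right 0)"
        using isCont_tendsto_compose by fastforce
      then have "((\<lambda>x. of_real (c k * m k ^ j) * (deriv ^^ j) F (of_real (m k) * of_real x)) \<longlongrightarrow>
          of_real (c k * m k ^ j) * (deriv ^^ j) F 0) (at_right 0)"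
        by (intro tendsto_intros)
      then show "((\<lambda>x. (deriv ^^ j) (t k) (of_real x)) \<longlongrightarrow> (-1) ^ j * of_real (b j k)) (at_right 0)"
        unfolding dt e(2) b_def by (simp add: mult_ac)
    next
      have "\<forall>\<^sub>F p in (at_top :: nat filter) \<times>\<^sub>F at_right (0::real). True \<and> snd p > 0"
        by (rule eventually_prodI[OF _ pos]) simp
      then show "\<forall>\<^sub>F (k, x) in at_top \<times>\<^sub>F at_right 0.
          norm ((deriv ^^ j) (t k) (of_real x)) \<le> (1 / 2) ^ k * (C * h ^ j * N j)"
        by eventually_elim (auto intro!: bt of_real_in_sector[OF \<alpha>])
    qed (auto intro: sumh)
    note T = this
    have bpos: "b j k \<ge> 0" for k using c[of k] m[of k] epos[of j] by (simp add: b_def)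
    have sb: "summable (b j)" using T(2) bpos by (simp add: norm_mult norm_power)
    have "(\<Sum>k. (-1) ^ j * of_real (b j k)) = (-1) ^ j * (of_real (a j) :: complex)"
      unfolding a_def suminf_of_real[OF sb] by (rule suminf_mult) (use sb in \<open>simp add: summable_of_real\<close>)
    moreover have "\<forall>\<^sub>F x in at_right 0. (\<Sum>k. (deriv ^^ j) (t k) (of_real x)) = (deriv ^^ j) f (of_real x)"
      using pos by eventually_elim (use sums_unique[OF sums[OF of_real_in_sector[OF \<alpha>]]] in simp)
    ultimately show ?thesis using sb Lim_transform_eventually[OF T(3)] by simp
  qed
  have lower: "(1 / 2) ^ j * N j \<le> a j" for j
  proof -
    have "(1 / 2) ^ j * N j \<le> b j j"
      using e(1)[of j] Lpos[of j] m[of j] by (simp add: b_def c_def N mult_ac)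
    also have "b j j = sum (b j) {j}" by simp
    also have "\<dots> \<le> a j" unfolding a_def
      using tan[of j] c m epos by (intro sum_le_suminf) (auto simp: b_def less_imp_le)
    finally show ?thesis .
  qed
  have "f \<in> ultraholomorphic_class N (sector \<alpha>)"
    unfolding ultraholomorphic_class_iff[OF Npos]
  proof (intro conjI holf exI ballI allI)
    show "0 < h" "0 < 2 * C" using C by simp_all
  qed (rule bf)
  then show ?thesis using lower tan by (intro that[of f a]) auto
qed

section \<open>Closedness under reciprocals\<close>

text \<open>Comparing \<open>k\<close> with the multiple \<open>k div j * j\<close> of \<open>j\<close> is harmless because \<open>L j powr (1 / j)\<close>
  increases.\<close>
lemma rai_of_multiples:
  assumes \<alpha>: "0 < \<alpha>" "\<alpha> \<le> 1" and L: "log_convex L" "L 0 \<le> 1"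
    and N: "\<And>j. N j = Gbar (\<alpha> - 1) j * L j" and "Q \<ge> 1"
    and power: "\<And>j l. 1 \<le> j \<Longrightarrow> 1 \<le> l \<Longrightarrow> seq_check N j ^ l \<le> Q ^ (l * j) * seq_check N (l * j)"
  shows "rai N"
proof -
  have Lpos: "L j > 0" for j using log_convex_pos[OF L(1)] .
  have Npos: "N j > 0" for j using Lpos Gbar_pos by (simp add: N)
  define r where "r j = ln (seq_check N j) / real j" for j
  have cpos: "seq_check N j > 0" for j using Npos by (simp add: seq_check_def)
  have root_r: "root j (seq_check N j) = exp (r j)" if "j \<ge> 1" for j
  proof -
    have "ln (root j (seq_check N j)) = r j" using that cpos by (simp add: r_def ln_root)
    then show ?thesis using cpos that by (metis exp_ln real_root_gt_zero zero_less_one order_less_le_trans)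
  qed
  have r_eq: "r j = ln (L j) / real j - (1 - \<alpha>) * ln (real j) - ln (fact j) / real j" if "j \<ge> 1" for j
    using that Lpos[of j] Gbar_pos[of "\<alpha> - 1" j]
    by (simp add: r_def seq_check_def N ln_mult ln_div ln_Gbar field_simps)
  have upper: "ln (fact k) / real k \<le> ln (real k)" if "k \<ge> 1" for k
  proof -
    have "ln (fact k) \<le> ln (real k ^ k)" using fact_le_power[of k, where 'a = real] that by simp
    then show ?thesis using that by (simp add: ln_realpow field_simps)
  qed
  have lower: "ln (real m) - 1 \<le> ln (fact m) / real m" if "m \<ge> 1" for m
  proof -
    have "ln (real m ^ m) \<le> ln (exp (real m) * fact m)" using power_self_le_fact[of m] that by simp
    then show ?thesis using that by (simp add: ln_realpow ln_mult field_simps)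
  qed
  \<comment> \<open>Besides \<open>ln Q\<close>, the constant collects \<open>ln 2\<close> for the
    change of the weight from \<open>m\<close> to \<open>k\<close>, and \<open>ln 2 + 1\<close> for
    the factorials, where the \<open>1\<close> is the error in \<open>lower\<close>.\<close>
  have "r j \<le> r k + (ln Q + 2 * ln 2 + 1)" if jk: "1 \<le> j" "j \<le> k" for j k
  proof -
    define l where "l = k div j"
    define m where "m = l * j"
    have l: "l \<ge> 1" using jk by (simp add: l_def div_greater_zero_iff Suc_leI)
    have m: "1 \<le> m" "j \<le> m" "m \<le> k" using jk l by (auto simp: m_def l_def)
    have "k < m + j" using jk dividend_less_div_times[of j k] by (simp add: m_def l_def add.commute)
    then have k2: "real k \<le> 2 * real m" using m by linarith
    have "ln (seq_check N j ^ l) \<le> ln (Q ^ m * seq_check N m)"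
      using power[OF jk(1) l] cpos[of j] cpos[of m] \<open>Q \<ge> 1\<close> by (subst ln_le_cancel_iff) (auto simp: m_def)
    then have "real l * ln (seq_check N j) \<le> real m * ln Q + ln (seq_check N m)"
      using cpos[of j] cpos[of m] \<open>Q \<ge> 1\<close> by (simp add: ln_mult ln_realpow)
    then have "(real l * ln (seq_check N j)) / real m \<le> (real m * ln Q + ln (seq_check N m)) / real m"
      by (rule divide_right_mono) simp
    then have 1: "r j \<le> ln Q + r m" using l jk by (simp add: r_def m_def add_divide_distrib)
    have "ln (L m ^ k) \<le> ln (L k ^ m)"
      using log_convex_power_le[OF L m(3)] Lpos by simp
    then have "real k * ln (L m) \<le> real m * ln (L k)" using Lpos by (simp add: ln_realpow)
    then have 2: "ln (L m) / real m \<le> ln (L k) / real k" using m jk by (simp add: field_simps)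
    have ln2: "ln (real k) - ln (real m) \<le> ln 2" "0 \<le> ln (real k) - ln (real m)"
    proof -
      have "ln (real k) \<le> ln (2 * real m)" using k2 m jk by (subst ln_le_cancel_iff) auto
      then show "ln (real k) - ln (real m) \<le> ln 2" using m by (simp add: ln_mult)
      show "0 \<le> ln (real k) - ln (real m)" using m jk by simp
    qed
    have "(1 - \<alpha>) * (ln (real k) - ln (real m)) \<le> 1 * (ln (real k) - ln (real m))"
      using \<alpha> ln2 by (intro mult_right_mono) auto
    then have 3: "(1 - \<alpha>) * ln (real k) - (1 - \<alpha>) * ln (real m) \<le> ln 2"
      using ln2 by (simp add: algebra_simps)
    show ?thesis
      using 1 2 3 ln2 upper[of k] lower[of m] r_eq[of m] r_eq[of k] m jk by linarith
  qed
  then have "root j (seq_check N j) \<le> exp (ln Q + 2 * ln 2 + 1) * root k (seq_check N k)"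
    if "1 \<le> j" "j \<le> k" for j k
    using that root_r[of j] root_r[of k] by (simp add: exp_add[symmetric] add.commute)
  then show ?thesis unfolding rai_def by (intro exI[of _ "exp (ln Q + 2 * ln 2 + 1)"]) auto
qed

text \<open>The Leibniz rule for \<open>g * (1 / g) = 1\<close>, divided by factorials so that it
  becomes the recursion for the coefficients of a reciprocal power series.\<close>

lemma Leibniz_reciprocal:
  assumes S: "open S" "z \<in> S" and g: "g holomorphic_on S" "\<And>w. w \<in> S \<Longrightarrow> g w \<noteq> 0" and "k \<ge> 1"
  shows "g z * ((deriv ^^ k) (\<lambda>w. 1 / g w) z / fact k) =
    - (\<Sum>i\<in>{1..k}. (deriv ^^ i) g z / fact i * ((deriv ^^ (k - i)) (\<lambda>w. 1 / g w) z / fact (k - i)))"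
proof -
  define u where "u w = 1 / g w" for w
  have u: "u holomorphic_on S" unfolding u_def[abs_def] by (intro holomorphic_intros g)
  have "(\<lambda>w. g w * u w) holomorphic_on S" by (intro holomorphic_intros g u)
  then have "(deriv ^^ k) (\<lambda>w. g w * u w) z = (deriv ^^ k) (\<lambda>w. 1) z"
    by (rule higher_deriv_transform_within_open[OF _ holomorphic_on_const S]) (simp add: u_def g(2))
  then have "(\<Sum>i = 0..k. of_nat (k choose i) * (deriv ^^ i) g z * (deriv ^^ (k - i)) u z) = 0"
    unfolding higher_deriv_mult[OF g(1) u S] using \<open>k \<ge> 1\<close> by simp
  moreover have "of_nat (k choose i) * (deriv ^^ i) g z * (deriv ^^ (k - i)) u z =
      fact k * ((deriv ^^ i) g z / fact i * ((deriv ^^ (k - i)) u z / fact (k - i)))" if "i \<in> {0..k}" for i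
    using that binomial_fact[of i k, where 'a = complex] by simp
  ultimately have "fact k * (\<Sum>i = 0..k. (deriv ^^ i) g z / fact i * ((deriv ^^ (k - i)) u z / fact (k - i))) = 0"
    by (simp add: sum_distrib_left)
  then have "(\<Sum>i = 0..k. (deriv ^^ i) g z / fact i * ((deriv ^^ (k - i)) u z / fact (k - i))) = 0" by simp
  then have "g z * ((deriv ^^ k) u z / fact k) +
      (\<Sum>i\<in>{1..k}. (deriv ^^ i) g z / fact i * ((deriv ^^ (k - i)) u z / fact (k - i))) = 0"
    by (subst (asm) sum.atLeast_Suc_atMost) auto
  then show ?thesis unfolding u_def[abs_def] by (simp add: eq_neg_iff_add_eq_0)
qed

text \<open>The \<open>B k\<close> are the coefficients of the reciprocal of the series with
  constant term \<open>\<delta>\<close> and other coefficients \<open>- A i\<close>, a geometric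
  series with nonnegative terms. The coefficient of index \<open>l * j\<close> contains
  \<open>A j ^ l / \<delta> ^ Suc l\<close>, and everything else can only increase it.\<close>

lemma nonneg_fps_reciprocal:
  fixes A :: "nat \<Rightarrow> real"
  assumes A: "\<And>i. i \<ge> 1 \<Longrightarrow> A i \<ge> 0" and "\<delta> > 0"
  obtains B where "\<And>k. B k \<ge> 0" "B 0 = 1 / \<delta>" "\<And>k. k \<ge> 1 \<Longrightarrow> \<delta> * B k = (\<Sum>i\<in>{1..k}. A i * B (k - i))"
    "\<And>j l. j \<ge> 1 \<Longrightarrow> A j ^ l \<le> \<delta> ^ Suc l * B (l * j)"
proof -
  define D where "D = Abs_fps (\<lambda>i. if i = 0 then \<delta> else - A i)"
  define B where "B k = fps_nth (inverse D) k" for k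
  have D0: "fps_nth D 0 \<noteq> 0" using \<open>\<delta> > 0\<close> by (simp add: D_def)
  have B0: "B 0 = 1 / \<delta>" by (simp add: B_def D_def inverse_eq_divide)
  have rec: "\<delta> * B k = (\<Sum>i\<in>{1..k}. A i * B (k - i))" if "k \<ge> 1" for k
  proof -
    have "D * inverse D = 1" using D0 by (rule inverse_mult_eq_1')
    then have "fps_nth (D * inverse D) k = 0" using that by simp
    then have "(\<Sum>i = 0..k. fps_nth D i * B (k - i)) = 0" by (simp add: fps_mult_nth B_def)
    then have "\<delta> * B k + (\<Sum>i\<in>{1..k}. fps_nth D i * B (k - i)) = 0"
      by (subst (asm) sum.atLeast_Suc_atMost) (auto simp: D_def)
    moreover have "(\<Sum>i\<in>{1..k}. fps_nth D i * B (k - i)) = - (\<Sum>i\<in>{1..k}. A i * B (k - i))"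
      unfolding sum_negf[symmetric] by (intro sum.cong) (auto simp: D_def)
    ultimately show ?thesis by simp
  qed
  have nonneg: "B k \<ge> 0" for k
  proof (induction k rule: less_induct)
    case (less k)
    show ?case
    proof (cases "k = 0")
      case False
      then have "\<delta> * B k \<ge> 0" using rec[of k] less A by (auto intro!: sum_nonneg mult_nonneg_nonneg)
      then show ?thesis using \<open>\<delta> > 0\<close> by (simp add: zero_le_mult_iff)
    qed (use B0 \<open>\<delta> > 0\<close> in simp)
  qed
  have "A j ^ l \<le> \<delta> ^ Suc l * B (l * j)" if "j \<ge> 1" for j l
  proof (induction l)
    case (Suc l)
    have "A j * B (Suc l * j - j) \<le> (\<Sum>i\<in>{1..Suc l * j}. A i * B (Suc l * j - i))"
      using that A nonneg by (intro member_le_sum) auto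
    also have "\<dots> = \<delta> * B (Suc l * j)" using rec[of "Suc l * j"] that by simp
    finally have *: "A j * B (l * j) \<le> \<delta> * B (Suc l * j)" by simp
    have "A j ^ Suc l \<le> A j * (\<delta> ^ Suc l * B (l * j))" using Suc A[OF that] by (simp add: mult_left_mono)
    also have "\<dots> = \<delta> ^ Suc l * (A j * B (l * j))" by simp
    also have "\<dots> \<le> \<delta> ^ Suc l * (\<delta> * B (Suc l * j))" using * \<open>\<delta> > 0\<close> by (intro mult_left_mono) auto
    finally show ?case by (simp add: mult_ac)
  qed (use B0 \<open>\<delta> > 0\<close> in simp)
  then show ?thesis using that[of B] nonneg B0 rec by blast
qed

text \<open>If \<open>f\<close> is characteristic, all derivatives of \<open>1 / (c - f)\<close> at the vertex have the sign
  \<open>(-1)\<^sup>k\<close> and are bounded from below by products of derivatives of \<open>f\<close>.\<close>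
lemma reciprocal_closed_imp_rai:
  assumes \<alpha>: "0 < \<alpha>" "\<alpha> \<le> 1" and L: "log_convex L" "L 0 = 1"
    and N: "\<And>j. N j = Gbar (\<alpha> - 1) j * L j"
    and closed: "\<And>f. f \<in> ultraholomorphic_class N (sector \<alpha>) \<Longrightarrow> (INF z\<in>sector \<alpha>. norm (f z)) > 0 \<Longrightarrow>
      (\<lambda>z. 1 / f z) \<in> ultraholomorphic_class N (sector \<alpha>)"
  shows "rai N"
proof -
  have Npos: "N j > 0" for j using log_convex_pos[OF L(1)] Gbar_pos by (simp add: N)
  have N0: "N 0 = 1" using L by (simp add: N)
  obtain f a where f: "f \<in> ultraholomorphic_class N (sector \<alpha>)" and aN: "\<And>j. (1 / 2) ^ j * N j \<le> a j"
    and alim: "\<And>j. ((\<lambda>x. (deriv ^^ j) f (of_real x)) \<longlongrightarrow> (-1) ^ j * of_real (a j)) (at_right 0)"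
    using characteristic_function[OF \<alpha> L(1) N] by blast
  have apos: "a j > 0" for j using aN[of j] Npos[of j] by (meson less_le_trans mult_pos_pos zero_less_power half_gt_zero zero_less_one)
  obtain h K where hK: "f holomorphic_on sector \<alpha>" "h > 0" "K > 0"
      "\<And>z j. z \<in> sector \<alpha> \<Longrightarrow> norm ((deriv ^^ j) f z) \<le> K * h ^ j * N j"
    using f by (auto simp: ultraholomorphic_class_iff[OF Npos])
  have fK: "norm (f z) \<le> K" if "z \<in> sector \<alpha>" for z using hK(4)[OF that, of 0] N0 by simp
  \<comment> \<open>As \<open>K\<close> bounds \<open>f\<close>, this shift keeps \<open>g\<close>
    at distance at least \<open>1\<close> from zero.\<close>
  define g where "g z = of_real (K + 1) - f z" for z
  have g1: "norm (g z) \<ge> 1" if "z \<in> sector \<alpha>" for z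
  proof -
    have "norm (of_real (K + 1) :: complex) - norm (f z) \<le> norm (g z)"
      unfolding g_def by (rule norm_triangle_ineq2)
    moreover have "norm (of_real (K + 1) :: complex) = K + 1" using hK(3) by (simp only: norm_of_real)
    ultimately show ?thesis using fK[OF that] by linarith
  qed
  have holg: "g holomorphic_on sector \<alpha>" unfolding g_def[abs_def] by (intro holomorphic_intros hK(1))
  have dg: "(deriv ^^ j) g z = - (deriv ^^ j) f z" if "z \<in> sector \<alpha>" "j \<ge> 1" for j z
    using higher_deriv_diff[OF holomorphic_on_const hK(1) open_sector[OF \<alpha>] that(1), of j "of_real (K + 1)"] that(2)
    unfolding g_def[abs_def] by simp
  have "g \<in> ultraholomorphic_class N (sector \<alpha>)"
    unfolding ultraholomorphic_class_iff[OF Npos]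
  proof (intro conjI holg exI ballI allI)
    show "h > 0" "2 * K + 1 > 0" using hK by simp_all
    fix z j assume z: "z \<in> sector \<alpha>"
    show "norm ((deriv ^^ j) g z) \<le> (2 * K + 1) * h ^ j * N j"
    proof (cases "j = 0")
      case True
      have "norm (g z) \<le> norm (of_real (K + 1) :: complex) + norm (f z)"
        unfolding g_def by (rule norm_triangle_ineq4)
      also have "norm (of_real (K + 1) :: complex) = K + 1" using hK(3) by (simp only: norm_of_real)
      finally show ?thesis using fK[OF z] True N0 by simp
    next
      case False
      then have "norm ((deriv ^^ j) g z) \<le> K * h ^ j * N j" using dg[OF z, of j] hK(4)[OF z, of j] by simp
      also have "\<dots> \<le> (2 * K + 1) * h ^ j * N j"
        using hK Npos[of j] by (intro mult_right_mono) auto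
      finally show ?thesis .
    qed
  qed
  moreover have "(INF z\<in>sector \<alpha>. norm (g z)) > 0"
  proof -
    have "sector \<alpha> \<noteq> {}" using of_real_in_sector[OF \<alpha>, of 1] by auto
    then have "(INF z\<in>sector \<alpha>. norm (g z)) \<ge> 1" using g1 by (intro cINF_greatest) auto
    then show ?thesis by simp
  qed
  ultimately have "(\<lambda>z. 1 / g z) \<in> ultraholomorphic_class N (sector \<alpha>)" by (rule closed)
  then obtain h' K' where K': "h' > 0" "K' > 0"
      "\<And>z j. z \<in> sector \<alpha> \<Longrightarrow> norm ((deriv ^^ j) (\<lambda>z. 1 / g z) z) \<le> K' * h' ^ j * N j"
    by (auto simp: ultraholomorphic_class_iff[OF Npos])
  \<comment> \<open>The limit of \<open>g\<close> at the vertex.\<close>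
  define \<delta> where "\<delta> = K + 1 - a 0"
  have pos: "\<forall>\<^sub>F x in at_right (0::real). x > 0" by (rule eventually_at_right_less)
  have sec: "\<forall>\<^sub>F x in at_right (0::real). of_real x \<in> sector \<alpha>"
    using pos by eventually_elim (rule of_real_in_sector[OF \<alpha>])
  have "a 0 \<le> K"
  proof -
    have "norm ((-1) ^ 0 * of_real (a 0) :: complex) \<le> K"
    proof (rule tendsto_upperbound[OF tendsto_norm[OF alim[of 0]]])
      show "\<forall>\<^sub>F x in at_right 0. norm ((deriv ^^ 0) f (of_real x)) \<le> K"
        using sec by eventually_elim (simp add: fK)
    qed simp
    then show ?thesis by simp
  qed
  then have \<delta>: "\<delta> \<ge> 1" by (simp add: \<delta>_def)
  define A where "A i = a i / fact i" for i
  have Apos: "A i > 0" for i using apos by (simp add: A_def)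
  obtain B where B: "\<And>k. B k \<ge> 0" "B 0 = 1 / \<delta>" "\<And>k. k \<ge> 1 \<Longrightarrow> \<delta> * B k = (\<Sum>i\<in>{1..k}. A i * B (k - i))"
    "\<And>j l. j \<ge> 1 \<Longrightarrow> A j ^ l \<le> \<delta> ^ Suc l * B (l * j)"
    by (rule nonneg_fps_reciprocal[of A \<delta>]) (use Apos \<delta> in \<open>auto simp: less_imp_le\<close>)
  define U where "U k x = (deriv ^^ k) (\<lambda>w. 1 / g w) (of_real x) / fact k" for k and x :: real
  have glim: "((\<lambda>x. g (of_real x)) \<longlongrightarrow> of_real \<delta>) (at_right 0)"
  proof -
    have "((\<lambda>x. of_real (K + 1) - f (of_real x)) \<longlongrightarrow> of_real (K + 1) - of_real (a 0)) (at_right 0)"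
      using alim[of 0] by (intro tendsto_intros) simp
    then show ?thesis by (simp add: g_def \<delta>_def)
  qed
  \<comment> \<open>The reciprocal has no expansion at the vertex, but the Leibniz recursion holds
    inside the sector and passes to the limit order by order. Each of its terms carries the sign
    \<open>(-1) ^ i * (-1) ^ (k - i)\<close>, so the limits satisfy the recursion for
    \<open>B\<close>.\<close>
  have Ulim: "((\<lambda>x. U k x) \<longlongrightarrow> (-1) ^ k * of_real (B k)) (at_right 0)" for k
  proof (induction k rule: less_induct)
    case (less k)
    show ?case
    proof (cases "k = 0")
      case True
      have "((\<lambda>x. 1 / g (of_real x)) \<longlongrightarrow> 1 / of_real \<delta>) (at_right 0)"
        using \<delta> by (intro tendsto_intros glim) auto
      then show ?thesis using True B(2) by (simp add: U_def)
    next
      case False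
      then have k: "k \<ge> 1" by simp
      have lim: "((\<lambda>x. (\<Sum>i\<in>{1..k}. (deriv ^^ i) f (of_real x) / fact i * U (k - i) x) / g (of_real x)) \<longlongrightarrow>
          (\<Sum>i\<in>{1..k}. ((-1) ^ i * of_real (a i)) / fact i * ((-1) ^ (k - i) * of_real (B (k - i)))) / of_real \<delta>)
          (at_right 0)"
        using \<delta> less k by (intro tendsto_intros alim glim) auto
      have "(\<Sum>i\<in>{1..k}. ((-1) ^ i * of_real (a i)) / fact i * ((-1) ^ (k - i) * of_real (B (k - i)))) =
          (\<Sum>i\<in>{1..k}. (-1) ^ k * of_real (A i * B (k - i)) :: complex)"
      proof (rule sum.cong[OF refl])
        fix i assume "i \<in> {1..k}"
        then have "(-1) ^ k = (-1) ^ i * ((-1) ^ (k - i) :: complex)" by (simp flip: power_add)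
        then show "((-1) ^ i * of_real (a i)) / fact i * ((-1) ^ (k - i) * of_real (B (k - i))) =
            (-1) ^ k * (of_real (A i * B (k - i)) :: complex)"
          by (simp add: A_def)
      qed
      also have "\<dots> = (-1) ^ k * of_real (\<delta> * B k)"
        unfolding B(3)[OF k] of_real_sum sum_distrib_left ..
      finally have val: "(\<Sum>i\<in>{1..k}. ((-1) ^ i * of_real (a i)) / fact i * ((-1) ^ (k - i) * of_real (B (k - i)))) /
          of_real \<delta> = (-1) ^ k * (of_real (B k) :: complex)" using \<delta> by simp
      have "\<forall>\<^sub>F x in at_right 0. (\<Sum>i\<in>{1..k}. (deriv ^^ i) f (of_real x) / fact i * U (k - i) x) / g (of_real x) = U k x"
        using sec
      proof eventually_elim
        case (elim x)
        have nz: "g w \<noteq> 0" if "w \<in> sector \<alpha>" for w using g1[OF that] by auto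
        have "g (of_real x) * U k x = - (\<Sum>i\<in>{1..k}. (deriv ^^ i) g (of_real x) / fact i * U (k - i) x)"
          unfolding U_def by (rule Leibniz_reciprocal[OF open_sector[OF \<alpha>] elim holg nz k])
        also have "\<dots> = (\<Sum>i\<in>{1..k}. (deriv ^^ i) f (of_real x) / fact i * U (k - i) x)"
          unfolding sum_negf[symmetric] by (intro sum.cong refl) (simp add: dg[OF elim])
        finally show ?case using nz[OF elim] by (simp add: field_simps)
      qed
      from Lim_transform_eventually[OF lim this] show ?thesis unfolding val .
    qed
  qed
  have Bbound: "B k \<le> K' * h' ^ k * seq_check N k" for k
  proof -
    have "norm ((-1) ^ k * of_real (B k) :: complex) \<le> K' * h' ^ k * seq_check N k"
    proof (rule tendsto_upperbound[OF tendsto_norm[OF Ulim[of k]]])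
      show "\<forall>\<^sub>F x in at_right 0. norm (U k x) \<le> K' * h' ^ k * seq_check N k"
        using sec
      proof eventually_elim
        case (elim x)
        have "norm (U k x) \<le> (K' * h' ^ k * N k) / fact k"
          unfolding U_def norm_divide using K'(3)[OF elim, of k] by (simp add: divide_right_mono)
        then show ?case by (simp add: seq_check_def)
      qed
    qed simp
    then show ?thesis using B(1)[of k] by (simp add: norm_mult norm_power)
  qed
  \<comment> \<open>The \<open>2\<close> pays for the loss \<open>(1 / 2) ^ j\<close> in the
    characteristic function, and \<open>\<delta>\<^sup>2\<close> for
    \<open>\<delta> ^ Suc l\<close>, because \<open>Suc l \<le> 2 * (l * j)\<close>.\<close>
  define Q where "Q = 2 * \<delta>\<^sup>2 * max 1 K' * max 1 h'"
  have Q1: "Q \<ge> 1"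
  proof -
    have "1 * 1 * 1 * 1 \<le> 2 * \<delta>\<^sup>2 * max 1 K' * max 1 h'"
      using \<delta> by (intro mult_mono) auto
    then show ?thesis by (simp add: Q_def)
  qed
  show ?thesis
  proof (rule rai_of_multiples[OF \<alpha> L(1) _ N Q1])
    fix j l :: nat assume j: "1 \<le> j" and l: "1 \<le> l"
    have cpos: "seq_check N i > 0" for i using Npos by (simp add: seq_check_def)
    have lj: "Suc l \<le> 2 * (l * j)" "1 \<le> l * j"
    proof -
      have "l * 1 \<le> l * j" using j by (intro mult_left_mono) auto
      then show "Suc l \<le> 2 * (l * j)" "1 \<le> l * j" using l by linarith+
    qed
    have "seq_check N j \<le> 2 ^ j * A j"
    proof -
      have "N j \<le> 2 ^ j * a j" using aN[of j] by (simp add: power_one_over field_simps)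
      then show ?thesis by (simp add: seq_check_def A_def divide_right_mono)
    qed
    then have "seq_check N j ^ l \<le> (2 ^ j * A j) ^ l" using cpos[of j] by (intro power_mono) auto
    also have "\<dots> = 2 ^ (l * j) * A j ^ l" by (simp add: power_mult_distrib power_mult[symmetric] mult.commute)
    also have "\<dots> \<le> 2 ^ (l * j) * (\<delta> ^ Suc l * B (l * j))" using B(4)[OF j] by (intro mult_left_mono) auto
    also have "\<dots> \<le> 2 ^ (l * j) * (\<delta> ^ (2 * (l * j)) * (K' * h' ^ (l * j) * seq_check N (l * j)))"
      using \<delta> lj(1) B(1) Bbound by (intro mult_left_mono mult_mono power_increasing) auto
    also have "\<dots> \<le> 2 ^ (l * j) * (\<delta> ^ (2 * (l * j)) * (max 1 K' ^ (l * j) * max 1 h' ^ (l * j) * seq_check N (l * j)))"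
    proof -
      have "K' \<le> max 1 K' ^ 1" by simp
      also have "\<dots> \<le> max 1 K' ^ (l * j)" using lj by (intro power_increasing) auto
      finally have "K' \<le> max 1 K' ^ (l * j)" .
      moreover have "h' ^ (l * j) \<le> max 1 h' ^ (l * j)" using K' by (intro power_mono) auto
      ultimately show ?thesis using K' cpos[of "l * j"] \<delta> by (intro mult_left_mono mult_mono) auto
    qed
    also have "\<dots> = Q ^ (l * j) * seq_check N (l * j)"
      by (simp add: Q_def power_mult_distrib power_mult[symmetric] mult_ac)
    finally show "seq_check N j ^ l \<le> Q ^ (l * j) * seq_check N (l * j)" .
  qed (use L in simp)
qed

section \<open>Composition and the main equivalences\<close>

lemma holomorphic_derivs_bounded_on_compact:
  assumes g: "g holomorphic_on U" and "open U" "compact T" "T \<subseteq> U"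
  obtains C h where "C > 0" "h > 0" "\<And>w l. w \<in> T \<Longrightarrow> norm ((deriv ^^ l) g w) \<le> C * h ^ l * fact l"
proof -
  obtain r where r: "r > 0" "(\<Union>w\<in>T. cball w r) \<subseteq> U"
    using compact_subset_open_imp_cball_epsilon_subset[OF \<open>compact T\<close> \<open>open U\<close> \<open>T \<subseteq> U\<close>] by blast
  define X where "X = {x + y | x y. x \<in> T \<and> y \<in> cball 0 r}"
  have "compact X" unfolding X_def by (rule compact_sums[OF \<open>compact T\<close> compact_cball])
  have ball: "cball w r \<subseteq> X" if "w \<in> T" for w
  proof
    fix x assume "x \<in> cball w r"
    then have "x = w + (x - w)" "x - w \<in> cball 0 r" by (auto simp: dist_norm norm_minus_commute)
    then show "x \<in> X" unfolding X_def using that by blast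
  qed
  have "X \<subseteq> U"
  proof
    fix x assume "x \<in> X"
    then obtain w y where "w \<in> T" "y \<in> cball 0 r" "x = w + y" unfolding X_def by blast
    then have "x \<in> cball w r" by (simp add: dist_norm)
    then show "x \<in> U" using r(2) \<open>w \<in> T\<close> by blast
  qed
  then have "continuous_on X g" using holomorphic_on_imp_continuous_on[OF g] continuous_on_subset by blast
  then have "bounded (g ` X)" using \<open>compact X\<close> compact_continuous_image compact_imp_bounded by blast
  then obtain C where C: "C > 0" "\<And>x. x \<in> X \<Longrightarrow> norm (g x) \<le> C" by (auto simp: bounded_pos)
  have "norm ((deriv ^^ l) g w) \<le> C * (1 / r) ^ l * fact l" if w: "w \<in> T" for w l
  proof -
    have sub: "cball w r \<subseteq> U" "ball w r \<subseteq> U" using ball[OF w] \<open>X \<subseteq> U\<close> ball_subset_cball[of w r] by blast+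
    have "norm ((deriv ^^ l) g w) \<le> fact l * C / r ^ l"
    proof (rule Cauchy_inequality[OF holomorphic_on_subset[OF g sub(2)]])
      show "continuous_on (cball w r) g"
        using holomorphic_on_imp_continuous_on[OF g] sub(1) continuous_on_subset by blast
      fix x assume "norm (w - x) = r"
      then have "x \<in> cball w r" by (simp add: dist_norm)
      then show "norm (g x) \<le> C" using ball[OF w] C(2) by blast
    qed (rule r(1))
    then show ?thesis by (simp add: power_one_over mult_ac)
  qed
  then show ?thesis using C(1) r(1) by (intro that[of C "1 / r"]) auto
qed

text \<open>The bounds \<open>H * s ^ j\<close> multiply up exactly, so only the number of
  compositions of \<open>n\<close> matters. Without a constant term in \<open>B\<close>, the bound
  \<open>2 ^ n\<close> reproduces itself: the sum of \<open>2 ^ (n - j)\<close> over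
  \<open>j \<ge> 1\<close> stays below \<open>2 ^ n\<close>. Only coefficients up to
  \<open>k\<close> are restricted, since \<open>s\<close> will depend on \<open>k\<close>.\<close>

lemma fps_nth_power_bound:
  fixes B :: "complex fps"
  assumes "H \<ge> 0" "s \<ge> 0" and B0: "fps_nth B 0 = 0" and B: "\<And>j. 1 \<le> j \<Longrightarrow> j \<le> k \<Longrightarrow> norm (fps_nth B j) \<le> H * s ^ j"
  shows "n \<le> k \<Longrightarrow> norm (fps_nth (B ^ i) n) \<le> H ^ i * s ^ n * 2 ^ n"
proof (induction i arbitrary: n)
  case 0
  then show ?case using \<open>s \<ge> 0\<close> by simp
next
  case (Suc i)
  have "fps_nth (B ^ Suc i) n = (\<Sum>j=0..n. fps_nth B j * fps_nth (B ^ i) (n - j))"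
    by (simp add: fps_mult_nth)
  also have "\<dots> = (\<Sum>j\<in>{1..n}. fps_nth B j * fps_nth (B ^ i) (n - j))"
    by (subst sum.atLeast_Suc_atMost) (auto simp: B0)
  finally have "norm (fps_nth (B ^ Suc i) n) \<le> (\<Sum>j\<in>{1..n}. norm (fps_nth B j * fps_nth (B ^ i) (n - j)))"
    by (simp add: norm_sum)
  also have "\<dots> \<le> (\<Sum>j\<in>{1..n}. H ^ Suc i * s ^ n * 2 ^ (n - j))"
  proof (rule sum_mono)
    fix j assume j: "j \<in> {1..n}"
    have "norm (fps_nth B j) * norm (fps_nth (B ^ i) (n - j)) \<le> (H * s ^ j) * (H ^ i * s ^ (n - j) * 2 ^ (n - j))"
      using j Suc.prems assms(1,2) by (intro mult_mono B Suc.IH) auto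
    also have "\<dots> = H ^ Suc i * (s ^ j * s ^ (n - j)) * 2 ^ (n - j)" by simp
    also have "s ^ j * s ^ (n - j) = s ^ n" using j by (simp flip: power_add)
    finally show "norm (fps_nth B j * fps_nth (B ^ i) (n - j)) \<le> H ^ Suc i * s ^ n * 2 ^ (n - j)"
      by (simp add: norm_mult)
  qed
  also have "\<dots> = H ^ Suc i * s ^ n * (\<Sum>j\<in>{1..n}. 2 ^ (n - j))" by (simp add: sum_distrib_left)
  also have "(\<Sum>j\<in>{1..n}. 2 ^ (n - j)) = (\<Sum>j<n. 2 ^ j :: real)"
    by (rule sum.reindex_bij_witness[of _ "\<lambda>j. n - j" "\<lambda>j. n - j"]) auto
  also have "H ^ Suc i * s ^ n * (\<Sum>j<n. 2 ^ j :: real) \<le> H ^ Suc i * s ^ n * 2 ^ n"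
  proof (rule mult_left_mono)
    show "(\<Sum>j<n. 2 ^ j :: real) \<le> 2 ^ n" by (induction n) auto
  qed (use assms(1,2) in simp)
  finally show ?case .
qed

text \<open>Faa di Bruno's formula, with its sum over partitions hidden in the powers of a series
  without constant term.\<close>

lemma higher_deriv_compose_fps:
  assumes "f analytic_on {z}" "g analytic_on {f z}"
  shows "(deriv ^^ k) (g \<circ> f) z / fact k =
    (\<Sum>i=0..k. (deriv ^^ i) g (f z) / fact i * fps_nth ((fps_expansion f z - fps_const (f z)) ^ i) k)"
proof -
  define B where "B = fps_expansion f z - fps_const (f z)"
  have f: "(\<lambda>x. f (z + x)) has_fps_expansion fps_expansion f z"
    by (rule analytic_at_imp_has_fps_expansion[OF assms(1)])
  have B: "(\<lambda>x. f (z + x) - f z) has_fps_expansion B"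
    unfolding B_def by (intro fps_expansion_intros f)
  have B0: "fps_nth B 0 = 0" by (simp add: B_def fps_expansion_def)
  have g: "(\<lambda>x. g (f z + x)) has_fps_expansion fps_expansion g (f z)"
    by (rule analytic_at_imp_has_fps_expansion[OF assms(2)])
  have "(\<lambda>x. (g \<circ> f) (z + x)) has_fps_expansion fps_compose (fps_expansion g (f z)) B"
    using has_fps_expansion_compose[OF g B B0] by (simp add: o_def)
  moreover have "(\<lambda>x. (g \<circ> f) (z + x)) has_fps_expansion fps_expansion (g \<circ> f) z"
    by (intro analytic_at_imp_has_fps_expansion analytic_on_compose assms(1)) (use assms(2) in simp)
  ultimately have "fps_expansion (g \<circ> f) z = fps_compose (fps_expansion g (f z)) B"
    by (rule fps_expansion_unique_complex[symmetric])
  then have "fps_nth (fps_expansion (g \<circ> f) z) k = fps_nth (fps_compose (fps_expansion g (f z)) B) k" by simp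
  then show ?thesis by (simp add: fps_compose_nth fps_expansion_def[of g] fps_expansion_def[of "g \<circ> f"] B_def)
qed

text \<open>For a fixed order \<open>k\<close>, (rai) bounds all Taylor coefficients of
  \<open>f\<close> up to \<open>k\<close> by a geometric sequence. Its ratio \<open>s\<close> is
  proportional to the \<open>k\<close>-th root of \<open>seq_check N k\<close>, so that
  \<open>s ^ k\<close> returns the required bound.\<close>

lemma rai_imp_compose_mem:
  assumes \<alpha>: "0 < \<alpha>" "\<alpha> \<le> 1" and Npos: "\<And>j. N j > 0" and N0: "N 0 = 1" and "rai N"
    and f: "f \<in> ultraholomorphic_class N (sector \<alpha>)"
    and U: "open U" "closure (f ` sector \<alpha>) \<subseteq> U" and g: "g holomorphic_on U"
  shows "g \<circ> f \<in> ultraholomorphic_class N (sector \<alpha>)"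
proof -
  obtain h K where f: "f holomorphic_on sector \<alpha>" "h > 0" "K > 0"
      "\<And>z j. z \<in> sector \<alpha> \<Longrightarrow> norm ((deriv ^^ j) f z) \<le> K * h ^ j * N j"
    using f by (auto simp: ultraholomorphic_class_iff[OF Npos])
  obtain C where C: "C > 0" "\<And>j k. 1 \<le> j \<Longrightarrow> j \<le> k \<Longrightarrow> root j (seq_check N j) \<le> C * root k (seq_check N k)"
    using \<open>rai N\<close> unfolding rai_def by blast
  have cpos: "seq_check N j > 0" for j using Npos by (simp add: seq_check_def)
  have "norm x \<le> K" if "x \<in> f ` sector \<alpha>" for x using that f(4)[of _ 0] N0 by auto
  then have "bounded (f ` sector \<alpha>)" unfolding bounded_iff by blast
  then have "compact (closure (f ` sector \<alpha>))" by simp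
  from holomorphic_derivs_bounded_on_compact[OF g U(1) this U(2)]
  obtain C1 h1 where C1: "C1 > 0" "h1 > 0"
    "\<And>w l. w \<in> closure (f ` sector \<alpha>) \<Longrightarrow> norm ((deriv ^^ l) g w) \<le> C1 * h1 ^ l * fact l" by metis
  have fU: "f z \<in> U" "f z \<in> closure (f ` sector \<alpha>)" if "z \<in> sector \<alpha>" for z
    using U(2) closure_subset[of "f ` sector \<alpha>"] that by auto
  have hol: "g \<circ> f holomorphic_on sector \<alpha>"
    by (rule holomorphic_on_compose_gen[OF f(1) g]) (use fU in auto)
  \<comment> \<open>One factor 2 counts compositions, the other absorbs the number
    \<open>Suc k\<close> of summands.\<close>
  define Q where "Q = 4 * max 1 (h1 * K) * (h * C)"
  have "Q > 0" using f C by (simp add: Q_def)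
  have bound: "norm ((deriv ^^ k) (g \<circ> f) z) \<le> C1 * Q ^ k * N k" if z: "z \<in> sector \<alpha>" for z k
  proof (cases "k = 0")
    case True
    then show ?thesis using C1(3)[OF fU(2)[OF z], of 0] N0 by simp
  next
    case False
    define R where "R = root k (seq_check N k)"
    have R: "R > 0" "R ^ k = seq_check N k" using False cpos[of k] by (auto simp: R_def)
    define s where "s = h * C * R"
    have "s > 0" using f C R by (simp add: s_def)
    define B where "B = fps_expansion f z - fps_const (f z)"
    have B0: "fps_nth B 0 = 0" by (simp add: B_def fps_expansion_def)
    have Bj: "norm (fps_nth B j) \<le> K * s ^ j" if j: "1 \<le> j" "j \<le> k" for j
    proof -
      have "seq_check N j = root j (seq_check N j) ^ j" using j cpos[of j] by simp
      also have "\<dots> \<le> (C * R) ^ j" using C(2)[OF j] cpos[of j] j unfolding R_def by (intro power_mono) auto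
      finally have "h ^ j * seq_check N j \<le> h ^ j * (C * R) ^ j" using f(2) by simp
      then have 1: "K * (h ^ j * seq_check N j) \<le> K * s ^ j"
        using f(3) by (simp add: s_def power_mult_distrib mult_ac)
      have "norm (fps_nth B j) = norm ((deriv ^^ j) f z) / fact j"
        using j by (simp add: B_def fps_expansion_def norm_divide)
      also have "\<dots> \<le> K * h ^ j * N j / fact j" using f(4)[OF z, of j] by (simp add: divide_right_mono)
      finally show ?thesis using 1 by (simp add: seq_check_def mult.assoc)
    qed
    have fan: "f analytic_on {z}" using f(1) open_sector[OF \<alpha>] z by (auto simp: analytic_at)
    have gan: "g analytic_on {f z}" using g U(1) fU(1)[OF z] by (auto simp: analytic_at)
    have "norm ((deriv ^^ k) (g \<circ> f) z / fact k) \<le>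
        (\<Sum>i=0..k. norm ((deriv ^^ i) g (f z) / fact i * fps_nth (B ^ i) k))"
      unfolding higher_deriv_compose_fps[OF fan gan] B_def by (rule norm_sum)
    also have "\<dots> \<le> (\<Sum>i=0..k. C1 * (max 1 (h1 * K) ^ k * (s ^ k * 2 ^ k)))"
    proof (rule sum_mono)
      fix i assume i: "i \<in> {0..k}"
      have "norm ((deriv ^^ i) g (f z) / fact i) \<le> C1 * h1 ^ i"
        using C1(3)[OF fU(2)[OF z], of i] by (simp add: norm_divide field_simps)
      moreover have "norm (fps_nth (B ^ i) k) \<le> K ^ i * s ^ k * 2 ^ k"
        using f \<open>s > 0\<close> B0 Bj by (intro fps_nth_power_bound[where k = k]) auto
      ultimately have "norm ((deriv ^^ i) g (f z) / fact i) * norm (fps_nth (B ^ i) k) \<le> (C1 * h1 ^ i) * (K ^ i * s ^ k * 2 ^ k)"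
        using C1 by (intro mult_mono) auto
      also have "\<dots> = C1 * ((h1 * K) ^ i * (s ^ k * 2 ^ k))" by (simp add: power_mult_distrib mult_ac)
      also have "\<dots> \<le> C1 * (max 1 (h1 * K) ^ k * (s ^ k * 2 ^ k))"
      proof -
        have "(h1 * K) ^ i \<le> max 1 (h1 * K) ^ i" using C1 f by (intro power_mono) auto
        also have "\<dots> \<le> max 1 (h1 * K) ^ k" using i by (intro power_increasing) auto
        finally show ?thesis using C1(1) \<open>s > 0\<close> by (intro mult_left_mono mult_right_mono) auto
      qed
      finally show "norm ((deriv ^^ i) g (f z) / fact i * fps_nth (B ^ i) k) \<le> C1 * (max 1 (h1 * K) ^ k * (s ^ k * 2 ^ k))"
        by (simp only: norm_mult)
    qed
    also have "\<dots> = real (Suc k) * (C1 * (max 1 (h1 * K) ^ k * (s ^ k * 2 ^ k)))" by simp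
    also have "\<dots> \<le> 2 ^ k * (C1 * (max 1 (h1 * K) ^ k * (s ^ k * 2 ^ k)))"
    proof (rule mult_right_mono)
      have "Suc k \<le> 2 ^ k" by (simp add: Suc_le_eq)
      then have "real (Suc k) \<le> real (2 ^ k)" by (rule of_nat_mono)
      then show "real (Suc k) \<le> 2 ^ k" by simp
    qed (use C1 \<open>s > 0\<close> in auto)
    also have "\<dots> = C1 * Q ^ k * seq_check N k"
      by (simp add: Q_def s_def power_mult_distrib R(2)[symmetric] mult_ac flip: power_mult_distrib)
    finally have "norm ((deriv ^^ k) (g \<circ> f) z) / fact k \<le> C1 * Q ^ k * N k / fact k"
      by (simp add: seq_check_def norm_divide)
    then show ?thesis by (simp add: divide_le_cancel)
  qed
  show ?thesis unfolding ultraholomorphic_class_iff[OF Npos]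
    using hol \<open>Q > 0\<close> C1(1) bound by blast
qed

section \<open>The condition (FdB)\<close>

lemma finite_compositions: "finite {js :: nat list. (\<forall>i\<in>set js. 1 \<le> i) \<and> sum_list js = k}"
proof (rule finite_subset)
  show "{js :: nat list. (\<forall>i\<in>set js. 1 \<le> i) \<and> sum_list js = k} \<subseteq> {js. set js \<subseteq> {..k} \<and> length js \<le> k}"
  proof safe
    fix js :: "nat list"
    assume js: "\<forall>i\<in>set js. 1 \<le> i"
    show "i \<le> sum_list js" if "i \<in> set js" for i using that by (rule member_le_sum_list) auto
    show "length js \<le> sum_list js" using js by (induction js) auto
  qed
qed (rule finite_lists_length_le, simp)

lemma finite_composition_values:
  "finite {u js | js :: nat list. length js \<ge> 1 \<and> (\<forall>i\<in>set js. i \<ge> 1) \<and> sum_list js = k}"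
  by (rule finite_subset[OF _ finite_imageI[OF finite_compositions[of k], of u]]) auto

text \<open>With \<open>R ^ k\<close> equal to \<open>n k\<close> up to a geometric factor, (rai)
  gives \<open>n i \<le> R ^ i\<close> for \<open>i \<le> k\<close>. The product over the parts then
  already uses up \<open>R ^ k\<close>, so the additional factor \<open>n (length js)\<close> is in
  excess. (dc) gains one power of \<open>R\<close> in each part, by estimating \<open>n i\<close>
  through \<open>n (i - 1)\<close>, and this pays for it.\<close>

lemma rai_dc_imp_FdB:
  assumes Npos: "\<And>j. N j > 0" and N0: "N 0 = 1" and "rai N" "dc N"
  shows "FdB N"
proof -
  obtain C0 where C0: "C0 > 0" "\<And>j k. 1 \<le> j \<Longrightarrow> j \<le> k \<Longrightarrow> root j (seq_check N j) \<le> C0 * root k (seq_check N k)"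
    using \<open>rai N\<close> unfolding rai_def by blast
  obtain D where D: "D \<ge> 1" "\<And>j. N (j + 1) \<le> D ^ (j + 1) * N j"
    using \<open>dc N\<close> unfolding dc_def by blast
  define n where "n = seq_check N"
  define C where "C = max 1 C0"
  have npos: "n j > 0" for j using Npos by (simp add: n_def seq_check_def)
  have dcn: "n (Suc j) \<le> D ^ Suc j * n j" for j
  proof -
    have "n (Suc j) = N (j + 1) / (real (Suc j) * fact j)" by (simp add: n_def seq_check_def)
    also have "\<dots> \<le> N (j + 1) / (1 * fact j)"
      using Npos[of "j + 1"] by (intro divide_left_mono mult_right_mono mult_pos_pos) (auto intro: less_imp_le)
    also have "\<dots> \<le> D ^ Suc j * N j / fact j" using D(2)[of j] by (simp add: divide_right_mono)
    finally show ?thesis by (simp add: n_def seq_check_def)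
  qed
  have main: "n (length js) * prod_list (map n js) \<le> (D * C) ^ k * n k"
    if js: "length js \<ge> 1" "\<forall>i\<in>set js. i \<ge> 1" "sum_list js = k" for js k
  proof -
    have len: "length js \<le> sum_list js" using js(2) by (induction js) auto
    have k: "k \<ge> 1" using len js by linarith
    define R where "R = C * root k (n k)"
    have R: "R > 0" using npos[of k] k by (simp add: R_def C_def)
    have Rk: "R ^ k = C ^ k * n k" using k npos[of k] by (simp add: R_def power_mult_distrib)
    have nR: "n j \<le> R ^ j" if "j \<le> k" for j
    proof (cases "j = 0")
      case True
      then show ?thesis using N0 by (simp add: n_def seq_check_def)
    next
      case False
      have "root j (n j) \<le> C0 * root k (n k)" using C0(2)[of j k] False that by (simp add: n_def)
      also have "\<dots> \<le> R" unfolding R_def C_def using npos[of k] k by (intro mult_right_mono) auto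
      finally have "root j (n j) ^ j \<le> R ^ j"
        by (rule power_mono) (rule real_root_ge_zero[OF less_imp_le[OF npos]])
      then show ?thesis using False npos[of j] by simp
    qed
    \<comment> \<open>The gain is kept as a factor \<open>R ^ length ls\<close> on the left, so that
      the induction over the list is multiplicative.\<close>
    have prod: "prod_list (map n ls) * R ^ length ls \<le> (D * R) ^ sum_list ls \<and> 0 \<le> prod_list (map n ls)"
      if "\<forall>i\<in>set ls. 1 \<le> i \<and> i \<le> k" for ls
      using that
    proof (induction ls)
      case (Cons i ls)
      obtain i' where i': "i = Suc i'" "i' \<le> k" using Cons.prems by (cases i) auto
      have "n i * R \<le> (D ^ i * n i') * R" using dcn[of i'] R unfolding i'(1) by (intro mult_right_mono) auto
      also have "\<dots> \<le> (D ^ i * R ^ i') * R" using nR[OF i'(2)] D R by (intro mult_right_mono mult_left_mono) auto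
      also have "\<dots> = (D * R) ^ i" by (simp add: i' power_mult_distrib)
      finally have i: "n i * R \<le> (D * R) ^ i" .
      have IH: "prod_list (map n ls) * R ^ length ls \<le> (D * R) ^ sum_list ls" "0 \<le> prod_list (map n ls)"
        using Cons by auto
      have "(n i * R) * (prod_list (map n ls) * R ^ length ls) \<le> (D * R) ^ i * (D * R) ^ sum_list ls"
        using i IH npos[of i] R D by (intro mult_mono) auto
      then show ?case using IH npos[of i] by (simp add: power_add mult_ac)
    qed simp
    have "\<forall>i\<in>set js. 1 \<le> i \<and> i \<le> k" using js member_le_sum_list by fastforce
    note P = prod[OF this]
    have "n (length js) * prod_list (map n js) \<le> R ^ length js * prod_list (map n js)"
      using nR[of "length js"] len js P by (intro mult_right_mono) auto
    also have "\<dots> \<le> (D * R) ^ k" using P js by (simp add: mult.commute)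
    also have "\<dots> = (D * C) ^ k * n k" by (simp add: power_mult_distrib Rk)
    finally show ?thesis .
  qed
  have "seq_check_circ N j \<le> 1 * (D * C) ^ j * seq_check N j" for j
  proof (cases "j = 0")
    case True
    then show ?thesis using N0 by (simp add: seq_check_circ_def seq_check_def)
  next
    case False
    define X where "X = {n (length js) * prod_list (map n js) | js. length js \<ge> 1 \<and> (\<forall>i\<in>set js. i \<ge> 1) \<and> sum_list js = j}"
    have "finite X" unfolding X_def by (rule finite_composition_values)
    moreover have "X \<noteq> {}"
    proof -
      have "n (length [j]) * prod_list (map n [j]) \<in> X" unfolding X_def using False by (intro CollectI exI[of _ "[j]"]) auto
      then show ?thesis by blast
    qed
    ultimately have "Max X \<le> (D * C) ^ j * n j" using main by (auto simp: X_def)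
    then show ?thesis using False by (simp add: seq_check_circ_def X_def n_def)
  qed
  moreover have "D * C \<ge> 1" using D mult_mono[of 1 D 1 C] by (simp add: C_def)
  ultimately show ?thesis unfolding FdB_def by (intro exI[of _ 1] exI[of _ "D * C"] conjI allI) auto
qed

text \<open>The composition of \<open>l * j\<close> into \<open>l\<close> equal parts shows that
  \<open>n l * n j ^ l\<close> is dominated by \<open>n (l * j)\<close>. The lower bound on
  \<open>n l\<close> removes the first factor at geometric cost.\<close>

lemma FdB_imp_rai:
  assumes \<alpha>: "0 < \<alpha>" "\<alpha> \<le> 1" and L: "log_convex L" "L 0 \<le> 1" and N: "\<And>j. N j = Gbar (\<alpha> - 1) j * L j"
    and low: "\<epsilon> > 0" "c > 0" "\<And>j. \<epsilon> * c ^ j \<le> seq_check N j" and "FdB N"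
  shows "rai N"
proof -
  obtain C h where C: "C \<ge> 1" "h \<ge> 1" "\<And>j. seq_check_circ N j \<le> C * h ^ j * seq_check N j"
    using \<open>FdB N\<close> unfolding FdB_def by blast
  define n where "n = seq_check N"
  have npos: "n j > 0" for j unfolding n_def
    by (rule less_le_trans[OF _ low(3)]) (use low(1,2) in simp)
  define Q where "Q = max 1 (C / \<epsilon>) * max 1 (1 / c) * h"
  have Q: "Q \<ge> 1"
  proof -
    have "1 * 1 * 1 \<le> max 1 (C / \<epsilon>) * max 1 (1 / c) * h" using C by (intro mult_mono) auto
    then show ?thesis by (simp add: Q_def)
  qed
  show ?thesis
  proof (rule rai_of_multiples[OF \<alpha> L N Q])
    fix j l :: nat assume j: "1 \<le> j" and l: "1 \<le> l"
    define k where "k = l * j"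
    have k: "k \<ge> 1" "l \<le> k" using j l by (auto simp: k_def)
    define X where "X = {n (length js) * prod_list (map n js) | js. length js \<ge> 1 \<and> (\<forall>i\<in>set js. i \<ge> 1) \<and> sum_list js = k}"
    have "finite X" unfolding X_def by (rule finite_composition_values)
    moreover have "n l * n j ^ l \<in> X"
      unfolding X_def using j l
      by (intro CollectI exI[of _ "replicate l j"]) (auto simp: k_def sum_list_replicate prod_list_replicate)
    ultimately have "n l * n j ^ l \<le> Max X" by (rule Max_ge)
    also have "Max X = seq_check_circ N k" using k by (simp add: seq_check_circ_def X_def n_def)
    also have "\<dots> \<le> C * h ^ k * n k" using C(3)[of k] by (simp add: n_def)
    finally have "n l * n j ^ l \<le> C * h ^ k * n k" .
    moreover have "(\<epsilon> * c ^ l) * n j ^ l \<le> n l * n j ^ l"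
      unfolding n_def by (rule mult_right_mono[OF low(3)]) (use npos[of j] in \<open>simp add: n_def\<close>)
    ultimately have "(\<epsilon> * c ^ l) * n j ^ l \<le> C * h ^ k * n k" by linarith
    then have "n j ^ l \<le> (C / \<epsilon>) * ((1 / c) ^ l * (h ^ k * n k))"
      using low(1,2) by (simp add: power_one_over field_simps)
    also have "\<dots> \<le> max 1 (C / \<epsilon>) ^ k * (max 1 (1 / c) ^ k * (h ^ k * n k))"
    proof -
      have "C / \<epsilon> \<le> max 1 (C / \<epsilon>) ^ 1" by simp
      also have "\<dots> \<le> max 1 (C / \<epsilon>) ^ k" using k by (intro power_increasing) auto
      finally have 1: "C / \<epsilon> \<le> max 1 (C / \<epsilon>) ^ k" .
      have "(1 / c) ^ l \<le> max 1 (1 / c) ^ l" using low by (intro power_mono) auto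
      also have "\<dots> \<le> max 1 (1 / c) ^ k" using k by (intro power_increasing) auto
      finally have 2: "(1 / c) ^ l \<le> max 1 (1 / c) ^ k" .
      have p: "0 \<le> h ^ k * n k" using C npos[of k] by simp
      show ?thesis
        by (rule mult_mono[OF 1 mult_right_mono[OF 2 p]]) (use p low(2) in auto)
    qed
    also have "\<dots> = Q ^ k * n k" by (simp add: Q_def power_mult_distrib mult_ac)
    finally show "seq_check N j ^ l \<le> Q ^ (l * j) * seq_check N (l * j)" by (simp add: n_def k_def)
  qed
qed

text \<open>Any \<open>c\<close> below the limit inferior works for large indices;
  \<open>\<epsilon>\<close> takes care of the finitely many others, among them index 0, where the
  root carries no information.\<close>

lemma geometric_lower_bound_of_liminf:
  fixes u :: "nat \<Rightarrow> real"
  assumes "\<And>j. u j > 0" "liminf (\<lambda>j. ereal (root j (u j))) > 0"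
  obtains \<epsilon> c where "\<epsilon> > 0" "c > 0" "\<And>j. \<epsilon> * c ^ j \<le> u j"
proof -
  obtain c where c: "0 < ereal c" "ereal c < liminf (\<lambda>j. ereal (root j (u j)))"
    using ereal_dense2[OF assms(2)] by blast
  have "\<forall>\<^sub>F j in sequentially. c < root j (u j)"
    using less_LiminfD[OF c(2)] by simp
  then obtain J where J: "\<And>j. j \<ge> J \<Longrightarrow> c < root j (u j)" by (auto simp: eventually_sequentially)
  have "c > 0" using c(1) by simp
  define J' where "J' = max 1 J"
  have large: "c ^ j \<le> u j" if "j \<ge> J'" for j
  proof -
    have j: "j \<ge> 1" "c < root j (u j)" using that J by (auto simp: J'_def)
    have "c ^ j \<le> root j (u j) ^ j" using j \<open>c > 0\<close> by (intro power_mono) auto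
    then show ?thesis using j assms(1)[of j] by simp
  qed
  define \<epsilon> where "\<epsilon> = Min (insert 1 ((\<lambda>j. u j / c ^ j) ` {..<J'}))"
  have "\<epsilon> > 0" unfolding \<epsilon>_def using assms(1) \<open>c > 0\<close> by (subst Min_gr_iff) auto
  moreover have "\<epsilon> * c ^ j \<le> u j" for j
  proof (cases "j < J'")
    case True
    then have "\<epsilon> \<le> u j / c ^ j" unfolding \<epsilon>_def by (intro Min_le) auto
    then show ?thesis using \<open>c > 0\<close> by (simp add: field_simps)
  next
    case False
    have "\<epsilon> \<le> 1" unfolding \<epsilon>_def by (intro Min_le) auto
    then have "\<epsilon> * c ^ j \<le> 1 * c ^ j" using \<open>c > 0\<close> by (intro mult_right_mono) auto
    then show ?thesis using large[of j] False by simp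
  qed
  ultimately show ?thesis using \<open>c > 0\<close> that by blast
qed

section \<open>The equivalences\<close>

theorem corollary5p10:
  fixes M :: "nat \<Rightarrow> real" and \<alpha> :: real
  assumes "\<And>j. M j > 0" and "M 0 = 1"
    and "0 < \<alpha>" and "\<alpha> \<le> 1"
    and "filterlim (\<lambda>j. root j (Gbar (1 - \<alpha>) j * M j)) at_top sequentially"
  shows "(rai (seq_alpha M \<alpha>) \<longleftrightarrow> holomorphically_closed M \<alpha>) \<and>
         (rai (seq_alpha M \<alpha>) \<longleftrightarrow> inverse_closed M \<alpha>) \<and>
         (liminf (\<lambda>j. ereal (root j (M j / fact j))) > 0 \<and> dc (seq_alpha M \<alpha>) \<longrightarrow>
            (rai (seq_alpha M \<alpha>) \<longleftrightarrow> composition_closed M \<alpha>) \<and>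
            (rai (seq_alpha M \<alpha>) \<longleftrightarrow> FdB (seq_alpha M \<alpha>)))"
proof -
  define N where "N = seq_alpha M \<alpha>"
  define x where "x j = Gbar (1 - \<alpha>) j * M j" for j
  define L where "L = lc_minorant x"
  note \<alpha> = assms(3,4)
  have x: "x j > 0" for j using assms(1) Gbar_pos by (simp add: x_def)
  have xlim: "filterlim (\<lambda>j. root j (x j)) at_top sequentially" using assms(5) by (simp add: x_def)
  have L: "log_convex L" unfolding L_def by (rule lc_minorant_log_convex[OF x xlim])
  have "x 0 = 1" by (simp add: x_def assms(2))
  \<comment> \<open>At \<open>j = 0\<close> the left touching index must be \<open>0\<close> itself,
    so the minorant agrees with \<open>x\<close> there.\<close>
  then have L0: "L 0 = 1" using lc_minorant_line[OF x xlim, of 0] by (auto simp: L_def)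
  have N: "N j = Gbar (\<alpha> - 1) j * L j" for j
    by (simp add: N_def L_def seq_alpha_def x_def[abs_def])
  have Npos: "N j > 0" for j using log_convex_pos[OF L] Gbar_pos by (simp add: N)
  have N0: "N 0 = 1" using L0 by (simp add: N)
  have cls: "ultraholomorphic_class M (sector \<alpha>) = ultraholomorphic_class N (sector \<alpha>)"
    unfolding N_def by (rule ultraholomorphic_class_seq_alpha[OF assms(1) \<alpha> assms(5)])
  have ab: "holomorphically_closed M \<alpha>" if "rai N"
    unfolding holomorphically_closed_def cls using rai_imp_compose_mem[OF \<alpha> Npos N0 that] by blast
  have bc: "inverse_closed M \<alpha>" if "holomorphically_closed M \<alpha>"
    unfolding inverse_closed_def
  proof (intro ballI impI)
    fix f assume f: "f \<in> ultraholomorphic_class M (sector \<alpha>)" and inf: "(INF z\<in>sector \<alpha>. norm (f z)) > 0"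
    define \<epsilon> where "\<epsilon> = (INF z\<in>sector \<alpha>. norm (f z))"
    have \<epsilon>: "\<epsilon> \<le> norm (f z)" if "z \<in> sector \<alpha>" for z
      unfolding \<epsilon>_def using that by (intro cINF_lower) (auto intro!: bdd_belowI[of _ 0])
    have "f ` sector \<alpha> \<subseteq> - ball 0 \<epsilon>" by (rule image_subsetI) (use \<epsilon> in \<open>simp add: not_less\<close>)
    then have "closure (f ` sector \<alpha>) \<subseteq> - ball 0 \<epsilon>" by (intro closure_minimal) auto
    moreover have "0 \<in> ball (0::complex) \<epsilon>" using inf by (simp add: \<epsilon>_def)
    ultimately have "closure (f ` sector \<alpha>) \<subseteq> - {0}" by blast
    moreover have "(\<lambda>w::complex. 1 / w) holomorphic_on - {0}" by (intro holomorphic_intros) auto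
    ultimately have "(\<lambda>w. 1 / w) \<circ> f \<in> ultraholomorphic_class M (sector \<alpha>)"
      using that f unfolding holomorphically_closed_def by (metis open_delete open_UNIV Compl_eq_Diff_UNIV)
    then show "(\<lambda>z. 1 / f z) \<in> ultraholomorphic_class M (sector \<alpha>)" by (simp add: o_def)
  qed
  have ca: "rai N" if "inverse_closed M \<alpha>"
    using that unfolding inverse_closed_def cls
    by (intro reciprocal_closed_imp_rai[OF \<alpha> L L0 N]) auto
  have de: "(rai N \<longleftrightarrow> composition_closed M \<alpha>) \<and> (rai N \<longleftrightarrow> FdB N)"
    if lim: "liminf (\<lambda>j. ereal (root j (M j / fact j))) > 0" and "dc N"
  proof -
    obtain \<epsilon> c where \<epsilon>: "\<epsilon> > 0" "c > 0" "\<And>j. \<epsilon> * c ^ j \<le> M j / fact j"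
      using geometric_lower_bound_of_liminf[OF _ lim] assms(1) by auto
    have Mlow: "\<epsilon> * c ^ j * fact j \<le> M j" for j using \<epsilon>(3)[of j] by (simp add: field_simps)
    \<comment> \<open>The lower bound for \<open>x\<close> is itself log-convex and therefore lies
      below the greatest log-convex minorant.\<close>
    have Nlow: "\<epsilon> * c ^ j \<le> seq_check N j" for j
    proof -
      have "Gbar (1 - \<alpha>) j * (\<epsilon> * c ^ j * fact j) \<le> L j"
        unfolding L_def
      proof (rule lc_minorant_greatest[OF x xlim log_convex_Gbar_fact])
        show "Gbar (1 - \<alpha>) j * (\<epsilon> * c ^ j * fact j) \<le> x j" for j
          unfolding x_def using Mlow[of j] Gbar_pos[of "1 - \<alpha>" j] by (intro mult_left_mono) auto
      qed (use \<alpha> \<epsilon> in auto)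
      then have "Gbar (\<alpha> - 1) j * (Gbar (1 - \<alpha>) j * (\<epsilon> * c ^ j * fact j)) \<le> N j"
        unfolding N using Gbar_pos[of "\<alpha> - 1" j] by (intro mult_left_mono) auto
      moreover have "Gbar (\<alpha> - 1) j * (Gbar (1 - \<alpha>) j * (\<epsilon> * c ^ j * fact j)) = \<epsilon> * c ^ j * fact j"
      proof -
        have "Gbar (\<alpha> - 1) j * Gbar (1 - \<alpha>) j = 1" using Gbar_cancel[of "\<alpha> - 1" j] by simp
        then show ?thesis by (simp only: mult.assoc[symmetric] mult_1_left)
      qed
      ultimately have "\<epsilon> * c ^ j * fact j \<le> N j" by (simp only:)
      then show ?thesis by (simp only: seq_check_def pos_le_divide_eq[OF fact_gt_zero])
    qed
    have "g \<in> local_holomorphic_class M U" if "open U" "g holomorphic_on U" for g U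
      unfolding local_holomorphic_class_def
    proof (intro CollectI conjI that(2) allI impI)
      fix K assume K: "compact K \<and> K \<subseteq> U"
      from holomorphic_derivs_bounded_on_compact[OF that(2,1)] K
      obtain C h where C: "C > 0" "h > 0" "\<And>w l. w \<in> K \<Longrightarrow> norm ((deriv ^^ l) g w) \<le> C * h ^ l * fact l"
        by metis
      have "norm ((deriv ^^ j) g z) / ((h / c) ^ j * M j) \<le> C / \<epsilon>" if "z \<in> K" for z j
      proof -
        have "norm ((deriv ^^ j) g z) * \<epsilon> \<le> C * h ^ j * fact j * \<epsilon>"
          using C(3)[OF that] \<epsilon>(1) by (intro mult_right_mono) auto
        also have "\<dots> = C * (h / c) ^ j * (\<epsilon> * c ^ j * fact j)" using \<epsilon> by (simp add: power_divide)
        also have "\<dots> \<le> C * (h / c) ^ j * M j" using Mlow[of j] C \<epsilon> by (intro mult_left_mono) auto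
        finally have "norm ((deriv ^^ j) g z) \<le> C * (h / c) ^ j * M j / \<epsilon>"
          using \<epsilon>(1) by (simp only: pos_le_divide_eq)
        also have "\<dots> = C / \<epsilon> * ((h / c) ^ j * M j)" by simp
        finally have "norm ((deriv ^^ j) g z) \<le> C / \<epsilon> * ((h / c) ^ j * M j)" .
        moreover have "(h / c) ^ j * M j > 0" using C \<epsilon> assms(1) by simp
        ultimately show ?thesis by (simp only: pos_divide_le_eq)
      qed
      then have "bdd_above {norm ((deriv ^^ j) g z) / ((h / c) ^ j * M j) |z j. z \<in> K}"
        by (intro bdd_aboveI[of _ "C / \<epsilon>"]) auto
      moreover have "h / c > 0" using C \<epsilon> by simp
      ultimately show "\<exists>h>0. bdd_above {norm ((deriv ^^ j) g z) / (h ^ j * M j) |z j. z \<in> K}" by blast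
    qed
    moreover have "g holomorphic_on U" if "g \<in> local_holomorphic_class M U" for g U
      using that by (simp add: local_holomorphic_class_def)
    ultimately have "composition_closed M \<alpha> \<longleftrightarrow> holomorphically_closed M \<alpha>"
      unfolding composition_closed_def holomorphically_closed_def by blast
    moreover have "rai N \<longleftrightarrow> FdB N"
      using rai_dc_imp_FdB[OF Npos N0 _ \<open>dc N\<close>] FdB_imp_rai[OF \<alpha> L _ N \<epsilon>(1,2) Nlow] L0 by auto
    ultimately show ?thesis using ab bc ca by blast
  qed
  show ?thesis unfolding N_def[symmetric] using ab bc ca de by blast
qed

end
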